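(* There exist sequences of compact Riemann surfaces $S_i$ and $T_i$ of genus $\geq 2$, together with a sequence of branched double covers $f_i:S_i\to T_i$, such that, putting $$\mu_i:=\sup\Big\{\frac{f_i^*ds^2_{T_i}(x)}{ds^2_{S_i}(x)} : x\in S_i\Big\},$$ we have $\lim_{i\to\infty}\mu_i=0$.
   Context: For a compact Riemann surface $C$ of genus $\geq 2$, $ds^2_C$ denotes the Poincaré metric on $C$ of constant Gaussian curvature $-2$. *)

theory Defs
  imports "HOL-Complex_Analysis.Complex_Analysis"
begin

text \<open>Compact Riemann surfaces of genus at least 2 are modelled, via uniformization,
as quotients of the unit disc by torsion-free cocompact Fuchsian groups; holomorphic maps
between them are modelled by equivariant holomorphic lifts to the disc.\<close>

abbreviation disc :: "complex set" where "disc \<equiv> ball 0 1"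

definition disc_moebius :: "complex \<Rightarrow> complex \<Rightarrow> complex \<Rightarrow> complex" where
  "disc_moebius u a = (\<lambda>z. u * (z - a) / (1 - cnj a * z))"

definition disc_automorphisms :: "(complex \<Rightarrow> complex) set" where
  "disc_automorphisms = {disc_moebius u a | u a. norm u = 1 \<and> norm a < 1}"

definition orbit :: "(complex \<Rightarrow> complex) set \<Rightarrow> complex \<Rightarrow> complex set" where
  "orbit \<Gamma> z = {g z | g. g \<in> \<Gamma>}"

text \<open>A torsion-free, cocompact Fuchsian group acting on the disc:
  disc/\<Gamma> is a compact Riemann surface of genus \<ge> 2, and every such surface arises so.\<close>
definition surface_group :: "(complex \<Rightarrow> complex) set \<Rightarrow> bool" where
  "surface_group \<Gamma> \<longleftrightarrow>
     \<Gamma> \<subseteq> disc_automorphisms \<and>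
     id \<in> \<Gamma> \<and>
     (\<forall>g\<in>\<Gamma>. \<forall>h\<in>\<Gamma>. \<exists>k\<in>\<Gamma>. \<forall>z\<in>disc. h (g z) = k z) \<and>
     (\<forall>g\<in>\<Gamma>. \<exists>h\<in>\<Gamma>. \<forall>z\<in>disc. h (g z) = z) \<and>
     (\<forall>g\<in>\<Gamma>. \<forall>z\<in>disc. g z = z \<longrightarrow> (\<forall>w\<in>disc. g w = w)) \<and>
     (\<forall>K. compact K \<and> K \<subseteq> disc \<longrightarrow> finite {g\<in>\<Gamma>. g ` K \<inter> K \<noteq> {}}) \<and>
     (\<exists>K. compact K \<and> K \<subseteq> disc \<and> (\<forall>z\<in>disc. \<exists>g\<in>\<Gamma>. g z \<in> K))"

definition equivariant_lift ::
  "(complex \<Rightarrow> complex) set \<Rightarrow> (complex \<Rightarrow> complex) set \<Rightarrow> (complex \<Rightarrow> complex) \<Rightarrow> bool" where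
  "equivariant_lift \<Gamma>S \<Gamma>T F \<longleftrightarrow>
     F holomorphic_on disc \<and> F ` disc \<subseteq> disc \<and>
     (\<forall>g\<in>\<Gamma>S. \<exists>h\<in>\<Gamma>T. \<forall>z\<in>disc. F (g z) = h (F z))"

definition local_mult :: "(complex \<Rightarrow> complex) \<Rightarrow> complex \<Rightarrow> nat" where
  "local_mult F z = nat (zorder (\<lambda>x. F x - F z) z)"

text \<open>The induced map of quotients is a branched cover of degree 2: every point of the
  target has exactly two preimages counted with multiplicity.\<close>
definition branched_double_cover ::
  "(complex \<Rightarrow> complex) set \<Rightarrow> (complex \<Rightarrow> complex) set \<Rightarrow> (complex \<Rightarrow> complex) \<Rightarrow> bool" where
  "branched_double_cover \<Gamma>S \<Gamma>T F \<longleftrightarrow>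
     equivariant_lift \<Gamma>S \<Gamma>T F \<and>
     (\<forall>w\<in>disc.
        let P = {orbit \<Gamma>S z | z. z \<in> disc \<and> F z \<in> orbit \<Gamma>T w}
        in finite P \<and> (\<Sum>Q\<in>P. local_mult F (SOME z. z \<in> Q)) = 2)"

text \<open>Pointwise ratio f^* ds^2_T / ds^2_S of the Poincare metrics (any fixed curvature,
  the normalising constant cancels), computed on the universal cover.\<close>
definition metric_ratio :: "(complex \<Rightarrow> complex) \<Rightarrow> complex \<Rightarrow> real" where
  "metric_ratio F z = (norm (deriv F z))\<^sup>2 * (1 - (norm z)\<^sup>2)\<^sup>2 / (1 - (norm (F z))\<^sup>2)\<^sup>2"

definition sup_ratio :: "(complex \<Rightarrow> complex) \<Rightarrow> real" where
  "sup_ratio F = (SUP z\<in>disc. metric_ratio F z)"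

end

theory Submission
  imports Defs
begin

text \<open>
  Fix one compact surface \<open>T\<close>, given by an arithmetic group coming from the quaternion algebra
  \<open>(-1, 3 / \<rat>)\<close>. Poincare series of large weight give two automorphic forms \<open>P\<close>, \<open>Q\<close> with nonconstant
  quotient, and a product of forms \<open>P - c Q\<close> is an automorphic form \<open>m\<close> whose simple zeros are as
  dense in \<open>T\<close> as we like. The surface \<open>S\<close> is the double cover of \<open>T\<close> on which \<open>m\<close> has a square root; it
  is branched over the set \<open>B\<close> of zeros of odd order.

  To uniformize \<open>S\<close>, consider the holomorphic self-maps \<open>E\<close> of the disc fixing 0 through which every
  map that is ramified to even order over \<open>B\<close> lifts. By normal families there is one with smallest
  derivative at 0. It is itself ramified to even order over \<open>B\<close>, since otherwise composing it with a
  Blaschke product of degree two would decrease the derivative. This is the universal orbifold cover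
  \<open>F\<close>; its transformation group acts on the square root of \<open>m \<circ> F\<close> through a sign, and the kernel of
  the sign is the group of \<open>S\<close>.

  Finally, if the derivative of \<open>F\<close> in the Poincare metrics were not small at some point, then \<open>F\<close>
  would map a neighbourhood of it without branching onto a disc of definite size, which contains
  points of \<open>B\<close>; but every preimage of such a point is a branch point.
\<close>

section \<open>Holomorphic functions on the unit disc\<close>

text \<open>The surface \<open>S\<close> must be exhibited as a Fuchsian group, so its
  uniformization is constructed. The extremal argument mirrors the square-root trick of the Riemann
  mapping theorem: the class consists of maps that behave like covers, and a smaller derivative at 0
  means a larger cover. A disc about 0 avoiding \<open>B\<close> lifts through every member; this
  bounds the derivatives away from 0 and keeps the limit nonconstant. Paths never occur: covering
  properties are tested by lifting holomorphic maps from the disc, and the lifts of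
  \<open>p + e z\<close> and \<open>p + e z\<^sup>2\<close> recover the local form of
  \<open>F\<close>.

  The sign of the square root does two jobs. Its kernel has index two, which gives the degree of the
  cover; and the half-turn about a branch point has sign -1, because \<open>m\<close> vanishes there
  to odd order, so the kernel has no torsion.

  Only \<open>B\<close> varies. The group of \<open>T\<close>, and with it the radius
  \<open>\<rho>\<close> of a ball that meets all its orbits, is fixed once and for all, so the final
  bound \<open>64 * \<delta> / (1 - \<rho>\<^sup>2)\<^sup>2\<close> is linear in the mesh
  \<open>\<delta>\<close> of \<open>B\<close>.\<close>

lemma open_holomorphic_preimage:
  assumes "f holomorphic_on S" "open S" "open U"
  shows "open {z\<in>S. f z \<in> U}"
proof -
  have "{z\<in>S. f z \<in> U} = S \<inter> f -` U" by auto
  then show ?thesis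
    using continuous_open_preimage[OF holomorphic_on_imp_continuous_on] assms by metis
qed

section \<open>Holomorphic square roots\<close>

lemma square_eq_imp_eq_or_minus:
  assumes "open S" "connected S" "f holomorphic_on S" "g holomorphic_on S"
    and sq: "\<And>z. z \<in> S \<Longrightarrow> (f z)\<^sup>2 = (g z)\<^sup>2"
  shows "(\<forall>z\<in>S. f z = g z) \<or> (\<forall>z\<in>S. f z = - g z)"
proof (rule ccontr)
  assume "\<not> ?thesis"
  then obtain a b where a: "a \<in> S" "f a \<noteq> g a" and b: "b \<in> S" "f b \<noteq> - g b"
    by blast
  define T where "T = {z\<in>S. f z - g z \<noteq> 0}"
  have "open T"
    unfolding T_def
    using open_holomorphic_preimage[of "\<lambda>z. f z - g z" S "-{0}"] assms
    by (simp add: open_Compl holomorphic_on_diff)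
  moreover have "T \<noteq> {}" "T \<subseteq> S"
    using a by (auto simp: T_def)
  moreover have "f z = - g z" if "z \<in> T" for z
  proof -
    have "(f z)\<^sup>2 = (g z)\<^sup>2" using that sq by (auto simp: T_def)
    then show ?thesis using that by (auto simp: power2_eq_iff T_def)
  qed
  ultimately have "f b = - g b"
    using analytic_continuation_open[of T S f "\<lambda>z. - g z" b] assms b
    by (auto intro!: holomorphic_intros)
  with b show False by simp
qed

text \<open>Dividing \<open>f\<close> by the square of the polynomial \<open>p\<close> with the same
  zeros and half the orders leaves a function without zeros, which has a square root on a simply
  connected set. Finiteness of the zero set makes \<open>p\<close> a finite product.\<close>

lemma holomorphic_sqrt_even_zorder_finite:
  assumes holf: "f holomorphic_on S" and S: "open S" "connected S" "simply_connected S"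
    and fin: "finite {z\<in>S. f z = 0}"
    and nz: "a \<in> S" "f a \<noteq> 0"
    and ev: "\<And>z. z \<in> S \<Longrightarrow> even (zorder f z)"
  shows "\<exists>s. s holomorphic_on S \<and> (\<forall>z\<in>S. (s z)\<^sup>2 = f z)"
proof -
  define Z where "Z = {z\<in>S. f z = 0}"
  define n where "n = (\<lambda>z. nat (zorder f z div 2))"
  define p where "p = (\<lambda>z. \<Prod>w\<in>Z. (z - w) ^ n w)"
  have finZ: "finite Z" using fin by (simp add: Z_def)
  have ord: "(if f z = 0 then zorder f z > 0 else zorder f z = 0)" if "z \<in> S" for z
    using zorder_exist_zero[OF holf S(1,2) that] nz by blast
  have npos: "n w > 0" if "w \<in> Z" for w
    using ord[of w] ev[of w] that by (auto simp: Z_def n_def elim!: evenE)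
  have holp: "p holomorphic_on A" for A
    unfolding p_def by (intro holomorphic_intros)
  have p0: "p z = 0 \<longleftrightarrow> z \<in> Z" for z
    using finZ npos by (auto simp: p_def)
  obtain h where h: "h holomorphic_on S" "\<And>z. z \<in> S \<Longrightarrow> h z \<noteq> 0"
    "\<And>z. z \<in> S \<Longrightarrow> f z = h z * (p z)\<^sup>2"
  proof (rule holomorphic_zorder_factorization[of f S "\<lambda>z. (p z)\<^sup>2"])
    show "(\<lambda>z. (p z)\<^sup>2) holomorphic_on S"
      by (intro holomorphic_intros holp)
    show "((p z)\<^sup>2 = 0) = (f z = 0)" if "z \<in> S" for z
      using that p0[of z] by (auto simp: Z_def)
    show "zorder (\<lambda>z. (p z)\<^sup>2) z = zorder f z" if z: "z \<in> S" for z
    proof (cases "z \<in> Z")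
      case False
      then have "zorder (\<lambda>z. (p z)\<^sup>2) z = 0"
        using p0 by (intro zorder_eq_0I analytic_intros analytic_on_holomorphic[THEN iffD2])
           (auto intro!: exI[of _ UNIV] holp)
      moreover have "zorder f z = 0"
        using ord[OF z] False z by (auto simp: Z_def)
      ultimately show ?thesis by simp
    next
      case True
      have "zorder (\<lambda>z. (p z)\<^sup>2) z = 2 * n z"
      proof (rule zorder_eqI[of UNIV z "\<lambda>x. (\<Prod>w\<in>Z-{z}. (x - w) ^ n w)\<^sup>2"])
        show "(\<lambda>x. (\<Prod>w\<in>Z-{z}. (x - w) ^ n w)\<^sup>2) holomorphic_on UNIV"
          by (intro holomorphic_intros)
        show "(\<Prod>w\<in>Z - {z}. (z - w) ^ n w)\<^sup>2 \<noteq> 0"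
          using finZ by auto
        fix w
        have "p w = (w - z) ^ n z * (\<Prod>x\<in>Z - {z}. (w - x) ^ n x)"
          unfolding p_def using prod.remove[OF finZ True] by blast
        then show "(p w)\<^sup>2 = (\<Prod>x\<in>Z - {z}. (w - x) ^ n x)\<^sup>2 * (w - z) powi int (2 * n z)"
          unfolding power_int_of_nat
          by (simp add: power_mult_distrib power_even_eq)
      qed auto
      also have "\<dots> = zorder f z"
        using ord[OF z] ev[OF z] by (auto simp: n_def split: if_splits elim!: evenE)
      finally show ?thesis .
    qed
  qed (use holf S in auto)
  obtain t where t: "t holomorphic_on S" "\<And>z. z \<in> S \<Longrightarrow> h z = (t z)\<^sup>2"
    using simply_connected_imp_holomorphic_sqrt[OF h(1) S(3) _ h(2)] S(1)
      open_imp_locally_path_connected by blast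
  show ?thesis
    using t h by (intro exI[of _ "\<lambda>z. t z * p z"])
      (auto intro!: holomorphic_intros holp simp: power_mult_distrib)
qed

text \<open>The square roots on smaller concentric discs, normalised at one point, patch together.\<close>

lemma holomorphic_sqrt_even_zorder:
  assumes holf: "f holomorphic_on disc"
    and nz: "a \<in> disc" "f a \<noteq> 0"
    and ev: "\<And>z. z \<in> disc \<Longrightarrow> even (zorder f z)"
  obtains s where "s holomorphic_on disc" "\<And>z. z \<in> disc \<Longrightarrow> (s z)\<^sup>2 = f z"
proof -
  define R where "R = {norm a<..<1}"
  have "\<exists>s. s holomorphic_on ball 0 r \<and> (\<forall>z\<in>ball 0 r. (s z)\<^sup>2 = f z) \<and> s a = csqrt (f a)"
    if r: "r \<in> R" for r
  proof -
    have sub: "ball 0 r \<subseteq> disc" "cball 0 r \<subseteq> disc" and ar: "a \<in> ball 0 r"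
      using r by (auto simp: R_def)
    have nc: "f constant_on disc \<Longrightarrow> f z \<noteq> 0" if "z \<in> disc" for z
      using nz that by (auto simp: constant_on_def)
    have "finite {z\<in>cball 0 r. f z = 0}"
    proof (cases "f constant_on disc")
      case True
      then have "{z\<in>cball 0 r. f z = 0} = {}" using sub nc by blast
      then show ?thesis by (metis finite.emptyI)
    next
      case False
      then show ?thesis
        using holomorphic_compact_finite_zeros[OF holf _ _ compact_cball sub(2)] by simp
    qed
    then have fin: "finite {z\<in>ball 0 r. f z = 0}"
      by (rule finite_subset[rotated]) auto
    have "\<exists>s. s holomorphic_on ball 0 r \<and> (\<forall>z\<in>ball 0 r. (s z)\<^sup>2 = f z)"
      using fin ar nz ev sub holomorphic_on_subset[OF holf sub(1)]
      by (intro holomorphic_sqrt_even_zorder_finite[of f "ball 0 r" a] convex_imp_simply_connected)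
         (auto simp: subset_iff)
    then obtain s where s: "s holomorphic_on ball 0 r" "\<forall>z\<in>ball 0 r. (s z)\<^sup>2 = f z"
      by blast
    have "(s a)\<^sup>2 = (csqrt (f a))\<^sup>2" using s ar by simp
    then consider "s a = csqrt (f a)" | "s a = - csqrt (f a)"
      by (metis power2_eq_iff)
    then show ?thesis
    proof cases
      case 1 then show ?thesis using s by blast
    next
      case 2 then show ?thesis using s
        by (intro exI[of _ "\<lambda>z. - s z"]) (auto intro!: holomorphic_intros)
    qed
  qed
  then obtain s where s: "\<And>r. r \<in> R \<Longrightarrow> s r holomorphic_on ball 0 r"
    "\<And>r z. \<lbrakk>r \<in> R; z \<in> ball 0 r\<rbrakk> \<Longrightarrow> (s r z)\<^sup>2 = f z"
    "\<And>r. r \<in> R \<Longrightarrow> s r a = csqrt (f a)"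
    by metis
  have agree: "s r z = s r' z" if "r \<in> R" "r' \<in> R" "r \<le> r'" "z \<in> ball 0 r" for r r' z
  proof -
    have sub: "ball (0::complex) r \<subseteq> ball 0 r'" using that by auto
    have "(\<forall>z\<in>ball 0 r. s r z = s r' z) \<or> (\<forall>z\<in>ball 0 r. s r z = - s r' z)"
      using that sub s holomorphic_on_subset[OF s(1)[OF that(2)] sub]
      by (intro square_eq_imp_eq_or_minus) (auto simp: subset_iff)
    moreover have "a \<in> ball 0 r" "s r a = s r' a" "s r' a \<noteq> 0"
      using that s nz by (auto simp: R_def)
    ultimately show ?thesis using that(4) by auto
  qed
  \<comment> \<open>This radius lies strictly between both norms and 1, so its ball contains
    \<open>z\<close> as well as the normalisation point \<open>a\<close>.\<close>
  define t where "t = (\<lambda>z. s ((1 + max (norm a) (norm z)) / 2) z)"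
  have t_eq: "t z = s r z" if "r \<in> R" "z \<in> ball 0 r" for r z
  proof -
    have "norm z < 1" using that by (auto simp: R_def)
    then have "(1 + max (norm a) (norm z)) / 2 \<in> R" "z \<in> ball 0 ((1 + max (norm a) (norm z)) / 2)"
      using nz by (auto simp: R_def max_def)
    then show ?thesis
      using agree that by (metis linear t_def)
  qed
  have cover: "\<exists>r\<in>R. z \<in> ball 0 r" if "z \<in> disc" for z
    using that nz by (intro bexI[of _ "(1 + max (norm a) (norm z)) / 2"]) (auto simp: R_def max_def)
  have "t holomorphic_on (\<Union>r\<in>R. ball 0 r)"
  proof (rule holomorphic_on_UN_open)
    fix r assume "r \<in> R"
    then show "t holomorphic_on ball 0 r"
      using s(1) t_eq by (metis holomorphic_transform)
  qed auto
  moreover have "(\<Union>r\<in>R. ball 0 r) = disc"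
    using cover by (auto simp: R_def)
  ultimately have "t holomorphic_on disc" by simp
  moreover have "(t z)\<^sup>2 = f z" if "z \<in> disc" for z
    using cover[OF that] t_eq s(2) by metis
  ultimately show ?thesis by (rule that)
qed

section \<open>Self-maps of the disc: limits, unique lifting, covered discs\<close>

lemma compact_subset_disc_bounded:
  assumes "compact K" "K \<subseteq> disc"
  obtains \<rho> where "0 < \<rho>" "\<rho> < 1" "\<And>k. k \<in> K \<Longrightarrow> norm k \<le> \<rho>"
proof (cases "K = {}")
  case True
  then show ?thesis using that[of "1/2"] by auto
next
  case False
  then obtain k0 where k0: "k0 \<in> K" "\<And>k. k \<in> K \<Longrightarrow> norm k \<le> norm k0"
    using continuous_attains_sup[of K norm] assms continuous_on_norm_id by blast
  have "norm k0 < 1" using k0 assms by auto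
  moreover have "norm k \<le> (norm k0 + 1) / 2" if "k \<in> K" for k
    using k0(2)[OF that] \<open>norm k0 < 1\<close> by simp
  ultimately show ?thesis using that[of "(norm k0 + 1)/2"] by (simp add: add_nonneg_pos)
qed

text \<open>The limit has modulus at most 1. By the maximum principle it could reach modulus 1 only
  as a constant, which the single interior value at \<open>a\<close> excludes.\<close>

lemma limit_self_map_disc:
  assumes "\<And>n::nat. \<F> n ` disc \<subseteq> disc" "g holomorphic_on disc"
    and lim: "\<And>z. z \<in> disc \<Longrightarrow> (\<lambda>n. \<F> n z) \<longlonglongrightarrow> g z"
    and "a \<in> disc" "g a \<in> disc"
  shows "g ` disc \<subseteq> disc"
proof -
  have le: "norm (g z) \<le> 1" if "z \<in> disc" for z
  proof (rule LIMSEQ_le_const2)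
    show "(\<lambda>n. norm (\<F> n z)) \<longlonglongrightarrow> norm (g z)"
      by (intro tendsto_norm lim that)
    show "\<exists>N. \<forall>n\<ge>N. norm (\<F> n z) \<le> 1"
    proof (intro exI allI impI)
      fix n
      have "\<F> n z \<in> disc" using assms(1)[of n] that by blast
      then show "norm (\<F> n z) \<le> 1" by simp
    qed
  qed
  show ?thesis
  proof (rule ccontr)
    assume "\<not> ?thesis"
    then obtain z where z: "z \<in> disc" "norm (g z) \<ge> 1" by force
    have "g constant_on disc"
    proof (rule maximum_modulus_principle[OF assms(2) _ _ _ _ z(1)])
      show "norm (g w) \<le> norm (g z)" if "w \<in> disc" for w
        using le[OF that] z by linarith
    qed auto
    then have "g z = g a"
      using z assms by (auto simp: constant_on_def)
    then show False using z assms by auto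
  qed
qed

text \<open>\<open>F\<close> is injective near \<open>A z0\<close>, so \<open>A\<close> and
  \<open>B\<close> agree near \<open>z0\<close>, and the identity theorem does the rest. This takes
  the place of unique path lifting; the base point must not be critical for \<open>F\<close>,
  although other points may be.\<close>

lemma lift_unique:
  assumes F: "F holomorphic_on disc" and S: "open S" "connected S"
    and A: "A holomorphic_on S" "A ` S \<subseteq> disc"
    and B: "B holomorphic_on S" "B ` S \<subseteq> disc"
    and eq: "\<And>z. z \<in> S \<Longrightarrow> F (A z) = F (B z)"
    and z0: "z0 \<in> S" "A z0 = B z0" "deriv F (A z0) \<noteq> 0"
    and z: "z \<in> S"
  shows "A z = B z"
proof -
  obtain r where r: "r > 0" "ball (A z0) r \<subseteq> disc" "inj_on F (ball (A z0) r)"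
    using has_complex_derivative_locally_injective[OF F, of "A z0"] A(2) z0 by blast
  define T where "T = {x\<in>S. A x \<in> ball (A z0) r} \<inter> {x\<in>S. B x \<in> ball (A z0) r}"
  have "open T"
    unfolding T_def
    using A B S by (intro open_Int open_holomorphic_preimage) auto
  moreover have "z0 \<in> T" "T \<subseteq> S"
    using z0 r by (auto simp: T_def)
  moreover have "A x = B x" if "x \<in> T" for x
    using r(3) that eq by (auto simp: T_def inj_on_def)
  ultimately show ?thesis
    using analytic_continuation_open[of T S A B z] assms by blast
qed

lemma norm_deriv_deriv_le:
  assumes f: "f holomorphic_on disc" "f ` disc \<subseteq> disc" and z: "norm z \<le> 1/4"
  shows "norm ((deriv ^^ 2) f z) \<le> 8"
proof -
  have sub: "cball z (1/2) \<subseteq> disc"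
  proof
    fix x assume "x \<in> cball z (1/2)"
    then have "norm (x - z) \<le> 1/2" by (simp add: dist_norm norm_minus_commute)
    then have "norm x \<le> 3/4" using z norm_triangle_ineq2[of x z] by linarith
    then show "x \<in> disc" by simp
  qed
  have "norm ((deriv ^^ 2) f z) \<le> fact 2 * 1 / (1/2)^2"
  proof (rule Cauchy_inequality[where f=f and n=2 and r="1/2" and B=1])
    show "f holomorphic_on ball z (1/2)"
      by (rule holomorphic_on_subset[OF f(1) subset_trans[OF ball_subset_cball sub]])
    show "continuous_on (cball z (1/2)) f"
      by (rule holomorphic_on_imp_continuous_on[OF holomorphic_on_subset[OF f(1) sub]])
    show "norm (f x) \<le> 1" if "norm (z - x) = 1/2" for x
    proof -
      have "x \<in> cball z (1/2)" using that by (simp add: dist_norm)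
      then have "f x \<in> disc" using sub f by blast
      then show ?thesis by simp
    qed
  qed auto
  then show ?thesis by (simp add: power2_eq_square)
qed

text \<open>A covering theorem of Bloch type. With \<open>c = norm (deriv f 0)\<close>, the
  derivative varies by at most \<open>c/2\<close> on the disc of radius \<open>r = c/16\<close>, so
  it has no zero there and \<open>f\<close> moves boundary points by at least
  \<open>c/2 * r\<close>. The disc is covered by values at noncritical points, which matters because
  all points over \<open>B\<close> will be critical.\<close>

lemma ball_subset_regular_values:
  assumes f: "f holomorphic_on disc" "f ` disc \<subseteq> disc"
  shows "ball (f 0) ((norm (deriv f 0))\<^sup>2 / 64) \<subseteq> f ` {z\<in>disc. deriv f z \<noteq> 0}"
proof (cases "deriv f 0 = 0")
  case False
  define c where "c = norm (deriv f 0)"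
  have c: "c > 0" using False by (simp add: c_def)
  have "norm ((deriv ^^ 1) f 0) \<le> fact 1 * 1 / (1/2)^1"
  proof (rule Cauchy_inequality[where f=f and n=1 and r="1/2" and B=1])
    show "f holomorphic_on ball 0 (1/2)"
      using f by (rule_tac holomorphic_on_subset) auto
    show "continuous_on (cball 0 (1/2)) f"
      by (rule holomorphic_on_imp_continuous_on, rule holomorphic_on_subset[OF f(1)]) auto
    show "norm (f x) \<le> 1" if "norm (0 - x) = 1/2" for x
    proof -
      have "x \<in> disc" using that by simp
      then have "f x \<in> disc" using f(2) by blast
      then show ?thesis by simp
    qed
  qed auto
  then have c2: "c \<le> 2" by (simp add: c_def)
  \<comment> \<open>The bound 8 on the second derivative turns this radius into the variation
    \<open>c/2\<close>. As \<open>c \<le> 2\<close>, it stays below 1/4, where that bound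
    holds.\<close>
  define r where "r = c / 16"
  have r: "r > 0" "r \<le> 1/8" using c c2 by (auto simp: r_def)
  have hold: "deriv f holomorphic_on disc"
    using f by (intro holomorphic_deriv) auto
  have d1: "norm (deriv f z - deriv f 0) \<le> c/2" if "norm z \<le> r" for z
  proof -
    have "norm (deriv f z - deriv f 0) \<le> 8 * norm (z - 0)"
    proof (rule field_differentiable_bound[of "cball 0 r" "deriv f" "deriv (deriv f)"])
      fix x :: complex assume x: "x \<in> cball 0 r"
      then have "x \<in> disc" using r by auto
      then show "(deriv f has_field_derivative deriv (deriv f) x) (at x within cball 0 r)"
        using hold holomorphic_derivI[of "deriv f" disc x] has_field_derivative_at_within by blast
      show "norm (deriv (deriv f) x) \<le> 8"
        using norm_deriv_deriv_le[OF f, of x] x r by (simp add: numeral_2_eq_2)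
    qed (use that r in auto)
    also have "\<dots> \<le> 8 * r" using that by simp
    finally show ?thesis by (simp add: r_def)
  qed
  have nz: "deriv f z \<noteq> 0" if "norm z \<le> r" for z
    using d1[OF that] c by (auto simp: c_def)
  have lower: "norm (f z - f 0) \<ge> c/2 * norm z" if "norm z \<le> r" for z
  proof -
    have "norm ((f z - deriv f 0 * z) - (f 0 - deriv f 0 * 0)) \<le> c/2 * norm (z - 0)"
    proof (rule field_differentiable_bound[of "cball 0 r" "\<lambda>z. f z - deriv f 0 * z" "\<lambda>z. deriv f z - deriv f 0"])
      fix x :: complex assume x: "x \<in> cball 0 r"
      then have "x \<in> disc" using r by auto
      then have "(f has_field_derivative deriv f x) (at x within cball 0 r)"
        using f(1) holomorphic_derivI[of f disc x] has_field_derivative_at_within by blast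
      then show "((\<lambda>z. f z - deriv f 0 * z) has_field_derivative deriv f x - deriv f 0) (at x within cball 0 r)"
        by (auto intro!: derivative_eq_intros)
      show "norm (deriv f x - deriv f 0) \<le> c/2" using d1 x by simp
    qed (use that r in auto)
    then have "norm ((f z - f 0) - deriv f 0 * z) \<le> c/2 * norm z"
      by (simp add: algebra_simps)
    moreover have "norm (deriv f 0 * z) = c * norm z"
      by (simp add: c_def norm_mult)
    moreover have "norm (deriv f 0 * z) \<le> norm (f z - f 0) + norm ((f z - f 0) - deriv f 0 * z)"
      by (metis norm_triangle_sub norm_minus_commute add.commute)
    ultimately show ?thesis by linarith
  qed
  have "ball (f 0) (c/2 * r) \<subseteq> f ` cball 0 r"
  proof (rule ball_subset_open_map_image)
    show "continuous_on (closure (cball 0 r)) f"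
      using r by (intro holomorphic_on_imp_continuous_on holomorphic_on_subset[OF f(1)]) auto
    have nc: "\<not> f constant_on disc"
    proof
      assume "f constant_on disc"
      then have "f r = f 0" using r by (auto simp: constant_on_def)
      then have "c * r \<le> 0" using lower[of r] r by simp
      then show False using r c by (simp add: mult_le_0_iff)
    qed
    have "open (f ` ball 0 r)"
      using r by (intro open_mapping_thm[OF f(1) open_ball connected_ball open_ball _ nc]) auto
    then show "open (f ` interior (cball 0 r))"
      by simp
    show "c / 2 * r \<le> norm (f z - f 0)" if "z \<in> frontier (cball 0 r)" for z
      using lower[of z] that r by (auto simp: dist_norm)
  qed (use r c in auto)
  moreover have "ball (f 0) (c\<^sup>2/64) \<subseteq> ball (f 0) (c/2 * r)"
    by (rule subset_ball) (simp add: r_def power2_eq_square)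
  moreover have "f ` cball 0 r \<subseteq> f ` {z\<in>disc. deriv f z \<noteq> 0}"
    using nz r by auto
  ultimately show ?thesis unfolding c_def by blast
qed auto


section \<open>Automorphisms of the disc\<close>

lemma one_minus_mult_nz:
  fixes a z :: complex
  assumes "norm a < 1" "norm z < 1"
  shows "1 - cnj a * z \<noteq> 0"
proof
  assume "1 - cnj a * z = 0"
  then have "norm a * norm z = 1"
    by (metis complex_mod_cnj eq_iff_diff_eq_0 norm_mult norm_one)
  then show False
    using mult_strict_mono[of "norm a" 1 "norm z" 1] assms by auto
qed

lemma one_minus_norm_disc_moebius:
  assumes "norm u = 1" "norm a < 1" "norm z < 1"
  shows "1 - (norm (disc_moebius u a z))\<^sup>2 = (1 - (norm a)\<^sup>2) * (1 - (norm z)\<^sup>2) / (norm (1 - cnj a * z))\<^sup>2"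
proof -
  have nz: "1 - cnj a * z \<noteq> 0" using one_minus_mult_nz assms by blast
  have "(norm (1 - cnj a * z))\<^sup>2 - (norm (z - a))\<^sup>2 = (1 - (norm a)\<^sup>2) * (1 - (norm z)\<^sup>2)"
    unfolding cmod_power2 by (simp add: algebra_simps power2_eq_square)
  moreover have "1 - (norm (disc_moebius u a z))\<^sup>2 = ((norm (1 - cnj a * z))\<^sup>2 - (norm (z - a))\<^sup>2) / (norm (1 - cnj a * z))\<^sup>2"
    using nz assms by (simp add: disc_moebius_def norm_mult norm_divide power_divide diff_divide_distrib)
  ultimately show ?thesis by simp
qed

lemma disc_moebius_in_disc:
  assumes "norm u = 1" "norm a < 1" "z \<in> disc"
  shows "disc_moebius u a z \<in> disc"
proof -
  have z: "norm z < 1" using assms by simp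
  have "0 < (1 - (norm a)\<^sup>2) * (1 - (norm z)\<^sup>2) / (norm (1 - cnj a * z))\<^sup>2"
    using one_minus_mult_nz[OF assms(2) z] assms z by (simp add: power_less_one_iff abs_square_less_1)
  then have "(norm (disc_moebius u a z))\<^sup>2 < 1"
    using one_minus_norm_disc_moebius[OF assms(1,2) z] by linarith
  then show ?thesis by (simp add: abs_square_less_1)
qed

lemma disc_moebius_holomorphic:
  assumes "norm a < 1"
  shows "disc_moebius u a holomorphic_on disc"
  unfolding disc_moebius_def using one_minus_mult_nz[OF assms]
  by (intro holomorphic_intros) auto

lemma disc_moebius_inverse:
  assumes "norm u = 1" "norm a < 1" "z \<in> disc"
  shows "disc_moebius (cnj u) (- (u * a)) (disc_moebius u a z) = z"
proof -
  have u: "cnj u * u = 1" "u * cnj u = 1"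
    using assms(1) by (simp_all add: complex_norm_square[symmetric] mult.commute)
  have d: "1 - cnj a * z \<noteq> 0" using one_minus_mult_nz[of a z] assms by simp
  have n: "1 - cnj a * a \<noteq> 0" using one_minus_mult_nz[of a a] assms by simp
  have 1: "disc_moebius u a z + u * a = u * z * (1 - cnj a * a) / (1 - cnj a * z)"
    using d by (simp add: disc_moebius_def field_simps)
  have 2: "1 + cnj u * cnj a * disc_moebius u a z = (1 - cnj a * a) / (1 - cnj a * z)"
  proof -
    have "cnj u * cnj a * disc_moebius u a z = cnj a * (cnj u * u) * (z - a) / (1 - cnj a * z)"
      by (simp add: disc_moebius_def algebra_simps)
    also have "\<dots> = cnj a * (z - a) / (1 - cnj a * z)" by (simp add: u)
    finally show ?thesis using d by (simp add: field_simps)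
  qed
  have "disc_moebius (cnj u) (- (u * a)) (disc_moebius u a z)
      = cnj u * (disc_moebius u a z + u * a) / (1 + cnj u * cnj a * disc_moebius u a z)"
    by (simp add: disc_moebius_def[of "cnj u"])
  also have "\<dots> = cnj u * u * z"
    unfolding 1 2 using d n by simp
  finally show ?thesis using u by simp
qed

lemma holomorphic_compose_disc:
  assumes "f holomorphic_on S" "f ` S \<subseteq> disc" "g holomorphic_on disc"
  shows "(\<lambda>z. g (f z)) holomorphic_on S"
  using holomorphic_on_compose_gen[OF assms(1,3,2)] by (simp add: o_def)

lemma disc_automorphisms_holomorphic: "g \<in> disc_automorphisms \<Longrightarrow> g holomorphic_on disc"
  unfolding disc_automorphisms_def
  by (elim CollectE exE conjE, hypsubst) (rule disc_moebius_holomorphic)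

lemma disc_automorphisms_in_disc: "g \<in> disc_automorphisms \<Longrightarrow> z \<in> disc \<Longrightarrow> g z \<in> disc"
  unfolding disc_automorphisms_def
  by (elim CollectE exE conjE, hypsubst) (rule disc_moebius_in_disc)

lemma id_in_disc_automorphisms: "id \<in> disc_automorphisms"
  unfolding disc_automorphisms_def
  by (rule CollectI, rule exI[of _ 1], rule exI[of _ 0]) (simp add: disc_moebius_def fun_eq_iff)

lemma disc_automorphism_inverse:
  assumes "g \<in> disc_automorphisms"
  obtains h where "h \<in> disc_automorphisms" "\<And>z. z \<in> disc \<Longrightarrow> h (g z) = z" "\<And>z. z \<in> disc \<Longrightarrow> g (h z) = z"
proof -
  obtain u a where g: "g = disc_moebius u a" "norm u = 1" "norm a < 1"
    using assms by (auto simp: disc_automorphisms_def)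
  have u: "cnj u * u = 1"
    using g(2) by (simp add: complex_norm_square[symmetric] mult.commute)
  then have ua: "cnj u * (u * a) = a" by (simp only: mult.assoc[symmetric] mult_1_left)
  have "disc_moebius u a (disc_moebius (cnj u) (- (u * a)) z) = z" if "z \<in> disc" for z
    using disc_moebius_inverse[of "cnj u" "- (u * a)" z] g that
    by (simp only: mult_minus_right ua complex_cnj_cnj minus_minus) (simp add: norm_mult)
  moreover have "disc_moebius (cnj u) (- (u * a)) \<in> disc_automorphisms"
    unfolding disc_automorphisms_def using g
    by (intro CollectI exI[of _ "cnj u"] exI[of _ "- (u * a)"]) (simp add: norm_mult)
  ultimately show ?thesis
    using that g(1) disc_moebius_inverse[OF g(2,3)] by blast
qed

text \<open>The zero of the map determines \<open>a\<close>, and one further value determines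
  \<open>u\<close>. Group elements are functions on the whole plane, so equality on the disc has to
  be upgraded before elements can be counted.\<close>

lemma disc_automorphism_eqI:
  assumes "g \<in> disc_automorphisms" "h \<in> disc_automorphisms" "\<And>z. z \<in> disc \<Longrightarrow> g z = h z"
  shows "g = h"
proof -
  obtain u a where g: "g = disc_moebius u a" "norm u = 1" "norm a < 1"
    using assms by (auto simp: disc_automorphisms_def)
  obtain v b where h: "h = disc_moebius v b" "norm v = 1" "norm b < 1"
    using assms by (auto simp: disc_automorphisms_def)
  have uv: "u \<noteq> 0" "v \<noteq> 0" using g h by auto
  have "h a = 0" using assms(3)[of a] g by (simp add: disc_moebius_def)
  then have ab: "a = b"
    using h uv one_minus_mult_nz[of b a] g by (auto simp: disc_moebius_def)
  have "u = v"
  proof (cases "a = 0")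
    case True
    then show ?thesis using assms(3)[of "1/2"] g h ab by (simp add: disc_moebius_def)
  next
    case False
    then show ?thesis using assms(3)[of 0] g h ab by (simp add: disc_moebius_def)
  qed
  then show ?thesis using g h ab by simp
qed

text \<open>After moving \<open>k 0\<close> to 0, the Schwarz lemma for the map and for its inverse
  shows that moduli are preserved, so the map is a rotation.\<close>

lemma biholomorphism_is_disc_automorphism:
  assumes f: "f holomorphic_on disc" "f ` disc \<subseteq> disc"
    and k: "k holomorphic_on disc" "k ` disc \<subseteq> disc"
    and fk: "\<And>z. z \<in> disc \<Longrightarrow> f (k z) = z" and kf: "\<And>z. z \<in> disc \<Longrightarrow> k (f z) = z"
  obtains g where "g \<in> disc_automorphisms" "\<And>z. z \<in> disc \<Longrightarrow> f z = g z"
proof -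
  define a where "a = k 0"
  have a: "norm a < 1" using k(2) by (auto simp: a_def image_subset_iff)
  have da: "disc_moebius 1 a \<in> disc_automorphisms"
    using a norm_one unfolding disc_automorphisms_def by blast
  obtain M where M: "M \<in> disc_automorphisms" "\<And>z. z \<in> disc \<Longrightarrow> M (disc_moebius 1 a z) = z"
     "\<And>z. z \<in> disc \<Longrightarrow> disc_moebius 1 a (M z) = z"
    using disc_automorphism_inverse[OF da] by blast
  have M0: "M 0 = a" using M(2)[of a] a by (simp add: disc_moebius_def)
  define p where "p = (\<lambda>z. f (M z))"
  define q where "q = (\<lambda>z. disc_moebius 1 a (k z))"
  have p: "p holomorphic_on disc" "p ` disc \<subseteq> disc"
    unfolding p_def using disc_automorphisms_in_disc[OF M(1)] f
    by (auto intro!: holomorphic_compose_disc[OF disc_automorphisms_holomorphic[OF M(1)]] simp: image_subset_iff)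
  have q: "q holomorphic_on disc" "q ` disc \<subseteq> disc"
    unfolding q_def using disc_automorphisms_in_disc[OF da] k
    by (auto intro!: holomorphic_compose_disc[OF k] disc_automorphisms_holomorphic[OF da] simp: image_subset_iff)
  have p0: "p 0 = 0" and q0: "q 0 = 0"
    using fk[of 0] by (auto simp: p_def q_def M0 a_def disc_moebius_def)
  have qp: "q (p z) = z" if "z \<in> disc" for z
    using kf[of "M z"] M that disc_automorphisms_in_disc[OF M(1) that] by (simp add: p_def q_def)
  have "norm (p z) \<le> norm z" "norm (q z) \<le> norm z" if "z \<in> disc" for z
    using Schwarz_Lemma(1)[OF p(1) p0, of z] Schwarz_Lemma(1)[OF q(1) q0, of z] p(2) q(2) that
    by (auto simp: image_subset_iff)
  then have "norm (p z) = norm z" if "z \<in> disc" for z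
    using qp[OF that] that p(2) by (metis image_subset_iff order_antisym)
  then have "norm (p (1/2)) = norm (1/2 :: complex)" by simp
  then have "\<exists>\<alpha>. (\<forall>z. norm z < 1 \<longrightarrow> p z = \<alpha> * z) \<and> norm \<alpha> = 1"
    using p by (intro Schwarz_Lemma(3)[OF p(1) p0, of 0] disjI1 exI[of _ "1/2"]) (auto simp: image_subset_iff)
  then obtain u where u: "\<And>z. norm z < 1 \<Longrightarrow> p z = u * z" "norm u = 1" by blast
  have "f z = disc_moebius u a z" if "z \<in> disc" for z
  proof -
    have "f z = p (disc_moebius 1 a z)" using M(2) that by (simp add: p_def)
    also have "\<dots> = u * disc_moebius 1 a z"
      using u disc_automorphisms_in_disc[OF da that] by simp
    finally show ?thesis by (simp add: disc_moebius_def)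
  qed
  then show ?thesis using that[of "disc_moebius u a"] u a by (auto simp: disc_automorphisms_def)
qed

lemma disc_automorphism_compose:
  assumes "g \<in> disc_automorphisms" "h \<in> disc_automorphisms"
  obtains k where "k \<in> disc_automorphisms" "\<And>z. z \<in> disc \<Longrightarrow> h (g z) = k z"
proof -
  obtain g' where g': "g' \<in> disc_automorphisms" "\<And>z. z \<in> disc \<Longrightarrow> g' (g z) = z" "\<And>z. z \<in> disc \<Longrightarrow> g (g' z) = z"
    using disc_automorphism_inverse[OF assms(1)] by blast
  obtain h' where h': "h' \<in> disc_automorphisms" "\<And>z. z \<in> disc \<Longrightarrow> h' (h z) = z" "\<And>z. z \<in> disc \<Longrightarrow> h (h' z) = z"
    using disc_automorphism_inverse[OF assms(2)] by blast
  note D = disc_automorphisms_in_disc and H = disc_automorphisms_holomorphic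
  show ?thesis
  proof (rule biholomorphism_is_disc_automorphism[of "\<lambda>z. h (g z)" "\<lambda>z. g' (h' z)"])
    show "(\<lambda>z. h (g z)) holomorphic_on disc"
      by (rule holomorphic_compose_disc[OF H[OF assms(1)] _ H[OF assms(2)]]) (use D assms in blast)
    show "(\<lambda>z. g' (h' z)) holomorphic_on disc"
      by (rule holomorphic_compose_disc[OF H[OF h'(1)] _ H[OF g'(1)]]) (use D h' in blast)
    show "(\<lambda>z. h (g z)) ` disc \<subseteq> disc" using D assms by blast
    show "(\<lambda>z. g' (h' z)) ` disc \<subseteq> disc" using D g' h' by blast
    show "h (g (g' (h' z))) = z" if "z \<in> disc" for z
      using that g' h' D by metis
    show "g' (h' (h (g z))) = z" if "z \<in> disc" for z
      using that g' h' D assms by metis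
  qed (use that in blast)
qed

section \<open>The universal cover of the disc branched to order two\<close>

text \<open>The square roots say that \<open>G\<close> is ramified to even order over the points of \<open>B\<close>; in this form
  the condition passes to limits without an argument on zeros.\<close>

definition orbifold_map :: "complex set \<Rightarrow> (complex \<Rightarrow> complex) \<Rightarrow> bool" where
  "orbifold_map B G \<longleftrightarrow> G holomorphic_on disc \<and> G ` disc \<subseteq> disc \<and>
     (\<forall>b\<in>B. \<exists>r. r holomorphic_on disc \<and> (\<forall>z\<in>disc. (r z)\<^sup>2 = G z - b))"

text \<open>The covering property relative to \<open>B\<close>, stated for test maps from the disc.
  Only maps ramified to even order over \<open>B\<close> must lift, so \<open>E\<close> itself may
  be ramified there. The points \<open>z\<close> and \<open>w\<close> of the fibre are arbitrary;
  this freedom later yields transitivity on fibres. \<open>E 0 = 0\<close> normalises the extremal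
  problem.\<close>

definition lifts_orbifold_maps :: "complex set \<Rightarrow> (complex \<Rightarrow> complex) \<Rightarrow> bool" where
  "lifts_orbifold_maps B E \<longleftrightarrow> E holomorphic_on disc \<and> E ` disc \<subseteq> disc \<and> E 0 = 0 \<and>
     (\<forall>G. \<forall>z\<in>disc. \<forall>w\<in>disc. orbifold_map B G \<and> G z = E w \<longrightarrow>
        (\<exists>H. H holomorphic_on disc \<and> H ` disc \<subseteq> disc \<and> H z = w \<and> (\<forall>x\<in>disc. E (H x) = G x)))"

lemma lifts_orbifold_mapsD:
  assumes "lifts_orbifold_maps B E"
  shows "E holomorphic_on disc" "E ` disc \<subseteq> disc" "E 0 = 0"
    "\<And>G z w. \<lbrakk>z \<in> disc; w \<in> disc; orbifold_map B G; G z = E w\<rbrakk> \<Longrightarrow>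
       \<exists>H. H holomorphic_on disc \<and> H ` disc \<subseteq> disc \<and> H z = w \<and> (\<forall>x\<in>disc. E (H x) = G x)"
  using assms unfolding lifts_orbifold_maps_def by blast+

lemma disc_holomorphic_sqrt:
  assumes "f holomorphic_on disc" "\<And>z. z \<in> disc \<Longrightarrow> f z \<noteq> 0"
  obtains s where "s holomorphic_on disc" "\<And>z. z \<in> disc \<Longrightarrow> (s z)\<^sup>2 = f z"
proof -
  have "contractible disc"
    by (simp add: convex_imp_contractible)
  then obtain g where "g holomorphic_on disc" "\<And>z. z \<in> disc \<Longrightarrow> f z = (g z)\<^sup>2"
    using contractible_imp_holomorphic_sqrt[OF assms(1) _ assms(2)] by blast
  then show ?thesis using that by metis
qed

lemma scaled_in_ball:
  fixes p z :: complex
  assumes "e > 0" "z \<in> disc"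
  shows "p + of_real e * z \<in> ball p e" "p + of_real e * z\<^sup>2 \<in> ball p e"
proof -
  have "norm (z\<^sup>2) < 1"
    using assms(2) by (simp add: norm_power power_less_one_iff)
  then show "p + of_real e * z \<in> ball p e" "p + of_real e * z\<^sup>2 \<in> ball p e"
    using assms by (auto simp: dist_norm norm_mult)
qed

lemma orbifold_map_affine:
  assumes e: "e > 0" and sub: "ball p e \<subseteq> disc" and B: "ball p e \<inter> B = {}"
  shows "orbifold_map B (\<lambda>z. p + of_real e * z)"
proof -
  have "\<exists>r. r holomorphic_on disc \<and> (\<forall>z\<in>disc. (r z)\<^sup>2 = p + of_real e * z - b)" if "b \<in> B" for b
  proof (rule disc_holomorphic_sqrt[of "\<lambda>z. p + of_real e * z - b"])
    show "(\<lambda>z. p + of_real e * z - b) holomorphic_on disc" by (intro holomorphic_intros)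
    show "p + of_real e * z - b \<noteq> 0" if "z \<in> disc" for z
      using scaled_in_ball(1)[OF e that, of p] B \<open>b \<in> B\<close> by (auto simp del: mem_ball)
  qed blast
  moreover have "(\<lambda>z. p + of_real e * z) ` disc \<subseteq> disc"
    using scaled_in_ball(1)[OF e] sub by blast
  ultimately show ?thesis
    unfolding orbifold_map_def by (auto intro!: holomorphic_intros simp del: mem_ball)
qed

text \<open>The local model at a branch point. It is an orbifold map whether or not \<open>p\<close>
  belongs to \<open>B\<close>, so it can be used without knowing which case occurs.\<close>

lemma orbifold_map_square:
  assumes e: "e > 0" and sub: "ball p e \<subseteq> disc" and B: "ball p e \<inter> B \<subseteq> {p}"
  shows "orbifold_map B (\<lambda>z. p + of_real e * z\<^sup>2)"
proof -
  have "\<exists>r. r holomorphic_on disc \<and> (\<forall>z\<in>disc. (r z)\<^sup>2 = p + of_real e * z\<^sup>2 - b)" if "b \<in> B" for b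
  proof (cases "b = p")
    case True
    show ?thesis
      using e True by (intro exI[of _ "\<lambda>z. of_real (sqrt e) * z"])
        (auto intro!: holomorphic_intros simp: power_mult_distrib simp flip: of_real_power)
  next
    case False
    show ?thesis
    proof (rule disc_holomorphic_sqrt[of "\<lambda>z. p + of_real e * z\<^sup>2 - b"])
      show "(\<lambda>z. p + of_real e * z\<^sup>2 - b) holomorphic_on disc" by (intro holomorphic_intros)
      show "p + of_real e * z\<^sup>2 - b \<noteq> 0" if "z \<in> disc" for z
      proof
        assume "p + of_real e * z\<^sup>2 - b = 0"
        then have "b \<in> ball p e" using scaled_in_ball(2)[OF e that, of p] by simp
        then show False using B \<open>b \<in> B\<close> False by blast
      qed
    qed blast
  qed
  moreover have "(\<lambda>z. p + of_real e * z\<^sup>2) ` disc \<subseteq> disc"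
    using scaled_in_ball(2)[OF e] sub by blast
  ultimately show ?thesis
    unfolding orbifold_map_def by (auto intro!: holomorphic_intros simp del: mem_ball)
qed

text \<open>The scaling by \<open>e\<close> lifts to a self-map \<open>H\<close> of the disc fixing
  0, and \<open>deriv E 0 * deriv H 0 = e\<close> with the second factor of modulus at most 1 by the
  Schwarz lemma. This makes the infimum of the extremal problem positive.\<close>

lemma lifts_orbifold_maps_deriv_ge:
  assumes E: "lifts_orbifold_maps B E" and e: "0 < e" "e \<le> 1" "ball 0 e \<inter> B = {}"
  shows "norm (deriv E 0) \<ge> e"
proof -
  have hol: "E holomorphic_on disc" "E 0 = 0" using E by (auto simp: lifts_orbifold_maps_def)
  have "ball (0::complex) e \<subseteq> disc" using e by auto
  then have "orbifold_map B (\<lambda>z. 0 + of_real e * z)"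
    using e by (intro orbifold_map_affine) auto
  then obtain H where H: "H holomorphic_on disc" "H ` disc \<subseteq> disc" "H 0 = 0" 
    "\<And>x. x \<in> disc \<Longrightarrow> E (H x) = 0 + of_real e * x"
    using E hol(2) unfolding lifts_orbifold_maps_def
    by (metis (no_types, lifting) add.right_neutral centre_in_ball mult_zero_right zero_less_one)
  have dH: "(H has_field_derivative deriv H 0) (at 0)"
    using H(1) by (intro holomorphic_derivI[of H disc]) auto
  have dE: "(E has_field_derivative deriv E 0) (at (H 0))"
    using hol H(3) holomorphic_derivI[of E disc 0] by auto
  have "((\<lambda>x. E (H x)) has_field_derivative deriv E 0 * deriv H 0) (at 0)"
    using DERIV_chain2[OF dE dH] .
  moreover have "((\<lambda>x. E (H x)) has_field_derivative of_real e) (at 0)"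
  proof (rule has_field_derivative_transform_within_open[of "\<lambda>x. of_real e * x"])
    show "((\<lambda>x. of_real e * x) has_field_derivative of_real e) (at (0::complex))"
      by (auto intro!: derivative_eq_intros)
    show "of_real e * x = E (H x)" if "x \<in> disc" for x
      using H(4)[OF that] by simp
  qed auto
  ultimately have "deriv E 0 * deriv H 0 = of_real e"
    using DERIV_unique by blast
  then have eq: "norm (deriv E 0) * norm (deriv H 0) = e"
    using e by (metis norm_mult norm_of_real abs_of_pos)
  have "norm (deriv H 0) \<le> 1"
    using H(2) by (intro Schwarz_Lemma(2)[OF H(1,3), of 0]) (auto simp: image_subset_iff)
  then have "norm (deriv E 0) * norm (deriv H 0) \<le> norm (deriv E 0) * 1"
    by (intro mult_left_mono) auto
  then show ?thesis using eq by simp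
qed

text \<open>\<open>q\<close> is the Blaschke product of degree two branched over \<open>c\<close>.\<close>

lemma disc_double_cover_branched_at:
  assumes c: "c \<in> disc"
  obtains q where "q holomorphic_on disc" "q ` disc \<subseteq> disc" "q 0 = 0" "norm (deriv q 0) < 1"
    "\<And>H z w. \<lbrakk>H holomorphic_on disc; H ` disc \<subseteq> disc;
       \<exists>r. r holomorphic_on disc \<and> (\<forall>x\<in>disc. (r x)\<^sup>2 = H x - c); z \<in> disc; w \<in> disc; H z = q w\<rbrakk> \<Longrightarrow>
       \<exists>K. K holomorphic_on disc \<and> K ` disc \<subseteq> disc \<and> K z = w \<and> (\<forall>x\<in>disc. q (K x) = H x)"
proof -
  \<comment> \<open>The map \<open>q\<close> is the squaring map conjugated by the two Moebius maps
    for \<open>a\<close> and \<open>- c\<close>. Since \<open>M a 0 = - a\<close>, this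
    \<open>a\<close> gives \<open>q 0 = 0\<close>; the critical point \<open>a\<close> is sent to
    \<open>c\<close>.\<close>
  define a where "a = csqrt (- c)"
  have a2: "a\<^sup>2 = - c" by (simp add: a_def)
  have c1: "norm c < 1" using c by simp
  have a1: "norm a < 1"
  proof -
    have "(norm a)\<^sup>2 < 1" using a2 c1 by (metis norm_minus_cancel norm_power)
    then show ?thesis by (simp add: abs_square_less_1)
  qed
  define M where "M = disc_moebius 1"
  have Mdisc: "M b x \<in> disc" if "norm b < 1" "x \<in> disc" for b x
    unfolding M_def by (rule disc_moebius_in_disc) (use that in auto)
  have Minv: "M (- b) (M b x) = x" "M b (M (- b) x) = x" if "norm b < 1" "x \<in> disc" for b x
    using disc_moebius_inverse[of 1 b x] disc_moebius_inverse[of 1 "-b" x] that by (auto simp: M_def)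
  have Mhol: "M b holomorphic_on disc" if "norm b < 1" for b
    unfolding M_def by (rule disc_moebius_holomorphic[OF that])
  have sqdisc: "x\<^sup>2 \<in> disc \<longleftrightarrow> x \<in> disc" for x :: complex
    by (simp add: norm_power abs_square_less_1)
  define q where "q = (\<lambda>z. M (- c) ((M a z)\<^sup>2))"
  have "(\<lambda>z. (M a z)\<^sup>2) holomorphic_on disc" by (intro holomorphic_intros Mhol a1)
  moreover have "(\<lambda>z. (M a z)\<^sup>2) ` disc \<subseteq> disc" using Mdisc[OF a1] sqdisc by blast
  moreover have "M (- c) holomorphic_on disc" using c1 by (intro Mhol) simp
  ultimately have qhol: "q holomorphic_on disc"
    unfolding q_def by (rule holomorphic_compose_disc)
  have qdisc: "q x \<in> disc" if "x \<in> disc" for x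
    unfolding q_def using Mdisc[of "- c" "(M a x)\<^sup>2"] sqdisc[of "M a x"] Mdisc[OF a1 that] c1 by simp
  have q0: "q 0 = 0"
    using a2 by (simp add: q_def M_def disc_moebius_def)
  have qle: "norm (deriv q 0) < 1"
  proof (rule ccontr)
    assume "\<not> ?thesis"
    moreover have q1: "norm (q z) < 1" if "norm z < 1" for z using qdisc[of z] that by simp
    moreover have "norm (deriv q 0) \<le> 1"
      by (rule Schwarz_Lemma(2)[OF qhol q0 q1, of 0]) auto
    ultimately have "norm (deriv q 0) = 1" by linarith
    then obtain \<alpha> where \<alpha>: "\<And>z. norm z < 1 \<Longrightarrow> q z = \<alpha> * z" "norm \<alpha> = 1"
      using Schwarz_Lemma(3)[OF qhol q0 q1, of 0] by auto
    \<comment> \<open>Equality in the Schwarz lemma would make \<open>q\<close> a rotation, but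
      \<open>q\<close> identifies these two distinct points.\<close>
    define x y where "x = M (- a) (1/2)" and "y = M (- a) (- 1/2)"
    have xy: "x \<in> disc" "y \<in> disc" unfolding x_def y_def using a1 by (intro Mdisc; simp)+
    have Mxy: "M a x = 1/2" "M a y = - 1/2"
      unfolding x_def y_def using a1 Minv(2)[of a] by auto
    have "q x = q y" by (simp add: q_def Mxy power2_eq_square)
    then have "x = y" using \<alpha> xy by auto
    then show False using Mxy by simp
  qed
  have lift: "\<exists>K. K holomorphic_on disc \<and> K ` disc \<subseteq> disc \<and> K z = w \<and> (\<forall>x\<in>disc. q (K x) = H x)"
    if H: "H holomorphic_on disc" "H ` disc \<subseteq> disc"
       and ex: "\<exists>r. r holomorphic_on disc \<and> (\<forall>x\<in>disc. (r x)\<^sup>2 = H x - c)"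
       and zw: "z \<in> disc" "w \<in> disc" "H z = q w" for H z w
  proof -
    obtain r where r: "r holomorphic_on disc" "\<And>x. x \<in> disc \<Longrightarrow> (r x)\<^sup>2 = H x - c"
      using ex by blast
    have Hd: "H x \<in> disc" if "x \<in> disc" for x using H(2) that by blast
    have nz: "1 - cnj c * H x \<noteq> 0" if "x \<in> disc" for x
      using one_minus_mult_nz[of c "H x"] Hd[OF that] c1 by simp
    obtain t where t: "t holomorphic_on disc" "\<And>x. x \<in> disc \<Longrightarrow> (t x)\<^sup>2 = 1 - cnj c * H x"
      by (rule disc_holomorphic_sqrt[of "\<lambda>x. 1 - cnj c * H x"]) (use nz H in \<open>auto intro!: holomorphic_intros\<close>)
    have tnz: "t x \<noteq> 0" if "x \<in> disc" for x using t(2)[OF that] nz[OF that] by auto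
    \<comment> \<open>A square root of \<open>M c (H x)\<close>: the numerator
      \<open>H x - c\<close> has the root \<open>r\<close> by assumption, and the denominator has no
      zeros. Its sign is then adjusted to make the lift pass through \<open>w\<close>.\<close>
    define \<tau> where "\<tau> = (\<lambda>x. r x / t x)"
    have \<tau>hol: "\<tau> holomorphic_on disc"
      unfolding \<tau>_def by (intro holomorphic_intros r t tnz)
    have \<tau>2: "(\<tau> x)\<^sup>2 = M c (H x)" if "x \<in> disc" for x
      using r(2)[OF that] t(2)[OF that] by (simp add: \<tau>_def power_divide M_def disc_moebius_def)
    have \<tau>d: "\<tau> x \<in> disc" if "x \<in> disc" for x
      using \<tau>2[OF that] Mdisc[OF c1 Hd[OF that]] sqdisc by metis
    have "(M a w)\<^sup>2 = M c (q w)"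
      using Minv(2)[of c "(M a w)\<^sup>2"] c1 sqdisc Mdisc[OF a1] zw by (auto simp: q_def)
    then have "(M a w)\<^sup>2 = (\<tau> z)\<^sup>2" using \<tau>2 zw by simp
    then obtain \<sigma> :: complex where \<sigma>: "\<sigma> = 1 \<or> \<sigma> = -1" "\<sigma> * \<tau> z = M a w"
      unfolding power2_eq_iff by force
    have \<sigma>2: "(\<sigma> * x)\<^sup>2 = x\<^sup>2" "\<sigma> * x \<in> disc \<longleftrightarrow> x \<in> disc" for x using \<sigma>(1) by auto
    define K where "K = (\<lambda>x. M (- a) (\<sigma> * \<tau> x))"
    have "K holomorphic_on disc"
      unfolding K_def
    proof (rule holomorphic_compose_disc[where f="\<lambda>x. \<sigma> * \<tau> x" and g="M (- a)"])
      show "(\<lambda>x. \<sigma> * \<tau> x) holomorphic_on disc" by (intro holomorphic_intros \<tau>hol)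
      show "(\<lambda>x. \<sigma> * \<tau> x) ` disc \<subseteq> disc" using \<sigma>2(2) \<tau>d by blast
    qed (use a1 in \<open>auto intro: Mhol\<close>)
    moreover have "K ` disc \<subseteq> disc"
    proof
      fix y assume "y \<in> K ` disc"
      then obtain x where x: "x \<in> disc" "y = M (- a) (\<sigma> * \<tau> x)" by (auto simp: K_def)
      then show "y \<in> disc" using Mdisc[of "-a" "\<sigma> * \<tau> x"] a1 \<sigma>2(2) \<tau>d by simp
    qed
    moreover have "K z = w"
      using \<sigma> Minv(1)[OF a1 zw(2)] by (simp add: K_def)
    moreover have "q (K x) = H x" if "x \<in> disc" for x
    proof -
      have "M a (K x) = \<sigma> * \<tau> x"
        unfolding K_def using Minv(2)[OF a1, of "\<sigma> * \<tau> x"] \<sigma>2(2) \<tau>d[OF that] by blast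
      then have "q (K x) = M (- c) (M c (H x))" using \<sigma>2(1) \<tau>2[OF that] by (simp add: q_def)
      also have "\<dots> = H x" using Minv(1)[OF c1 Hd[OF that]] .
      finally show ?thesis .
    qed
    ultimately show ?thesis by blast
  qed
  show ?thesis
  proof (rule that[OF qhol _ q0 qle])
    show "q ` disc \<subseteq> disc" using qdisc by blast
  qed (rule lift)
qed

lemma eventually_nonzero_disc:
  assumes "f holomorphic_on disc" "a \<in> disc" "f a \<noteq> 0" "z \<in> disc"
  shows "eventually (\<lambda>w. f w \<noteq> 0) (at z)"
  using non_zero_neighbour_alt[of f disc z a] assms
  by (auto elim: eventually_mono)

lemma analytic_at_disc: "f holomorphic_on disc \<Longrightarrow> z \<in> disc \<Longrightarrow> f analytic_on {z}"
  using analytic_at open_ball by blast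

text \<open>If \<open>E\<close> fails to be an orbifold map, some \<open>E - b\<close> has a zero
  \<open>c\<close> of odd order. Every lift through \<open>E\<close> of an orbifold map then lifts
  once more through the degree-two map \<open>q\<close> branched over \<open>c\<close>. So
  \<open>E \<circ> q\<close> still lifts everything, and its derivative at 0 has gained the factor
  \<open>deriv q 0\<close>.\<close>

lemma lifts_orbifold_maps_improve:
  assumes E: "lifts_orbifold_maps B E" and B0: "0 \<notin> B" and E': "deriv E 0 \<noteq> 0"
    and not_orb: "\<not> orbifold_map B E"
  shows "\<exists>E1. lifts_orbifold_maps B E1 \<and> norm (deriv E1 0) < norm (deriv E 0)"
proof -
  note hol = lifts_orbifold_mapsD(1-3)[OF E] and lift = lifts_orbifold_mapsD(4)[OF E]
  obtain b where b: "b \<in> B" "\<nexists>r. r holomorphic_on disc \<and> (\<forall>z\<in>disc. (r z)\<^sup>2 = E z - b)"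
    using not_orb hol unfolding orbifold_map_def by blast
  define f where "f = (\<lambda>z. E z - b)"
  have f: "f holomorphic_on disc" unfolding f_def by (intro holomorphic_intros hol)
  have f0: "f 0 \<noteq> 0" using b B0 hol by (auto simp: f_def)
  have "\<exists>c\<in>disc. odd (zorder f c)"
  proof (rule ccontr)
    assume "\<not> ?thesis"
    then have ev: "\<And>z. z \<in> disc \<Longrightarrow> even (zorder f z)" by blast
    have "\<exists>s. s holomorphic_on disc \<and> (\<forall>z\<in>disc. (s z)\<^sup>2 = f z)"
      by (rule holomorphic_sqrt_even_zorder[OF f _ f0 ev]) auto
    then show False using b(2) unfolding f_def by blast
  qed
  then obtain c where c: "c \<in> disc" "odd (zorder f c)" by blast
  obtain q where q: "q holomorphic_on disc" "q ` disc \<subseteq> disc" "q 0 = 0" "norm (deriv q 0) < 1"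
    "\<And>H z w. \<lbrakk>H holomorphic_on disc; H ` disc \<subseteq> disc;
       \<exists>r. r holomorphic_on disc \<and> (\<forall>x\<in>disc. (r x)\<^sup>2 = H x - c); z \<in> disc; w \<in> disc; H z = q w\<rbrakk> \<Longrightarrow>
       \<exists>K. K holomorphic_on disc \<and> K ` disc \<subseteq> disc \<and> K z = w \<and> (\<forall>x\<in>disc. q (K x) = H x)"
    by (rule disc_double_cover_branched_at[OF c(1)]) (rule that)
  \<comment> \<open>Where \<open>H\<close> takes the value \<open>c\<close>, the order of
    \<open>G - b\<close> is the odd order of \<open>E - b\<close> at \<open>c\<close> times the
    order of \<open>H - c\<close>. The product is even, hence so is the second factor.\<close>
  have key: "\<exists>r. r holomorphic_on disc \<and> (\<forall>x\<in>disc. (r x)\<^sup>2 = H x - c)"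
    if G: "orbifold_map B G" and H: "H holomorphic_on disc" "H ` disc \<subseteq> disc" "\<forall>x\<in>disc. E (H x) = G x" for G H
  proof (cases "\<forall>x\<in>disc. H x = c")
    case True
    then show ?thesis by (intro exI[of _ "\<lambda>_. 0"]) auto
  next
    case False
    then obtain a where a: "a \<in> disc" "H a - c \<noteq> 0" by auto
    define k where "k = (\<lambda>x. H x - c)"
    have k: "k holomorphic_on disc" unfolding k_def by (intro holomorphic_intros H)
    obtain r where r: "r holomorphic_on disc" "\<And>x. x \<in> disc \<Longrightarrow> (r x)\<^sup>2 = G x - b"
      using G b(1) unfolding orbifold_map_def by blast
    have "even (zorder k x)" if x: "x \<in> disc" for x
    proof (cases "H x = c")
      case False
      then have "zorder k x = 0"
        by (intro zorder_eq_0I analytic_at_disc[OF k x]) (auto simp: k_def)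
      then show ?thesis by simp
    next
      case True
      have evk: "eventually (\<lambda>w. k w \<noteq> 0) (at x)"
        using eventually_nonzero_disc[OF k a(1) _ x] a by (simp add: k_def)
      then have evH: "eventually (\<lambda>w. H w \<noteq> H x) (at x)"
        by (simp add: k_def True)
      have evf: "eventually (\<lambda>w. f w \<noteq> 0) (at (H x))"
        using eventually_nonzero_disc[OF f _ f0, of "H x"] c True by simp
      have fan: "f analytic_on {H x}" using analytic_at_disc[OF f, of "H x"] c True by simp
      have "zorder (f \<circ> H) x = zorder f (H x) * zorder (\<lambda>y. H y - H x) x"
        using fan analytic_at_disc[OF H(1) x] evf evH
        by (intro zorder_compose' isolated_singularity_at_analytic not_essential_analytic)
      then have "zorder (f \<circ> H) x = zorder f c * zorder k x"
        by (simp add: True k_def)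
      moreover have "zorder (f \<circ> H) x = zorder (\<lambda>y. (r y)\<^sup>2) x"
      proof (rule zorder_cong)
        have "eventually (\<lambda>y. y \<in> disc) (at x)" using x by (intro eventually_at_in_open') auto
        then show "eventually (\<lambda>y. (f \<circ> H) y = (r y)\<^sup>2) (at x)"
          by eventually_elim (use H r in \<open>auto simp: f_def simp del: mem_ball\<close>)
      qed auto
      moreover have "zorder (\<lambda>y. (r y)\<^sup>2) x = 2 * zorder r x"
      proof -
        \<comment> \<open>If \<open>r\<close> vanished identically, so would
          \<open>f \<circ> H\<close>; but \<open>H\<close> carries a punctured neighbourhood of
          \<open>x\<close> to points near \<open>c\<close> where \<open>f\<close> is
          nonzero.\<close>
        obtain a' where "a' \<in> disc" "r a' \<noteq> 0"
        proof (rule ccontr)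
          assume "\<not> thesis"
          then have r0: "\<And>y. y \<in> disc \<Longrightarrow> r y = 0" using that by blast
          have "eventually (\<lambda>y. f (H y) \<noteq> 0) (at x)"
          proof -
            have "filterlim H (nhds (H x)) (at x)"
              using analytic_at_disc[OF H(1) x] analytic_at_imp_isCont isContD by blast
            then have "filterlim H (at (H x)) (at x)" using evH by (simp add: filterlim_at)
            then show ?thesis using evf eventually_compose_filterlim by blast
          qed
          moreover have "eventually (\<lambda>y. y \<in> disc) (at x)" using x by (intro eventually_at_in_open') auto
          ultimately have "eventually (\<lambda>y. False) (at x)"
            by eventually_elim (use H r r0 in \<open>auto simp: f_def simp del: mem_ball\<close>)
          then show False by simp
        qed
        then have "eventually (\<lambda>w. r w \<noteq> 0) (at x)" using eventually_nonzero_disc[OF r(1) _ _ x] by blast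
        then have "frequently (\<lambda>w. r w \<noteq> 0) (at x)" by (intro eventually_frequently) auto
        then show ?thesis
          using zorder_power[of r x 2] analytic_at_disc[OF r(1) x] analytic_on_imp_meromorphic_on by simp
      qed
      ultimately have "even (zorder f c * zorder k x)" by (metis dvd_triv_left)
      then show ?thesis using c(2) by simp
    qed
    then obtain s where "s holomorphic_on disc" "\<And>z. z \<in> disc \<Longrightarrow> (s z)\<^sup>2 = k z"
      using a(2) by (rule_tac holomorphic_sqrt_even_zorder[OF k a(1)]) (simp_all add: k_def)
    then show ?thesis unfolding k_def by blast
  qed
  define E1 where "E1 = (\<lambda>z. E (q z))"
  have E1: "E1 holomorphic_on disc" "E1 ` disc \<subseteq> disc" "E1 0 = 0"
    using hol q holomorphic_compose_disc[OF q(1,2) hol(1)] by (auto simp: E1_def simp del: mem_ball)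
  have "lifts_orbifold_maps B E1"
    unfolding lifts_orbifold_maps_def
  proof (intro conjI allI ballI impI E1)
    fix G z w assume zw: "z \<in> disc" "w \<in> disc" and G: "orbifold_map B G \<and> G z = E1 w"
    have "q w \<in> disc" using zw q by blast
    then obtain H where H: "H holomorphic_on disc" "H ` disc \<subseteq> disc" "H z = q w" "\<forall>x\<in>disc. E (H x) = G x"
      using lift[OF zw(1), of "q w" G] G by (auto simp: E1_def)
    obtain K where "K holomorphic_on disc \<and> K ` disc \<subseteq> disc \<and> K z = w \<and> (\<forall>x\<in>disc. q (K x) = H x)"
      using q(5)[OF H(1,2) key[OF conjunct1[OF G] H(1,2,4)] zw H(3)] by blast
    then show "\<exists>K. K holomorphic_on disc \<and> K ` disc \<subseteq> disc \<and> K z = w \<and> (\<forall>x\<in>disc. E1 (K x) = G x)"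
      using H(4) by (auto simp: E1_def simp del: mem_ball)
  qed
  moreover have "norm (deriv E1 0) < norm (deriv E 0)"
  proof -
    have dq: "(q has_field_derivative deriv q 0) (at 0)"
      using q(1) by (intro holomorphic_derivI[of q disc]) auto
    have dE: "(E has_field_derivative deriv E 0) (at (q 0))"
      using hol q(3) holomorphic_derivI[of E disc 0] by auto
    have "deriv E1 0 = deriv E 0 * deriv q 0"
      unfolding E1_def using DERIV_chain2[OF dE dq] DERIV_imp_deriv by blast
    then show ?thesis using q(4) E' by (simp add: norm_mult)
  qed
  ultimately show ?thesis by blast
qed

text \<open>Hurwitz's theorem on the part of the disc near \<open>w\<close>, applied to the sequence
  shifted by \<open>N\<close>: values of the limit are taken by late members of the sequence at
  nearby points.\<close>

lemma zeros_of_limit: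
  assumes hol: "\<And>n::nat. E n holomorphic_on disc" and g: "g holomorphic_on disc" "\<not> g constant_on disc"
    and lim: "\<And>K. \<lbrakk>compact K; K \<subseteq> disc\<rbrakk> \<Longrightarrow> uniform_limit K E g sequentially"
    and w: "w \<in> disc" "g w = c" and e: "e > 0"
  shows "\<exists>n\<ge>N. \<exists>x\<in>disc. dist w x < e \<and> E n x = c"
proof (rule ccontr)
  assume no: "\<not> ?thesis"
  define S where "S = disc \<inter> ball w e"
  have S: "open S" "connected S" "w \<in> S" "S \<subseteq> disc"
    using w e by (auto simp: S_def intro!: convex_connected convex_Int)
  have "g w - c \<noteq> 0"
  proof (rule Hurwitz_no_zeros[of S "\<lambda>n z. E (n + N) z - c" "\<lambda>z. g z - c"])
    show "(\<lambda>z. E (n + N) z - c) holomorphic_on S" for n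
      using holomorphic_on_subset[OF hol S(4)] by (intro holomorphic_intros)
    show "(\<lambda>z. g z - c) holomorphic_on S"
      using holomorphic_on_subset[OF g(1) S(4)] by (intro holomorphic_intros)
    show "uniform_limit K (\<lambda>n z. E (n + N) z - c) (\<lambda>z. g z - c) sequentially"
      if "compact K" "K \<subseteq> S" for K
    proof (intro uniform_limit_intros)
      have "uniform_limit K E g sequentially" using lim that S by blast
      then show "uniform_limit K (\<lambda>n. E (n + N)) g sequentially"
        using filterlim_compose[OF _ filterlim_add_const_nat_at_top] by blast
    qed
    show "\<not> (\<lambda>z. g z - c) constant_on S"
    proof
      assume "(\<lambda>z. g z - c) constant_on S"
      then obtain y where "\<And>z. z \<in> S \<Longrightarrow> g z - c = y" by (auto simp: constant_on_def)
      then have eq: "g z = g w" if "z \<in> S" for z using that S(3) by (metis diff_add_cancel)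
      have "g z = g w" if "z \<in> disc" for z
        by (rule analytic_continuation_open[OF S(1) open_ball _ connected_ball S(4) g(1) holomorphic_on_const eq that])
           (use S(3) in blast)
      then show False using g(2) unfolding constant_on_def by blast
    qed
    show "E (n + N) z - c \<noteq> 0" if "z \<in> S" for n z
      using no that by (auto simp: S_def)
  qed (use S in auto)
  then show False using w by simp
qed

lemma uniform_limit_diagonal:
  fixes g :: "complex \<Rightarrow> complex"
  assumes ul: "uniform_limit (cball l d) f g F" and d: "d > 0"
    and g: "continuous_on (cball l d) g" and x: "(x \<longlongrightarrow> l) F"
  shows "((\<lambda>j. f j (x j)) \<longlongrightarrow> g l) F"
proof -
  have ev: "eventually (\<lambda>j. x j \<in> ball l d) F"
    using x d by (metis centre_in_ball open_ball topological_tendstoD)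
  have "isCont g l"
    using continuous_on_interior[OF g, of l] d by simp
  then have 1: "((\<lambda>j. g (x j)) \<longlongrightarrow> g l) F"
    using x by (rule isCont_tendsto_compose)
  have 2: "((\<lambda>j. dist (f j (x j)) (g (x j))) \<longlongrightarrow> 0) F"
  proof (rule tendstoI)
    fix e :: real assume "e > 0"
    then have "eventually (\<lambda>j. \<forall>y\<in>cball l d. dist (f j y) (g y) < e) F"
      using ul by (rule uniform_limitD[rotated])
    with ev show "eventually (\<lambda>j. dist (dist (f j (x j)) (g (x j))) 0 < e) F"
      by eventually_elim auto
  qed
  show ?thesis
    using 2 by (intro Lim_transform[OF 1]) (simp add: dist_norm tendsto_norm_zero_iff)
qed

text \<open>The point \<open>w\<close> lies over \<open>G z\<close> only for the limit
  \<open>g\<close>. Hurwitz supplies points \<open>x j\<close> tending to \<open>w\<close> that lie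
  over \<open>G z\<close> for the approximants, and \<open>G\<close> lifts through these with base
  points \<open>x j\<close>. By Montel a subsequence of the lifts converges; the limit stays in the
  disc because it takes the value \<open>w\<close> at \<open>z\<close>.\<close>

lemma lifts_orbifold_maps_limit:
  assumes E: "\<And>n::nat. lifts_orbifold_maps B (E n)"
    and g: "g holomorphic_on disc" "\<not> g constant_on disc"
    and lim: "\<And>K. \<lbrakk>compact K; K \<subseteq> disc\<rbrakk> \<Longrightarrow> uniform_limit K E g sequentially"
  shows "lifts_orbifold_maps B g"
proof -
  note hol = lifts_orbifold_mapsD(1-3)[OF E] and lift = lifts_orbifold_mapsD(4)[OF E]
  have ptw: "(\<lambda>n. E n z) \<longlonglongrightarrow> g z" if "z \<in> disc" for z
    using lim[of "{z}"] that by (simp add: tendsto_uniform_limitI)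
  have g0: "g 0 = 0" using ptw[of 0] hol(3) by (simp add: LIMSEQ_const_iff)
  have gd: "g ` disc \<subseteq> disc"
    using limit_self_map_disc[of E g 0, OF hol(2) g(1) ptw] g0 by simp
  show ?thesis
    unfolding lifts_orbifold_maps_def
  proof (intro conjI allI ballI impI g gd g0)
    fix G z w assume zw: "z \<in> disc" "w \<in> disc" and G: "orbifold_map B G \<and> G z = g w"
    have "\<exists>n\<ge>j. \<exists>x\<in>disc. dist w x < 1 / Suc j \<and> E n x = G z" for j
      using G by (intro zeros_of_limit[OF hol(1) g lim zw(2)]) auto
    then obtain n x where nx: "\<And>j. n j \<ge> j" "\<And>j. x j \<in> disc" "\<And>j. dist w (x j) < 1 / Suc j" "\<And>j. E (n j) (x j) = G z"
      by metis
    have "\<exists>H. H holomorphic_on disc \<and> H ` disc \<subseteq> disc \<and> H z = x j \<and> (\<forall>y\<in>disc. E (n j) (H y) = G y)" for j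
      using lift[OF zw(1) nx(2)] G nx(4) by metis
    then obtain H where H: "\<And>j. H j holomorphic_on disc" "\<And>j. H j ` disc \<subseteq> disc" "\<And>j. H j z = x j"
       "\<And>j y. y \<in> disc \<Longrightarrow> E (n j) (H j y) = G y"
      by metis
    have Hb: "norm (H j y) \<le> 1" if "y \<in> disc" for j y
      using H(2)[of j] that by (force simp: image_subset_iff less_imp_le)
    obtain K \<rho> where K: "K holomorphic_on disc" "strict_mono \<rho>"
      "\<And>y. y \<in> disc \<Longrightarrow> (\<lambda>j. H (\<rho> j) y) \<longlonglongrightarrow> K y"
    proof (rule Montel[of disc "range H" H])
      show "\<exists>b. \<forall>h\<in>range H. \<forall>z\<in>C. norm (h z) \<le> b" if "compact C" "C \<subseteq> disc" for C
        using Hb that by (intro exI[of _ 1]) (auto simp del: mem_ball)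
    qed (use H in auto)
    have n\<rho>: "filterlim (\<lambda>j. n (\<rho> j)) at_top sequentially"
    proof (rule filterlim_at_top_mono[OF filterlim_subseq[OF K(2)]])
      show "eventually (\<lambda>j. \<rho> j \<le> n (\<rho> j)) sequentially" using nx(1) by auto
    qed
    have xlim: "x \<longlonglongrightarrow> w"
    proof (rule metric_LIMSEQ_I)
      fix e :: real assume "e > 0"
      then obtain N where N: "1 / Suc N < e" using nat_approx_posE by blast
      show "\<exists>N. \<forall>j\<ge>N. dist (x j) w < e"
      proof (intro exI[of _ N] allI impI)
        fix j assume "j \<ge> N"
        then have "1 / real (Suc j) \<le> 1 / real (Suc N)" by (intro divide_left_mono) auto
        then show "dist (x j) w < e" using nx(3)[of j] N by (simp add: dist_commute)
      qed
    qed
    have "K z = w"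
      using K(3)[OF zw(1)] H(3) LIMSEQ_subseq_LIMSEQ[OF xlim K(2)] LIMSEQ_unique
      by (auto simp: o_def)
    moreover have Kd: "K ` disc \<subseteq> disc"
      using limit_self_map_disc[of "\<lambda>j. H (\<rho> j)" K z, OF H(2) K(1,3) zw(1)] \<open>K z = w\<close> zw by simp
    moreover have "g (K y) = G y" if y: "y \<in> disc" for y
    proof -
      have Ky: "K y \<in> disc" using Kd y by blast
      then obtain d where d: "d > 0" "cball (K y) d \<subseteq> disc"
        using open_contains_cball[of disc] by blast
      have ul: "uniform_limit (cball (K y) d) (\<lambda>j. E (n (\<rho> j))) g sequentially"
        using filterlim_compose[OF lim[OF compact_cball d(2)] n\<rho>] by simp
      have "(\<lambda>j. E (n (\<rho> j)) (H (\<rho> j) y)) \<longlonglongrightarrow> g (K y)"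
        by (rule uniform_limit_diagonal[OF ul d(1) _ K(3)[OF y]])
           (rule holomorphic_on_imp_continuous_on[OF holomorphic_on_subset[OF g(1) d(2)]])
      moreover have "(\<lambda>j. E (n (\<rho> j)) (H (\<rho> j) y)) = (\<lambda>_. G y)"
        using H(4)[OF y] by auto
      ultimately show ?thesis by (simp add: LIMSEQ_const_iff)
    qed
    ultimately show "\<exists>K. K holomorphic_on disc \<and> K ` disc \<subseteq> disc \<and> K z = w \<and> (\<forall>y\<in>disc. g (K y) = G y)"
      using K(1) by blast
  qed
qed


lemma id_lifts_orbifold_maps: "lifts_orbifold_maps B (\<lambda>z. z)"
  unfolding lifts_orbifold_maps_def orbifold_map_def by (auto intro: holomorphic_on_ident)

text \<open>An element of smallest derivative at 0 in the class of maps that lift all orbifold maps is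
  itself an orbifold map: otherwise composing with a Blaschke product of degree two makes the
  derivative smaller.\<close>

theorem universal_orbifold_cover_exists:
  assumes e: "0 < e" "ball 0 e \<inter> B = {}"
  obtains F where "orbifold_map B F" "lifts_orbifold_maps B F"
proof -
  define d where "d = min e 1"
  have d: "0 < d" "d \<le> 1" "ball 0 d \<inter> B = {}" using e by (auto simp: d_def)
  have B0: "0 \<notin> B" using e by (metis Int_iff centre_in_ball empty_iff)
  define D where "D = (\<lambda>E. norm (deriv E 0)) ` {E. lifts_orbifold_maps B E}"
  define l where "l = Inf D"
  have ge: "x \<ge> d" if "x \<in> D" for x
    using that lifts_orbifold_maps_deriv_ge[OF _ d] by (auto simp: D_def)
  have ne: "D \<noteq> {}" using id_lifts_orbifold_maps by (auto simp: D_def)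
  have bdd: "bdd_below D" using ge by (auto simp: bdd_below_def)
  have "l \<ge> d" unfolding l_def using ne ge by (intro cInf_greatest) auto
  have "\<exists>E. lifts_orbifold_maps B E \<and> norm (deriv E 0) < l + 1 / Suc n" for n
  proof -
    have "Inf D < l + 1 / Suc n" by (simp add: l_def)
    then show ?thesis using cInf_lessD[OF ne] by (auto simp: D_def)
  qed
  then obtain E where E: "\<And>n. lifts_orbifold_maps B (E n)" "\<And>n. norm (deriv (E n) 0) < l + 1 / Suc n"
    by metis
  note hol = lifts_orbifold_mapsD(1,2)[OF E(1)]
  have bd: "norm (E n z) \<le> 1" if "z \<in> disc" for n z
  proof -
    have "E n z \<in> disc" using hol(2) that by blast
    then show ?thesis by simp
  qed
  obtain g \<rho> where g: "g holomorphic_on disc" "strict_mono \<rho>"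
    "\<And>K. \<lbrakk>compact K; K \<subseteq> disc\<rbrakk> \<Longrightarrow> uniform_limit K (E \<circ> \<rho>) g sequentially"
  proof (rule Montel[of disc "range E" E])
    show "\<exists>b. \<forall>h\<in>range E. \<forall>z\<in>K. norm (h z) \<le> b" if "compact K" "K \<subseteq> disc" for K
    proof (intro exI ballI)
      fix h z assume "h \<in> range E" "z \<in> K"
      then show "norm (h z) \<le> 1" using bd that by blast
    qed
  qed (use hol in auto)
  \<comment> \<open>Locally uniform convergence passes to derivatives, so the limit attains the
    infimum.\<close>
  have "\<exists>g'. \<forall>x \<in> disc. (g has_field_derivative g' x) (at x) \<and> (\<lambda>n. deriv ((E \<circ> \<rho>) n) x) \<longlonglongrightarrow> g' x"
  proof (rule has_complex_derivative_uniform_sequence)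
    show "((E \<circ> \<rho>) n has_field_derivative deriv ((E \<circ> \<rho>) n) x) (at x)" if "x \<in> disc" for n x
      using holomorphic_derivI[OF hol(1) open_ball that, of "\<rho> n"] by simp
    show "\<exists>r>0. cball x r \<subseteq> disc \<and> uniform_limit (cball x r) (E \<circ> \<rho>) g sequentially" if "x \<in> disc" for x
      using open_contains_cball[of disc] that g(3)[OF compact_cball] by blast
  qed auto
  then have lim: "(\<lambda>n. deriv (E (\<rho> n)) 0) \<longlonglongrightarrow> deriv g 0"
    by (auto dest!: bspec[of _ _ 0] DERIV_imp_deriv)
  have "norm (deriv g 0) \<le> l"
  proof (rule LIMSEQ_le[OF tendsto_norm[OF lim]])
    have "(\<lambda>n. l + 1 / real (Suc n)) \<longlonglongrightarrow> l + 0"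
      using LIMSEQ_inverse_real_of_nat by (intro tendsto_intros) (simp add: inverse_eq_divide)
    then show "(\<lambda>n. l + 1 / real (Suc n)) \<longlonglongrightarrow> l" by simp
    have "norm (deriv (E (\<rho> n)) 0) \<le> l + 1 / Suc n" for n
    proof -
      have "1 / real (Suc (\<rho> n)) \<le> 1 / real (Suc n)"
        using seq_suble[OF g(2), of n] by (intro divide_left_mono) auto
      then show ?thesis using E(2)[of "\<rho> n"] by linarith
    qed
    then show "\<exists>N. \<forall>n\<ge>N. norm (deriv (E (\<rho> n)) 0) \<le> l + 1 / real (Suc n)" by blast
  qed
  \<comment> \<open>The uniform lower bound survives in the limit. It rules out a constant limit, to
    which Hurwitz would not apply.\<close>
  have "norm (deriv g 0) \<ge> d"
  proof (rule LIMSEQ_le_const[OF tendsto_norm[OF lim]])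
    show "\<exists>N. \<forall>n\<ge>N. d \<le> norm (deriv (E (\<rho> n)) 0)"
      using ge E(1) by (auto simp: D_def)
  qed
  then have g': "deriv g 0 \<noteq> 0" using d by auto
  have nc: "\<not> g constant_on disc"
  proof
    assume "g constant_on disc"
    then obtain c where c: "\<And>z. z \<in> disc \<Longrightarrow> g z = c" by (auto simp: constant_on_def)
    have "(g has_field_derivative 0) (at 0)"
      by (rule has_field_derivative_transform_within_open[of "\<lambda>_. c" _ _ disc]) (use c in auto)
    then show False using g' DERIV_imp_deriv by blast
  qed
  have glift: "lifts_orbifold_maps B g"
    using lifts_orbifold_maps_limit[of B "E \<circ> \<rho>" g] E(1) g nc by simp
  have "orbifold_map B g"
  proof (rule ccontr)
    assume "\<not> ?thesis"
    then obtain E1 where "lifts_orbifold_maps B E1" "norm (deriv E1 0) < norm (deriv g 0)"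
      using lifts_orbifold_maps_improve[OF glift B0 g'] by blast
    moreover have "l \<le> norm (deriv E1 0)" if "lifts_orbifold_maps B E1"
      unfolding l_def using bdd that by (intro cInf_lower) (auto simp: D_def)
    ultimately show False using \<open>norm (deriv g 0) \<le> l\<close> by linarith
  qed
  then show ?thesis using glift that by blast
qed

section \<open>The double cover defined by a form of even weight\<close>

lemma orbifold_mapD:
  assumes "orbifold_map B G"
  shows "G holomorphic_on disc" "G ` disc \<subseteq> disc"
    "\<And>b. b \<in> B \<Longrightarrow> \<exists>r. r holomorphic_on disc \<and> (\<forall>z\<in>disc. (r z)\<^sup>2 = G z - b)"
  using assms unfolding orbifold_map_def by blast+

lemma zorder_simple_zero:
  assumes "f holomorphic_on S" "open S" "z \<in> S" "f z = 0" "deriv f z \<noteq> 0"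
  shows "zorder f z = 1"
  by (rule zorder_zero_eqI[OF assms(1-3)]) (use assms in auto)

lemma disc_automorphism_deriv_nz:
  assumes "h \<in> disc_automorphisms" "z \<in> disc"
  shows "deriv h z \<noteq> 0"
proof -
  obtain k where k: "k \<in> disc_automorphisms" "\<And>z. z \<in> disc \<Longrightarrow> k (h z) = z"
      "\<And>z. z \<in> disc \<Longrightarrow> h (k z) = z"
    by (rule disc_automorphism_inverse[OF assms(1)]) (rule that)
  have dh: "(h has_field_derivative deriv h z) (at z)"
    using holomorphic_derivI[OF disc_automorphisms_holomorphic[OF assms(1)] open_ball assms(2)] .
  have dk: "(k has_field_derivative deriv k (h z)) (at (h z))"
    using holomorphic_derivI[OF disc_automorphisms_holomorphic[OF k(1)] open_ball
       disc_automorphisms_in_disc[OF assms]] .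
  have "((\<lambda>x. k (h x)) has_field_derivative 1) (at z)"
    by (rule has_field_derivative_transform_within_open[of "\<lambda>x. x" _ _ disc]) (use k assms in auto)
  then have "deriv k (h z) * deriv h z = 1"
    using DERIV_chain2[OF dk dh] DERIV_unique by blast
  then show ?thesis by auto
qed

lemma deriv_chain_disc:
  assumes "k holomorphic_on disc" "k ` disc \<subseteq> disc" "h holomorphic_on disc" "z \<in> disc"
    "\<And>x. x \<in> disc \<Longrightarrow> l x = h (k x)"
  shows "deriv l z = deriv h (k z) * deriv k z"
proof -
  have dk: "(k has_field_derivative deriv k z) (at z)"
    using holomorphic_derivI[OF assms(1) open_ball assms(4)] .
  have dh: "(h has_field_derivative deriv h (k z)) (at (k z))"
    using holomorphic_derivI[OF assms(3) open_ball] assms(2,4) by blast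
  have "(l has_field_derivative deriv h (k z) * deriv k z) (at z)"
    using DERIV_chain2[OF dh dk]
    by (rule has_field_derivative_transform_within_open[of _ _ _ disc]) (use assms in auto)
  then show ?thesis by (rule DERIV_imp_deriv)
qed

lemma deriv_eq_0_const_disc:
  assumes "\<And>x. x \<in> disc \<Longrightarrow> f x = c" "z \<in> disc"
  shows "deriv f z = 0"
proof -
  have "(f has_field_derivative 0) (at z)"
    by (rule has_field_derivative_transform_within_open[OF DERIV_const open_ball assms(2)])
       (rule assms(1)[symmetric])
  then show ?thesis by (rule DERIV_imp_deriv)
qed

text \<open>With \<open>s w = t w * (w - z) ^ k\<close> and \<open>t z \<noteq> 0\<close>,
  invariance says \<open>((g w - z) / (w - z)) ^ k * t (g w) = t w\<close>; let \<open>w\<close>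
  tend to \<open>z\<close>. For odd \<open>k\<close> this excludes the derivative -1, that is, a
  half-turn.\<close>

lemma deriv_power_zorder_eq_1:
  assumes s: "s holomorphic_on disc" "a \<in> disc" "s a \<noteq> 0" and z: "z \<in> disc" "s z = 0"
    and g: "g holomorphic_on disc" "g ` disc \<subseteq> disc" "g z = z" "deriv g z \<noteq> 0"
    and inv: "\<And>x. x \<in> disc \<Longrightarrow> s (g x) = s x"
  shows "deriv g z ^ nat (zorder s z) = 1"
proof -
  define k where "k = nat (zorder s z)"
  define t where "t = zor_poly s z"
  obtain r where r: "r > 0" "cball z r \<subseteq> disc" "t holomorphic_on cball z r"
    "\<And>w. w \<in> cball z r \<Longrightarrow> s w = t w * (w - z) ^ k \<and> t w \<noteq> 0"
    using zorder_exist_zero[OF s(1) open_ball connected_ball z(1)] s(2,3)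
    unfolding k_def t_def by blast
  have dg: "(g has_field_derivative deriv g z) (at z)"
    using holomorphic_derivI[OF g(1) open_ball z(1)] .
  then have q: "((\<lambda>w. (g w - z) / (w - z)) \<longlongrightarrow> deriv g z) (at z)"
    using g(3) by (simp add: has_field_derivative_iff)
  have gz: "(g \<longlongrightarrow> z) (at z)"
    using DERIV_isCont[OF dg] g(3) by (simp add: isCont_def)
  have tc: "isCont t z"
    using r holomorphic_on_imp_continuous_on[OF r(3)] continuous_on_interior[of "cball z r" t z] by simp
  have t1: "((\<lambda>w. t (g w)) \<longlongrightarrow> t z) (at z)" using isCont_tendsto_compose[OF tc gz] .
  have t2: "(t \<longlongrightarrow> t z) (at z)" using tc by (simp add: isCont_def)
  have lim1: "((\<lambda>w. ((g w - z) / (w - z)) ^ k * t (g w)) \<longlongrightarrow> deriv g z ^ k * t z) (at z)"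
    by (intro tendsto_intros q t1)
  have ev: "eventually (\<lambda>w. w \<in> ball z r) (at z)" using r by (intro eventually_at_in_open') auto
  have evg: "eventually (\<lambda>w. g w \<in> ball z r) (at z)"
    using gz r by (metis centre_in_ball open_ball topological_tendstoD)
  have evne: "eventually (\<lambda>w. w \<noteq> z) (at z)" by (simp add: eventually_neq_at_within)
  have ev2: "eventually (\<lambda>w. ((g w - z) / (w - z)) ^ k * t (g w) = t w) (at z)"
    using ev evg evne
  proof eventually_elim
    case (elim w)
    have w: "w \<in> cball z r" "g w \<in> cball z r" "w \<in> disc" using elim r ball_subset_cball by blast+
    then have "t (g w) * (g w - z) ^ k = t w * (w - z) ^ k"
      using inv[of w] r(4) by metis
    then show ?case using elim by (simp add: power_divide field_simps)
  qed
  have "((\<lambda>w. ((g w - z) / (w - z)) ^ k * t (g w)) \<longlongrightarrow> t z) (at z)"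
    by (rule iffD2[OF tendsto_cong[OF ev2] t2])
  then have "deriv g z ^ k * t z = t z"
    by (rule tendsto_unique[OF at_neq_bot lim1])
  then show ?thesis using r(4)[of z] r(1) by (simp add: k_def)
qed

text \<open>For a Moebius map, \<open>h (G z) - h c\<close> is \<open>G z - c\<close> times a factor
  without zeros, and that factor has a square root on the disc.\<close>

lemma orbifold_map_compose_automorphism:
  assumes h: "h \<in> disc_automorphisms" and G: "orbifold_map B G"
    and B: "\<And>b. b \<in> B \<Longrightarrow> \<exists>c\<in>B \<inter> disc. h c = b"
  shows "orbifold_map B (\<lambda>z. h (G z))"
proof -
  note D = orbifold_mapD[OF G]
  obtain u a where ua: "h = disc_moebius u a" "norm u = 1" "norm a < 1"
    using h unfolding disc_automorphisms_def by blast
  have "\<exists>r. r holomorphic_on disc \<and> (\<forall>z\<in>disc. (r z)\<^sup>2 = h (G z) - b)" if b: "b \<in> B" for b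
  proof -
    obtain c where c: "c \<in> B" "c \<in> disc" "h c = b" using B[OF b] by blast
    obtain r where r: "r holomorphic_on disc" "\<And>z. z \<in> disc \<Longrightarrow> (r z)\<^sup>2 = G z - c"
      using D(3)[OF c(1)] by blast
    have nzc: "1 - cnj a * c \<noteq> 0" using one_minus_mult_nz[of a c] ua c by simp
    have nz: "1 - cnj a * G z \<noteq> 0" if "z \<in> disc" for z
    proof -
      have "G z \<in> disc" using D(2) that by blast
      then show ?thesis using one_minus_mult_nz[of a "G z"] ua by simp
    qed
    have nza: "1 - cnj a * a \<noteq> 0" using one_minus_mult_nz[of a a] ua by simp
    define v where "v = (\<lambda>z. u * (1 - cnj a * a) / ((1 - cnj a * G z) * (1 - cnj a * c)))"
    obtain t where t: "t holomorphic_on disc" "\<And>z. z \<in> disc \<Longrightarrow> (t z)\<^sup>2 = v z"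
    proof (rule disc_holomorphic_sqrt[of v])
      show "v holomorphic_on disc" unfolding v_def using nz nzc by (intro holomorphic_intros D(1)) auto
      show "v z \<noteq> 0" if "z \<in> disc" for z
        using nz[OF that] nza nzc ua(2) by (auto simp: v_def)
    qed blast
    have "h (G z) - b = v z * (G z - c)" if "z \<in> disc" for z
      unfolding c(3)[symmetric] ua(1) disc_moebius_def v_def
      using nz[OF that] nzc by (simp add: field_simps)
    then show ?thesis
      using t r by (intro exI[of _ "\<lambda>z. t z * r z"]) (auto intro!: holomorphic_intros simp: power_mult_distrib)
  qed
  moreover have "(\<lambda>z. h (G z)) holomorphic_on disc"
    by (rule holomorphic_compose_disc[OF D(1,2) disc_automorphisms_holomorphic[OF h]])
  moreover have "(\<lambda>z. h (G z)) ` disc \<subseteq> disc"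
    using disc_automorphisms_in_disc[OF h] D(2) by blast
  ultimately show ?thesis unfolding orbifold_map_def by blast
qed

section \<open>Surface groups and the Poincare metric\<close>

lemma surface_groupD:
  assumes "surface_group \<Gamma>"
  shows "\<Gamma> \<subseteq> disc_automorphisms" "id \<in> \<Gamma>"
    "\<And>g h. \<lbrakk>g \<in> \<Gamma>; h \<in> \<Gamma>\<rbrakk> \<Longrightarrow> \<exists>k\<in>\<Gamma>. \<forall>z\<in>disc. h (g z) = k z"
    "\<And>g. g \<in> \<Gamma> \<Longrightarrow> \<exists>h\<in>\<Gamma>. \<forall>z\<in>disc. h (g z) = z"
    "\<And>g z w. \<lbrakk>g \<in> \<Gamma>; z \<in> disc; g z = z; w \<in> disc\<rbrakk> \<Longrightarrow> g w = w"
    "\<And>K. \<lbrakk>compact K; K \<subseteq> disc\<rbrakk> \<Longrightarrow> finite {g\<in>\<Gamma>. g ` K \<inter> K \<noteq> {}}"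
    "\<exists>K. compact K \<and> K \<subseteq> disc \<and> (\<forall>z\<in>disc. \<exists>g\<in>\<Gamma>. g z \<in> K)"
proof -
  note a = assms[unfolded surface_group_def]
  note c2 = conjunct2[OF a] note c3 = conjunct2[OF c2] note c4 = conjunct2[OF c3]
  note c5 = conjunct2[OF c4] note c6 = conjunct2[OF c5] note c7 = conjunct2[OF c6]
  show "\<Gamma> \<subseteq> disc_automorphisms" "id \<in> \<Gamma>" using conjunct1[OF a] conjunct1[OF c2] by blast+
  show "\<exists>k\<in>\<Gamma>. \<forall>z\<in>disc. h (g z) = k z" if "g \<in> \<Gamma>" "h \<in> \<Gamma>" for g h
    using conjunct1[OF c3] that by blast
  show "\<exists>h\<in>\<Gamma>. \<forall>z\<in>disc. h (g z) = z" if "g \<in> \<Gamma>" for g using conjunct1[OF c4] that by blast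
  show "g w = w" if "g \<in> \<Gamma>" "z \<in> disc" "g z = z" "w \<in> disc" for g z w
    using conjunct1[OF c5] that by blast
  show "finite {g\<in>\<Gamma>. g ` K \<inter> K \<noteq> {}}" if "compact K" "K \<subseteq> disc" for K
    using conjunct1[OF c6] that by blast
  show "\<exists>K. compact K \<and> K \<subseteq> disc \<and> (\<forall>z\<in>disc. \<exists>g\<in>\<Gamma>. g z \<in> K)" using c7 .
qed

lemma orbit_eq:
  assumes G: "surface_group \<Gamma>" and z: "z \<in> disc" and g: "g \<in> \<Gamma>"
  shows "orbit \<Gamma> (g z) = orbit \<Gamma> z"
proof
  note D = surface_groupD[OF G]
  have gz: "g z \<in> disc" using disc_automorphisms_in_disc[OF subsetD[OF D(1) g] z] .
  show "orbit \<Gamma> (g z) \<subseteq> orbit \<Gamma> z"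
  proof
    fix x assume "x \<in> orbit \<Gamma> (g z)"
    then obtain h where h: "h \<in> \<Gamma>" "x = h (g z)" unfolding orbit_def by blast
    obtain k where "k \<in> \<Gamma>" "\<forall>z\<in>disc. h (g z) = k z" using D(3)[OF g h(1)] by blast
    then show "x \<in> orbit \<Gamma> z" unfolding orbit_def using h(2) z by blast
  qed
  show "orbit \<Gamma> z \<subseteq> orbit \<Gamma> (g z)"
  proof
    fix x assume "x \<in> orbit \<Gamma> z"
    then obtain h where h: "h \<in> \<Gamma>" "x = h z" unfolding orbit_def by blast
    obtain i where i: "i \<in> \<Gamma>" "\<forall>z\<in>disc. i (g z) = z" using D(4)[OF g] by blast
    obtain k where k: "k \<in> \<Gamma>" "\<forall>z\<in>disc. h (i z) = k z" using D(3)[OF i(1) h(1)] by blast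
    have "x = k (g z)" using k(2) gz i(2) z h(2) by metis
    then show "x \<in> orbit \<Gamma> (g z)" unfolding orbit_def using k(1) by blast
  qed
qed

lemma norm_deriv_disc_automorphism:
  assumes h: "h \<in> disc_automorphisms" and z: "z \<in> disc"
  shows "norm (deriv h z) * (1 - (norm z)\<^sup>2) = 1 - (norm (h z))\<^sup>2"
proof -
  obtain u a where ua: "h = disc_moebius u a" "norm u = 1" "norm a < 1"
    using h unfolding disc_automorphisms_def by blast
  have z1: "norm z < 1" using z by simp
  have nz: "1 - cnj a * z \<noteq> 0" using one_minus_mult_nz[OF ua(3) z1] .
  have "((\<lambda>z. u * (z - a) / (1 - cnj a * z)) has_field_derivative
     (u * (1 - cnj a * z) - u * (z - a) * (- cnj a)) / ((1 - cnj a * z) * (1 - cnj a * z))) (at z)"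
    by (rule DERIV_divide) (use nz in \<open>auto intro!: derivative_eq_intros\<close>)
  then have "deriv h z = (u * (1 - cnj a * z) - u * (z - a) * (- cnj a)) / ((1 - cnj a * z) * (1 - cnj a * z))"
    unfolding ua(1) disc_moebius_def by (rule DERIV_imp_deriv)
  also have "u * (1 - cnj a * z) - u * (z - a) * (- cnj a) = u * of_real (1 - (norm a)\<^sup>2)"
    unfolding of_real_diff complex_norm_square by (simp add: algebra_simps)
  finally have "norm (deriv h z) = \<bar>1 - (norm a)\<^sup>2\<bar> / (norm (1 - cnj a * z))\<^sup>2"
    using ua(2) by (simp only: norm_divide norm_mult norm_of_real power2_eq_square mult_1_left)
  moreover have "\<bar>1 - (norm a)\<^sup>2\<bar> = 1 - (norm a)\<^sup>2" using ua(3) by (simp add: abs_square_le_1)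
  ultimately show ?thesis
    using one_minus_norm_disc_moebius[OF ua(2,3) z1] unfolding ua(1) by simp
qed

text \<open>\<open>m\<close> is an automorphic form whose automorphy factor is the square of
  \<open>deriv h ^ n\<close>, so no choice of root is needed for the factor of its square root.
  \<open>B\<close> keeps only the zeros of odd order, because at the others \<open>m\<close> already
  has a local square root. A point of \<open>B\<close> will supply a lift of sign -1.\<close>

locale branched_orbifold_cover =
  fixes \<Gamma>T :: "(complex \<Rightarrow> complex) set" and m F :: "complex \<Rightarrow> complex" and n :: nat and B :: "complex set"
  assumes surface: "surface_group \<Gamma>T"
    and m_hol: "m holomorphic_on disc" and m0: "m 0 \<noteq> 0"
    and m_aut: "\<And>h z. \<lbrakk>h \<in> \<Gamma>T; z \<in> disc\<rbrakk> \<Longrightarrow> m (h z) * deriv h z ^ (2 * n) = m z"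
    and B_def: "B = {z\<in>disc. odd (zorder m z)}" and B_ne: "B \<noteq> {}"
    and F_orb: "orbifold_map B F" and F_lift: "lifts_orbifold_maps B F"
begin

lemmas T_aut = subsetD[OF surface_groupD(1)[OF surface]]
lemmas F_hol = orbifold_mapD(1)[OF F_orb]
lemmas F_disc = orbifold_mapD(2)[OF F_orb]
lemmas F0 = lifts_orbifold_mapsD(3)[OF F_lift]

lemma F_in_disc: "z \<in> disc \<Longrightarrow> F z \<in> disc"
  using F_disc by blast

lemma T_in_disc: "h \<in> \<Gamma>T \<Longrightarrow> z \<in> disc \<Longrightarrow> h z \<in> disc"
  using disc_automorphisms_in_disc T_aut by blast

lemma T_hol: "h \<in> \<Gamma>T \<Longrightarrow> h holomorphic_on disc"
  using disc_automorphisms_holomorphic T_aut by blast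

lemma m_eventually_nz: "z \<in> disc \<Longrightarrow> eventually (\<lambda>w. m w \<noteq> 0) (at z)"
  using eventually_nonzero_disc[OF m_hol _ m0] by simp

lemma m_B: "b \<in> B \<Longrightarrow> b \<in> disc \<and> m b = 0"
  using zorder_eq_0I[OF analytic_at_disc[OF m_hol]] unfolding B_def by force

lemma B_isolated:
  assumes "p \<in> disc"
  obtains e where "e > 0" "ball p e \<subseteq> disc" "ball p e \<inter> B \<subseteq> {p}"
proof -
  obtain d where d: "d > 0" "\<And>w. w \<noteq> p \<Longrightarrow> dist w p < d \<Longrightarrow> m w \<noteq> 0"
    using m_eventually_nz[OF assms] unfolding eventually_at by blast
  obtain c where c: "c > 0" "ball p c \<subseteq> disc"
    using assms open_contains_ball[of disc] by blast
  have "ball p (min c d) \<inter> B \<subseteq> {p}"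
  proof
    fix x assume x: "x \<in> ball p (min c d) \<inter> B"
    then have "dist x p < d" "m x = 0" using m_B by (auto simp: dist_commute)
    then show "x \<in> {p}" using d(2) by blast
  qed
  then show ?thesis using that[of "min c d"] c d by (meson min_less_iff_conj min.cobounded1 subset_ball subset_trans)
qed

lemma T_inverse:
  assumes "h \<in> \<Gamma>T"
  obtains k where "k \<in> \<Gamma>T" "\<And>z. z \<in> disc \<Longrightarrow> k (h z) = z" "\<And>z. z \<in> disc \<Longrightarrow> h (k z) = z"
proof -
  obtain k where k: "k \<in> \<Gamma>T" "\<forall>z\<in>disc. k (h z) = z" using surface_groupD(4)[OF surface assms] by blast
  obtain l where l: "l \<in> disc_automorphisms" "\<And>z. z \<in> disc \<Longrightarrow> l (h z) = z"
      "\<And>z. z \<in> disc \<Longrightarrow> h (l z) = z"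
    by (rule disc_automorphism_inverse[OF T_aut[OF assms]]) (rule that)
  have "k z = l z" if "z \<in> disc" for z
    using k(2) l that disc_automorphisms_in_disc[OF l(1) that] by metis
  then show ?thesis using that[OF k(1)] k(2) l(3) by simp
qed

text \<open>\<open>h\<close> is injective and the factor \<open>deriv h z ^ (2 * n)\<close> has no
  zeros, so neither changes the order. Hence \<open>B\<close> is a union of orbits.\<close>

lemma zorder_m_invariant:
  assumes h: "h \<in> \<Gamma>T" and z: "z \<in> disc"
  shows "zorder m (h z) = zorder m z"
proof -
  have h': "deriv h z \<noteq> 0" using disc_automorphism_deriv_nz[OF T_aut[OF h] z] .
  have hz: "h z \<in> disc" using T_in_disc h z by blast
  have "(\<lambda>x. h x - h z) holomorphic_on disc" by (intro holomorphic_intros T_hol h)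
  moreover have "deriv (\<lambda>x. h x - h z) z = deriv h z"
    using holomorphic_derivI[OF T_hol[OF h] open_ball z] by (intro DERIV_imp_deriv) (auto intro!: derivative_eq_intros)
  ultimately have z1: "zorder (\<lambda>x. h x - h z) z = 1"
    using h' z by (intro zorder_simple_zero[of _ disc]) auto
  have evh: "eventually (\<lambda>w. h w \<noteq> h z) (at z)"
  proof -
    obtain k where k: "k \<in> \<Gamma>T" "\<And>z. z \<in> disc \<Longrightarrow> k (h z) = z" "\<And>z. z \<in> disc \<Longrightarrow> h (k z) = z"
      by (rule T_inverse[OF h]) (rule that)
    have "eventually (\<lambda>w. w \<in> disc \<and> w \<noteq> z) (at z)" 
      using z eventually_at_in_open'[of disc z] by (auto intro!: eventually_conj simp: eventually_neq_at_within)
    then show ?thesis by eventually_elim (use k(2) z in metis)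
  qed
  have "zorder (m \<circ> h) z = zorder m (h z) * zorder (\<lambda>x. h x - h z) z"
    using analytic_at_disc[OF m_hol hz] analytic_at_disc[OF T_hol[OF h] z] m_eventually_nz[OF hz] evh
    by (intro zorder_compose' isolated_singularity_at_analytic not_essential_analytic)
  then have 1: "zorder (\<lambda>x. m (h x)) z = zorder m (h z)" by (simp add: z1 o_def)
  have mh: "(\<lambda>x. m (h x)) holomorphic_on disc"
    by (rule holomorphic_compose_disc[OF T_hol[OF h] _ m_hol]) (use T_in_disc[OF h] in blast)
  have dh: "(\<lambda>x. deriv h x ^ (2 * n)) holomorphic_on disc"
    by (intro holomorphic_intros holomorphic_deriv T_hol h open_ball)
  have evd: "eventually (\<lambda>w. w \<in> disc) (at z)" using z by (intro eventually_at_in_open') auto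
  have eq: "eventually (\<lambda>w. m (h w) * deriv h w ^ (2 * n) = m w) (at z)"
    using evd by eventually_elim (use m_aut[OF h] in blast)
  have "zorder (\<lambda>x. m (h x) * deriv h x ^ (2 * n)) z = zorder (\<lambda>x. m (h x)) z + zorder (\<lambda>x. deriv h x ^ (2 * n)) z"
  proof (rule zorder_times_analytic[OF analytic_at_disc[OF mh z] analytic_at_disc[OF dh z]])
    show "eventually (\<lambda>w. m (h w) * deriv h w ^ (2 * n) \<noteq> 0) (at z)"
      using eq m_eventually_nz[OF z] by eventually_elim auto
  qed
  moreover have "zorder (\<lambda>x. deriv h x ^ (2 * n)) z = 0"
    using h' by (intro zorder_eq_0I analytic_at_disc[OF dh z]) auto
  moreover have "zorder (\<lambda>x. m (h x) * deriv h x ^ (2 * n)) z = zorder m z"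
    using eq by (intro zorder_cong) auto
  ultimately show ?thesis using 1 by simp
qed

lemma B_invariant: "h \<in> \<Gamma>T \<Longrightarrow> z \<in> disc \<Longrightarrow> h z \<in> B \<longleftrightarrow> z \<in> B"
  using zorder_m_invariant T_in_disc unfolding B_def by force

lemma zero_notin_B: "0 \<notin> B"
  using m_B m0 by blast

text \<open>A small disc about \<open>F z\<close> misses \<open>B\<close> and therefore lifts; the
  chain rule shows that \<open>deriv F z\<close> times the derivative of the lift is the
  radius.\<close>

lemma F_deriv_nz:
  assumes z: "z \<in> disc" and "F z \<notin> B"
  shows "deriv F z \<noteq> 0"
proof -
  obtain e where e: "e > 0" "ball (F z) e \<subseteq> disc" "ball (F z) e \<inter> B \<subseteq> {F z}"
    by (rule B_isolated[OF F_in_disc[OF z]])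
  have eB: "ball (F z) e \<inter> B = {}" using e(3) assms(2) by blast
  have "\<exists>H. H holomorphic_on disc \<and> H ` disc \<subseteq> disc \<and> H 0 = z \<and> (\<forall>x\<in>disc. F (H x) = F z + of_real e * x)"
    by (rule lifts_orbifold_mapsD(4)[OF F_lift _ z orbifold_map_affine[OF e(1,2) eB]]) simp_all
  then obtain H where H: "H holomorphic_on disc" "H ` disc \<subseteq> disc" "H 0 = z"
     "\<And>x. x \<in> disc \<Longrightarrow> F (H x) = F z + of_real e * x"
    by blast
  have "deriv (\<lambda>x. F z + of_real e * x) 0 = deriv F (H 0) * deriv H 0"
    by (rule deriv_chain_disc[OF H(1,2) F_hol]) (use H(4) in auto)
  moreover have "deriv (\<lambda>x. F z + of_real e * x) 0 = of_real e"
    by (rule DERIV_imp_deriv) (auto intro!: derivative_eq_intros)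
  ultimately show ?thesis using e H(3) by auto
qed

text \<open>The lift \<open>H\<close> of the squaring model and the root \<open>r\<close> of
  \<open>F - F z\<close> are local inverses up to scaling: \<open>r \<circ> H\<close> has the same
  square as \<open>sqrt e * x\<close>, hence is linear and nonzero. So \<open>r\<close> is a local
  coordinate in which \<open>F\<close> is the square map.\<close>

lemma branch_point:
  assumes z: "z \<in> disc" and b: "F z \<in> B"
  obtains r H e where "r holomorphic_on disc" "\<And>x. x \<in> disc \<Longrightarrow> (r x)\<^sup>2 = F x - F z"
    "r z = 0" "deriv r z \<noteq> 0" "H holomorphic_on disc" "H ` disc \<subseteq> disc" "H 0 = z"
    "deriv H 0 \<noteq> 0" "\<And>x. x \<in> disc \<Longrightarrow> F (H x) = F z + of_real e * x\<^sup>2"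
    "e > 0" "ball (F z) e \<inter> B \<subseteq> {F z}"
proof -
  obtain e where e: "e > 0" "ball (F z) e \<subseteq> disc" "ball (F z) e \<inter> B \<subseteq> {F z}"
    by (rule B_isolated[OF F_in_disc[OF z]])
  have "\<exists>H. H holomorphic_on disc \<and> H ` disc \<subseteq> disc \<and> H 0 = z \<and> (\<forall>x\<in>disc. F (H x) = F z + of_real e * x\<^sup>2)"
    by (rule lifts_orbifold_mapsD(4)[OF F_lift _ z orbifold_map_square[OF e]]) simp_all
  then obtain H where H: "H holomorphic_on disc" "H ` disc \<subseteq> disc" "H 0 = z"
     "\<And>x. x \<in> disc \<Longrightarrow> F (H x) = F z + of_real e * x\<^sup>2"
    by blast
  obtain r where r: "r holomorphic_on disc" "\<And>x. x \<in> disc \<Longrightarrow> (r x)\<^sup>2 = F x - F z"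
    using orbifold_mapD(3)[OF F_orb b] by blast
  have r0: "r z = 0" using r(2)[OF z] by simp
  define c where "c = complex_of_real (sqrt e)"
  have c: "c \<noteq> 0" "c\<^sup>2 = of_real e" using e by (auto simp: c_def simp flip: of_real_power)
  have rH: "(\<lambda>x. r (H x)) holomorphic_on disc" using holomorphic_compose_disc[OF H(1,2) r(1)] .
  have "(\<forall>x\<in>disc. r (H x) = c * x) \<or> (\<forall>x\<in>disc. r (H x) = - (c * x))"
  proof (rule square_eq_imp_eq_or_minus[OF open_ball connected_ball rH])
    show "(r (H x))\<^sup>2 = (c * x)\<^sup>2" if "x \<in> disc" for x
    proof -
      have "H x \<in> disc" using H(2) that by blast
      then show ?thesis using r(2)[of "H x"] H(4)[OF that] c by (simp add: power_mult_distrib)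
    qed
  qed (intro holomorphic_intros)
  then obtain c' where c': "c' \<noteq> 0" "\<And>x. x \<in> disc \<Longrightarrow> c' * x = r (H x)"
    using c(1) by (metis mult_minus_left neg_equal_0_iff_equal)
  have "deriv (\<lambda>x. c' * x) 0 = deriv r (H 0) * deriv H 0"
    by (rule deriv_chain_disc[OF H(1,2) r(1)]) (use c' in auto)
  then have "deriv r z * deriv H 0 = c'" using H(3) by simp
  then show ?thesis using that[OF r r0 _ H(1-3) _ H(4) e(1,3)] c'(1) by fastforce
qed

lemma F_not_constant: "\<not> F constant_on disc"
proof
  assume "F constant_on disc"
  then obtain c where c: "\<And>x. x \<in> disc \<Longrightarrow> F x = c" unfolding constant_on_def by blast
  have "deriv F 0 = 0" by (rule deriv_eq_0_const_disc[OF c]) auto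
  then show False using F_deriv_nz[of 0] F0 zero_notin_B by simp
qed

text \<open>The image is open. It is also closed in the disc: near a limit point \<open>p\<close> it
  contains some \<open>F z\<close>, and the squaring model centred at \<open>p\<close> lifts through
  \<open>z\<close>, so its centre \<open>p\<close> is a value too. The model avoids a distinction
  whether \<open>p\<close> lies in \<open>B\<close>.\<close>

lemma F_surj:
  assumes "p \<in> disc"
  obtains z where "z \<in> disc" "F z = p"
proof -
  have op: "open (F ` disc)"
    using open_mapping_thm[OF F_hol open_ball connected_ball open_ball _ F_not_constant] by simp
  have "F ` disc = {} \<or> F ` disc = disc"
  proof (rule connected_clopen[THEN iffD1, rule_format, OF connected_ball], intro conjI)
    show "openin (top_of_set disc) (F ` disc)"
      using op F_disc by (simp add: openin_open_eq)
    show "closedin (top_of_set disc) (F ` disc)"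
      unfolding closedin_limpt
    proof (intro conjI F_disc allI impI)
      fix p assume p: "p islimpt F ` disc \<and> p \<in> disc"
      obtain e where e: "e > 0" "ball p e \<subseteq> disc" "ball p e \<inter> B \<subseteq> {p}"
        by (rule B_isolated[OF conjunct2[OF p]])
      obtain z where z: "z \<in> disc" "F z \<in> ball p e"
        using p e(1) unfolding islimpt_approachable by (metis dist_commute imageE mem_ball)
      \<comment> \<open>The point at which the model map takes the value \<open>F z\<close>, where
        the lift has to be anchored.\<close>
      define \<zeta> where "\<zeta> = csqrt ((F z - p) / of_real e)"
      have \<zeta>: "F z = p + of_real e * \<zeta>\<^sup>2" using e by (simp add: \<zeta>_def)
      have "norm ((F z - p) / of_real e) < 1"
        using z(2) e by (simp add: norm_divide dist_norm norm_minus_commute)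
      then have "(norm \<zeta>)\<^sup>2 < 1" by (simp add: \<zeta>_def flip: norm_power)
      then have \<zeta>d: "\<zeta> \<in> disc" by (simp add: abs_square_less_1)
      have orb: "orbifold_map B (\<lambda>x. p + of_real e * x\<^sup>2)"
        using orbifold_map_square[OF e] .
      obtain H where "H ` disc \<subseteq> disc" "\<forall>x\<in>disc. F (H x) = p + of_real e * x\<^sup>2"
        using lifts_orbifold_mapsD(4)[OF F_lift \<zeta>d z(1) orb] \<zeta> by metis
      then have "F (H 0) = p" "H 0 \<in> disc" by (auto simp: image_subset_iff)
      then show "p \<in> F ` disc" by blast
    qed
  qed
  then have "p \<in> F ` disc" using assms by auto
  then show ?thesis using that by blast
qed

lemma local_mult_unbranched:
  assumes z: "z \<in> disc" and "F z \<notin> B"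
  shows "zorder (\<lambda>x. F x - F z) z = 1"
proof (rule zorder_simple_zero[of _ disc])
  have "deriv (\<lambda>x. F x - F z) z = deriv F z"
    using holomorphic_derivI[OF F_hol open_ball z] by (intro DERIV_imp_deriv) (auto intro!: derivative_eq_intros)
  then show "deriv (\<lambda>x. F x - F z) z \<noteq> 0" using F_deriv_nz[OF assms] by simp
qed (use z F_hol in \<open>auto intro!: holomorphic_intros\<close>)

lemma local_mult_branched:
  assumes z: "z \<in> disc" and "F z \<in> B"
  shows "zorder (\<lambda>x. F x - F z) z = 2"
proof -
  obtain r H e where r: "r holomorphic_on disc" "\<And>x. x \<in> disc \<Longrightarrow> (r x)\<^sup>2 = F x - F z"
    "r z = 0" "deriv r z \<noteq> 0" and H: "H holomorphic_on disc" "H ` disc \<subseteq> disc" "H 0 = z"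
    "deriv H 0 \<noteq> 0" "\<And>x. x \<in> disc \<Longrightarrow> F (H x) = F z + of_real e * x\<^sup>2"
    "e > 0" "ball (F z) e \<inter> B \<subseteq> {F z}"
    by (rule branch_point[OF assms]) (rule that)
  have evd: "eventually (\<lambda>w. w \<in> disc) (at z)" using z by (intro eventually_at_in_open') auto
  have "zorder (\<lambda>x. F x - F z) z = zorder (\<lambda>x. (r x)\<^sup>2) z"
  proof (rule zorder_cong)
    show "eventually (\<lambda>x. F x - F z = (r x)\<^sup>2) (at z)"
      using evd by eventually_elim (use r(2) in metis)
  qed auto
  also have "\<dots> = 2 * zorder r z"
  proof -
    have "\<exists>a\<in>disc. r a \<noteq> 0"
    proof (rule ccontr)
      assume "\<not> ?thesis"
      then have "\<And>x. x \<in> disc \<Longrightarrow> r x = 0" by blast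
      then have "deriv r z = 0" using z by (rule deriv_eq_0_const_disc)
      then show False using r(4) by blast
    qed
    then have "eventually (\<lambda>w. r w \<noteq> 0) (at z)" using eventually_nonzero_disc[OF r(1) _ _ z] by blast
    then have "frequently (\<lambda>w. r w \<noteq> 0) (at z)" by (intro eventually_frequently) auto
    then show ?thesis
      using zorder_power[of r z 2] analytic_at_disc[OF r(1) z] analytic_on_imp_meromorphic_on by simp
  qed
  also have "zorder r z = 1" using zorder_simple_zero[OF r(1) open_ball z r(3,4)] .
  finally show ?thesis by simp
qed

lemma F_eventually_ne:
  assumes "z \<in> disc"
  shows "eventually (\<lambda>w. F w \<noteq> F z) (at z)"
proof -
  obtain a where "a \<in> disc" "F a - F z \<noteq> 0"
  proof (rule ccontr)
    assume *: "\<not> thesis"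
    have half: "(1/2::complex) \<in> disc" by simp
    obtain b where b: "b \<in> disc" "F b = 1/2" by (rule F_surj[OF half])
    have "F 0 - F z = 0" "F b - F z = 0" using * that b(1) by (meson centre_in_ball zero_less_one)+
    then show False using F0 b(2) by simp
  qed
  moreover have "(\<lambda>w. F w - F z) holomorphic_on disc" by (intro holomorphic_intros F_hol)
  ultimately show ?thesis using eventually_nonzero_disc[of "\<lambda>w. F w - F z" a z] assms by simp
qed

lemma zorder_m_F:
  assumes z: "z \<in> disc"
  shows "zorder (\<lambda>x. m (F x)) z = zorder m (F z) * zorder (\<lambda>x. F x - F z) z"
proof -
  have Fz: "F z \<in> disc" using F_in_disc z .
  have "zorder (m \<circ> F) z = zorder m (F z) * zorder (\<lambda>x. F x - F z) z"
    using analytic_at_disc[OF m_hol Fz] analytic_at_disc[OF F_hol z] m_eventually_nz[OF Fz] F_eventually_ne[OF z]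
    by (intro zorder_compose' isolated_singularity_at_analytic not_essential_analytic)
  then show ?thesis by (simp add: o_def)
qed

text \<open>Over \<open>B\<close> the order of \<open>m\<close> is doubled by the branching of
  \<open>F\<close>; elsewhere it is even already.\<close>

lemma sqrt_m_F_exists: "\<exists>s. s holomorphic_on disc \<and> (\<forall>z\<in>disc. (s z)\<^sup>2 = m (F z))"
proof -
  have hol: "(\<lambda>x. m (F x)) holomorphic_on disc" using holomorphic_compose_disc[OF F_hol F_disc m_hol] .
  have ev: "even (zorder (\<lambda>x. m (F x)) z)" if z: "z \<in> disc" for z
  proof (cases "F z \<in> B")
    case True
    then show ?thesis using zorder_m_F[OF z] local_mult_branched[OF z] by simp
  next
    case False
    then have "even (zorder m (F z))" using F_in_disc[OF z] unfolding B_def by blast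
    then show ?thesis using zorder_m_F[OF z] by simp
  qed
  obtain s where "s holomorphic_on disc" "\<And>z. z \<in> disc \<Longrightarrow> (s z)\<^sup>2 = m (F z)"
    using F0 m0 by (rule_tac holomorphic_sqrt_even_zorder[OF hol _ _ ev, of 0]) auto
  then show ?thesis by blast
qed

definition s where "s = (SOME s. s holomorphic_on disc \<and> (\<forall>z\<in>disc. (s z)\<^sup>2 = m (F z)))"

lemma s_hol: "s holomorphic_on disc" and s_sq: "z \<in> disc \<Longrightarrow> (s z)\<^sup>2 = m (F z)"
  using someI_ex[OF sqrt_m_F_exists] unfolding s_def[symmetric] by blast+

lemma s0: "s 0 \<noteq> 0"
  using s_sq[of 0] F0 m0 by auto

text \<open>As \<open>m\<close> has even weight, the square root \<open>s\<close> of \<open>m \<circ> F\<close> transforms under the lifts of \<open>\<Gamma>T\<close> with a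
  sign \<open>\<sigma>\<close>; the lifts of sign 1 form the group of the double cover.\<close>

definition over :: "complex \<Rightarrow> (complex \<Rightarrow> complex) \<Rightarrow> (complex \<Rightarrow> complex) \<Rightarrow> bool" where
  "over \<sigma> g h \<longleftrightarrow> g \<in> disc_automorphisms \<and> h \<in> \<Gamma>T \<and>
     (\<forall>x\<in>disc. F (g x) = h (F x) \<and> s (g x) * deriv h (F x) ^ n = \<sigma> * s x)"

lemma overD:
  assumes "over \<sigma> g h"
  shows "g \<in> disc_automorphisms" "h \<in> \<Gamma>T" "\<And>x. x \<in> disc \<Longrightarrow> F (g x) = h (F x)"
    "\<And>x. x \<in> disc \<Longrightarrow> s (g x) * deriv h (F x) ^ n = \<sigma> * s x"
    "g holomorphic_on disc" "\<And>x. x \<in> disc \<Longrightarrow> g x \<in> disc"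
  using assms disc_automorphisms_holomorphic disc_automorphisms_in_disc unfolding over_def by blast+

section \<open>Lifts of the target group and their signs\<close>

lemma lift_exists:
  assumes h: "h \<in> \<Gamma>T" and zw: "z \<in> disc" "w \<in> disc" "F w = h (F z)"
  obtains g where "g holomorphic_on disc" "g ` disc \<subseteq> disc" "g z = w" "\<And>x. x \<in> disc \<Longrightarrow> F (g x) = h (F x)"
proof -
  have "orbifold_map B (\<lambda>x. h (F x))"
  proof (rule orbifold_map_compose_automorphism[OF T_aut[OF h] F_orb])
    fix b assume b: "b \<in> B"
    obtain k where k: "k \<in> \<Gamma>T" "\<And>z. z \<in> disc \<Longrightarrow> k (h z) = z" "\<And>z. z \<in> disc \<Longrightarrow> h (k z) = z"
      by (rule T_inverse[OF h]) (rule that)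
    show "\<exists>c\<in>B \<inter> disc. h c = b"
      using m_B[OF b] b k(3) B_invariant[OF k(1)] T_in_disc[OF k(1)] by (intro bexI[of _ "k b"]) blast+
  qed
  then show ?thesis
    using lifts_orbifold_mapsD(4)[OF F_lift zw(1,2), of "\<lambda>x. h (F x)"] zw(3) that by metis
qed

text \<open>A lift of \<open>h\<close> and a lift of its inverse are mutually inverse by unique
  lifting, so both are automorphisms. The two sides of the transformation law for \<open>s\<close>
  have equal squares, which leaves a global sign. As \<open>z\<close> and \<open>w\<close> are
  arbitrary, the lifts act transitively on the points over an orbit.\<close>

lemma over_exists:
  assumes h: "h \<in> \<Gamma>T" and zw: "z \<in> disc" "w \<in> disc" "F w = h (F z)"
  obtains g \<sigma> where "\<sigma> = 1 \<or> \<sigma> = -1" "over \<sigma> g h" "g z = w"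
proof -
  obtain g where g: "g holomorphic_on disc" "g ` disc \<subseteq> disc" "g z = w" "\<And>x. x \<in> disc \<Longrightarrow> F (g x) = h (F x)"
    by (rule lift_exists[OF assms]) (rule that)
  obtain k where k: "k \<in> \<Gamma>T" "\<And>z. z \<in> disc \<Longrightarrow> k (h z) = z" "\<And>z. z \<in> disc \<Longrightarrow> h (k z) = z"
    by (rule T_inverse[OF h]) (rule that)
  have gd: "g x \<in> disc" if "x \<in> disc" for x using g(2) that by blast
  \<comment> \<open>Unique lifting needs a noncritical base point, and \<open>z\<close> may lie over
    \<open>B\<close>; hence the auxiliary point.\<close>
  obtain x0 where x0: "x0 \<in> disc" "F x0 \<notin> B"
    using F0 zero_notin_B by (intro that[of 0]) auto
  have y0: "g x0 \<in> disc" "F (g x0) \<notin> B"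
    using gd[OF x0(1)] g(4)[OF x0(1)] B_invariant[OF h F_in_disc[OF x0(1)]] x0 by auto
  have "F x0 = k (F (g x0))" using g(4)[OF x0(1)] k(2) F_in_disc x0(1) by simp
  then obtain g' where g': "g' holomorphic_on disc" "g' ` disc \<subseteq> disc" "g' (g x0) = x0"
     "\<And>x. x \<in> disc \<Longrightarrow> F (g' x) = k (F x)"
    by (rule lift_exists[OF k(1) y0(1) x0(1)]) (rule that)
  have gd': "g' x \<in> disc" if "x \<in> disc" for x using g'(2) that by blast
  have 1: "g' (g x) = x" if "x \<in> disc" for x
  proof (rule lift_unique[OF F_hol open_ball connected_ball _ _ holomorphic_on_ident _ _ x0(1) _ _ that])
    show "(\<lambda>x. g' (g x)) holomorphic_on disc" using holomorphic_compose_disc[OF g(1,2) g'(1)] .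
    show "(\<lambda>x. g' (g x)) ` disc \<subseteq> disc" using gd gd' by blast
    show "F (g' (g x)) = F x" if "x \<in> disc" for x
      using g'(4)[OF gd[OF that]] g(4)[OF that] k(2) F_in_disc[OF that] by simp
    show "deriv F (g' (g x0)) \<noteq> 0" using g'(3) F_deriv_nz[OF x0] by simp
  qed (use g'(3) in auto)
  have 2: "g (g' x) = x" if "x \<in> disc" for x
  proof (rule lift_unique[OF F_hol open_ball connected_ball _ _ holomorphic_on_ident _ _ y0(1) _ _ that])
    show "(\<lambda>x. g (g' x)) holomorphic_on disc" using holomorphic_compose_disc[OF g'(1,2) g(1)] .
    show "(\<lambda>x. g (g' x)) ` disc \<subseteq> disc" using gd gd' by blast
    show "F (g (g' x)) = F x" if "x \<in> disc" for x
      using g(4)[OF gd'[OF that]] g'(4)[OF that] k(3) F_in_disc[OF that] by simp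
    show "deriv F (g (g' (g x0))) \<noteq> 0" using g'(3) F_deriv_nz[OF y0] by simp
  qed (use g'(3) in auto)
  obtain G where G: "G \<in> disc_automorphisms" "\<And>x. x \<in> disc \<Longrightarrow> g x = G x"
    by (rule biholomorphism_is_disc_automorphism[OF g(1,2) g'(1,2) 2 1]) (assumption | rule that)+
  have hol: "(\<lambda>x. s (g x) * deriv h (F x) ^ n) holomorphic_on disc"
    using holomorphic_compose_disc[OF g(1,2) s_hol]
      holomorphic_compose_disc[OF F_hol F_disc holomorphic_deriv[OF T_hol[OF h] open_ball]]
    by (intro holomorphic_intros)
  have "(\<forall>x\<in>disc. s (g x) * deriv h (F x) ^ n = s x) \<or> (\<forall>x\<in>disc. s (g x) * deriv h (F x) ^ n = - s x)"
  proof (rule square_eq_imp_eq_or_minus[OF open_ball connected_ball hol s_hol])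
    fix x assume x: "x \<in> disc"
    have "(s (g x) * deriv h (F x) ^ n)\<^sup>2 = m (h (F x)) * deriv h (F x) ^ (2 * n)"
      using s_sq[OF gd[OF x]] g(4)[OF x] by (simp add: power_mult_distrib power_mult mult.commute flip: power_mult)
    then show "(s (g x) * deriv h (F x) ^ n)\<^sup>2 = (s x)\<^sup>2"
      using m_aut[OF h F_in_disc[OF x]] s_sq[OF x] by simp
  qed
  then obtain \<sigma> :: complex where "\<sigma> = 1 \<or> \<sigma> = -1" "\<forall>x\<in>disc. s (g x) * deriv h (F x) ^ n = \<sigma> * s x"
    by force
  then have "over \<sigma> G h" "\<sigma> = 1 \<or> \<sigma> = -1"
    unfolding over_def using G g(4) h by auto
  then show ?thesis using that G(2)[OF zw(1)] g(3) by metis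
qed

lemma over_compose:
  assumes "over \<sigma> g h" "over \<sigma>' g' h'"
  obtains k l where "over (\<sigma>' * \<sigma>) k l" "\<And>x. x \<in> disc \<Longrightarrow> k x = g' (g x)" "\<And>x. x \<in> disc \<Longrightarrow> l x = h' (h x)"
proof -
  note 1 = overD[OF assms(1)] and 2 = overD[OF assms(2)]
  obtain k where k: "k \<in> disc_automorphisms" "\<And>z. z \<in> disc \<Longrightarrow> g' (g z) = k z"
    by (rule disc_automorphism_compose[OF 1(1) 2(1)]) (rule that)
  obtain l where l: "l \<in> \<Gamma>T" "\<And>z. z \<in> disc \<Longrightarrow> h' (h z) = l z"
    using surface_groupD(3)[OF surface 1(2) 2(2)] by blast
  have "F (k x) = l (F x) \<and> s (k x) * deriv l (F x) ^ n = \<sigma>' * \<sigma> * s x" if x: "x \<in> disc" for x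
  proof
    have gx: "g x \<in> disc" using 1(6)[OF x] .
    show "F (k x) = l (F x)"
      using 2(3)[OF gx] 1(3)[OF x] k(2)[OF x] l(2)[OF F_in_disc[OF x]] by simp
    have "deriv l (F x) = deriv h' (h (F x)) * deriv h (F x)"
      by (rule deriv_chain_disc[OF T_hol[OF 1(2)] _ T_hol[OF 2(2)] F_in_disc[OF x]])
         (use l(2) T_in_disc[OF 1(2)] in \<open>auto simp del: mem_ball\<close>)
    then have "s (k x) * deriv l (F x) ^ n = s (g' (g x)) * deriv h' (F (g x)) ^ n * deriv h (F x) ^ n"
      using k(2)[OF x] 1(3)[OF x] by (simp add: power_mult_distrib)
    also have "\<dots> = \<sigma>' * (s (g x) * deriv h (F x) ^ n)" using 2(4)[OF gx] by simp
    also have "\<dots> = \<sigma>' * \<sigma> * s x" using 1(4)[OF x] by simp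
    finally show "s (k x) * deriv l (F x) ^ n = \<sigma>' * \<sigma> * s x" .
  qed
  then have "over (\<sigma>' * \<sigma>) k l" unfolding over_def using k(1) l(1) by blast
  then show ?thesis by (rule that) (simp_all add: k(2) l(2))
qed

lemma over_id: "over 1 id id"
proof -
  have "deriv id x = (1::complex)" for x by (simp add: id_def)
  then show ?thesis
    unfolding over_def using id_in_disc_automorphisms surface_groupD(2)[OF surface] by simp
qed

lemma T_fixed_point: "h \<in> \<Gamma>T \<Longrightarrow> p \<in> disc \<Longrightarrow> h p = p \<Longrightarrow> x \<in> disc \<Longrightarrow> h x = x"
  using surface_groupD(5)[OF surface] .

lemma deriv_identity_on_disc:
  assumes "\<And>x. x \<in> disc \<Longrightarrow> h x = x" "x \<in> disc"
  shows "deriv h x = 1"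
proof -
  have "(h has_field_derivative 1) (at x)"
    by (rule has_field_derivative_transform_within_open[of "\<lambda>x. x" _ _ disc]) (use assms in auto)
  then show ?thesis by (rule DERIV_imp_deriv)
qed

text \<open>If \<open>g\<close> fixes \<open>z\<close>, then \<open>h\<close> fixes
  \<open>F z\<close> and is the identity, so \<open>g\<close> preserves both \<open>F\<close> and
  \<open>s\<close>. Off \<open>B\<close>, unique lifting applies to \<open>F\<close>. Over
  \<open>B\<close>, the local coordinate \<open>r\<close> satisfies \<open>r \<circ> g = r\<close>
  or \<open>r \<circ> g = - r\<close>. The second case means \<open>deriv g z = -1\<close>, which is
  impossible because \<open>s\<close> is invariant and vanishes at \<open>z\<close> to odd order. In
  the first case unique lifting applies to \<open>r\<close>.\<close>

lemma over_torsion_free: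
  assumes o: "over 1 g h" and z: "z \<in> disc" "g z = z" and w: "w \<in> disc"
  shows "g w = w"
proof -
  note g = overD[OF o]
  have gd: "g ` disc \<subseteq> disc" using g(6) by blast
  have "h (F z) = F z" using g(3)[OF z(1)] z(2) by simp
  then have h: "h x = x" if "x \<in> disc" for x using T_fixed_point[OF g(2) F_in_disc[OF z(1)] _ that] by blast
  have Fg: "F (g x) = F x" if "x \<in> disc" for x using g(3)[OF that] h[OF F_in_disc[OF that]] by simp
  have sg: "s (g x) = s x" if "x \<in> disc" for x
    using g(4)[OF that] deriv_identity_on_disc[OF h F_in_disc[OF that]] by simp
  show ?thesis
  proof (cases "F z \<in> B")
    case False
    show ?thesis
      by (rule lift_unique[OF F_hol open_ball connected_ball g(5) gd holomorphic_on_ident _ Fg z(1) z(2) _ w])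
         (use z F_deriv_nz[OF z(1) False] in auto)
  next
    case True
  obtain r H e where r: "r holomorphic_on disc" "\<And>x. x \<in> disc \<Longrightarrow> (r x)\<^sup>2 = F x - F z"
    "r z = 0" "deriv r z \<noteq> 0" and H: "H holomorphic_on disc" "H ` disc \<subseteq> disc" "H 0 = z"
    "deriv H 0 \<noteq> 0" "\<And>x. x \<in> disc \<Longrightarrow> F (H x) = F z + of_real e * x\<^sup>2"
    "e > 0" "ball (F z) e \<inter> B \<subseteq> {F z}"
    by (rule branch_point[OF z(1) True]) (rule that)
    have g': "deriv g z \<noteq> 0" using disc_automorphism_deriv_nz[OF g(1) z(1)] .
    have sz: "s z = 0" using s_sq[OF z(1)] m_B[OF True] by simp
    have sord: "odd (nat (zorder s z))"
    proof -
      have "eventually (\<lambda>w. s w \<noteq> 0) (at z)" using eventually_nonzero_disc[OF s_hol _ s0 z(1)] by simp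
      then have fr: "frequently (\<lambda>w. s w \<noteq> 0) (at z)" by (intro eventually_frequently) auto
      have evd: "eventually (\<lambda>w. w \<in> disc) (at z)" using z by (intro eventually_at_in_open') auto
      have "2 * zorder s z = zorder (\<lambda>x. (s x)\<^sup>2) z"
        using zorder_power[OF _ fr, of 2] analytic_at_disc[OF s_hol z(1)] analytic_on_imp_meromorphic_on by simp
      also have "\<dots> = zorder (\<lambda>x. m (F x)) z"
      proof (rule zorder_cong)
        show "eventually (\<lambda>x. (s x)\<^sup>2 = m (F x)) (at z)"
          using evd by eventually_elim (use s_sq in blast)
      qed auto
      also have "\<dots> = zorder m (F z) * 2" using zorder_m_F[OF z(1)] local_mult_branched[OF z(1) True] by simp
      finally have "zorder s z = zorder m (F z)" by simp
      moreover have "odd (zorder m (F z))" using True unfolding B_def by blast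
      moreover have "zorder s z \<ge> 0"
        using zorder_ge_0[OF analytic_at_disc[OF s_hol z(1)] fr] .
      ultimately show ?thesis by (simp add: even_nat_iff)
    qed
    have "deriv g z ^ nat (zorder s z) = 1"
      by (rule deriv_power_zorder_eq_1[OF s_hol _ s0 z(1) sz g(5) gd z(2) g' sg]) auto
    moreover have "(\<forall>x\<in>disc. r (g x) = r x) \<or> (\<forall>x\<in>disc. r (g x) = - r x)"
    proof (rule square_eq_imp_eq_or_minus[OF open_ball connected_ball holomorphic_compose_disc[OF g(5) gd r(1)] r(1)])
      show "(r (g x))\<^sup>2 = (r x)\<^sup>2" if "x \<in> disc" for x
        using r(2)[OF g(6)[OF that]] r(2)[OF that] Fg[OF that] by simp
    qed
    moreover have False if "\<forall>x\<in>disc. r (g x) = - r x" "deriv g z ^ nat (zorder s z) = 1"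
    proof -
      have "deriv (\<lambda>x. - r x) z = deriv r (g z) * deriv g z"
        by (rule deriv_chain_disc[OF g(5) gd r(1) z(1)]) (use that in auto)
      moreover have "deriv (\<lambda>x. - r x) z = - deriv r z"
        using holomorphic_derivI[OF r(1) open_ball z(1)] by (intro DERIV_imp_deriv DERIV_minus)
      ultimately have "deriv g z = -1" using r(4) z(2)
        by (metis mult_cancel_left mult_minus1_right)
      then show False using that(2) sord by simp
    qed
    ultimately have rg: "r (g x) = r x" if "x \<in> disc" for x using that by blast
    show ?thesis
      by (rule lift_unique[OF r(1) open_ball connected_ball g(5) gd holomorphic_on_ident _ rg z(1) z(2) _ w])
         (use z r(4) in auto)
  qed
qed

lemma over_inverse:
  assumes o: "over \<sigma> g h" and \<sigma>: "\<sigma> = 1 \<or> \<sigma> = -1"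
  obtains g' h' where "over \<sigma> g' h'" "\<And>x. x \<in> disc \<Longrightarrow> g' (g x) = x" "\<And>x. x \<in> disc \<Longrightarrow> h' (h x) = x"
proof -
  note g = overD[OF o]
  obtain g' where g': "g' \<in> disc_automorphisms" "\<And>x. x \<in> disc \<Longrightarrow> g' (g x) = x" "\<And>x. x \<in> disc \<Longrightarrow> g (g' x) = x"
    by (rule disc_automorphism_inverse[OF g(1)]) (rule that)
  obtain k where k: "k \<in> \<Gamma>T" "\<And>z. z \<in> disc \<Longrightarrow> k (h z) = z" "\<And>z. z \<in> disc \<Longrightarrow> h (k z) = z"
    by (rule T_inverse[OF g(2)]) (rule that)
  have "F (g' x) = k (F x) \<and> s (g' x) * deriv k (F x) ^ n = \<sigma> * s x" if x: "x \<in> disc" for x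
  proof
    have y: "g' x \<in> disc" using disc_automorphisms_in_disc[OF g'(1) x] .
    have hy: "h (F (g' x)) = F x" using g(3)[OF y] g'(3)[OF x] by simp
    show 1: "F (g' x) = k (F x)" using k(2)[OF F_in_disc[OF y]] hy by simp
    have "deriv (\<lambda>x. x) (F (g' x)) = deriv k (h (F (g' x))) * deriv h (F (g' x))"
      by (rule deriv_chain_disc[OF T_hol[OF g(2)] _ T_hol[OF k(1)] F_in_disc[OF y]])
         (use k(2) T_in_disc[OF g(2)] in \<open>auto simp del: mem_ball\<close>)
    then have d: "deriv k (F x) * deriv h (F (g' x)) = 1" by (simp add: hy)
    have "s x * deriv h (F (g' x)) ^ n = \<sigma> * s (g' x)" using g(4)[OF y] g'(3)[OF x] by simp
    then have "s x * (deriv k (F x) * deriv h (F (g' x))) ^ n = \<sigma> * s (g' x) * deriv k (F x) ^ n"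
      by (simp add: power_mult_distrib mult_ac)
    then have "\<sigma> * s x = \<sigma> * \<sigma> * s (g' x) * deriv k (F x) ^ n" by (simp add: d)
    then show "s (g' x) * deriv k (F x) ^ n = \<sigma> * s x" using \<sigma> by auto
  qed
  then have "over \<sigma> g' k" unfolding over_def using g'(1) k(1) by blast
  then show ?thesis by (rule that) (simp_all add: g'(2) k(2))
qed

text \<open>The half-turn about a branch point: the lift of the identity that carries
  \<open>H (1/2)\<close> to \<open>H (-1/2)\<close> satisfies \<open>g (H x) = H (- x)\<close>. With
  sign 1 it would be the identity, as it fixes \<open>z\<close>, and then \<open>H\<close> would be
  even although its derivative at 0 is nonzero.\<close>

lemma branch_swap:
  assumes z: "z \<in> disc" and b: "F z \<in> B"
  obtains g where "over (-1) g id" "g z = z"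
proof -
  obtain r H e where r: "r holomorphic_on disc" "\<And>x. x \<in> disc \<Longrightarrow> (r x)\<^sup>2 = F x - F z"
    "r z = 0" "deriv r z \<noteq> 0" and H: "H holomorphic_on disc" "H ` disc \<subseteq> disc" "H 0 = z"
    "deriv H 0 \<noteq> 0" "\<And>x. x \<in> disc \<Longrightarrow> F (H x) = F z + of_real e * x\<^sup>2"
    "e > 0" "ball (F z) e \<inter> B \<subseteq> {F z}"
    by (rule branch_point[OF assms]) (rule that)
  have half: "(1/2::complex) \<in> disc" "(-1/2::complex) \<in> disc" by auto
  have Hd: "H x \<in> disc" if "x \<in> disc" for x using H(2) that by blast
  have Feq: "F (H (-1/2)) = id (F (H (1/2)))"
    using H(5)[OF half(1)] H(5)[OF half(2)] by (simp add: power2_eq_square)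
  obtain g \<sigma> where g: "\<sigma> = 1 \<or> \<sigma> = -1" "over \<sigma> g id" "g (H (1/2)) = H (-1/2)"
    by (rule over_exists[OF surface_groupD(2)[OF surface] Hd[OF half(1)] Hd[OF half(2)] Feq])
  note D = overD[OF g(2)]
  have neg: "- x \<in> disc" if "x \<in> disc" for x :: complex using that by simp
  have nb: "F (H (-1/2)) \<notin> B"
  proof
    assume in_B: "F (H (-1/2)) \<in> B"
    have "F (H (-1/2)) \<in> ball (F z) e"
      using scaled_in_ball(2)[OF H(6) half(2), of "F z"] H(5)[OF half(2)] by simp
    then have "F (H (-1/2)) = F z" using H(7) in_B by blast
    then show False using H(5)[OF half(2)] H(6) by simp
  qed
  have eq: "g (H x) = H (- x)" if x: "x \<in> disc" for x
  proof (rule lift_unique[OF F_hol open_ball connected_ball _ _ _ _ _ half(1) _ _ x])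
    show "(\<lambda>x. g (H x)) holomorphic_on disc" using holomorphic_compose_disc[OF H(1,2) D(5)] .
    show "(\<lambda>x. g (H x)) ` disc \<subseteq> disc" using Hd D(6) by blast
    show "(\<lambda>x. H (- x)) holomorphic_on disc"
      by (rule holomorphic_compose_disc[OF _ _ H(1)]) (auto intro!: holomorphic_intros)
    show "(\<lambda>x. H (- x)) ` disc \<subseteq> disc" using Hd neg by blast
    show "F (g (H x)) = F (H (- x))" if "x \<in> disc" for x
      using D(3)[OF Hd[OF that]] H(5)[OF that] H(5)[OF neg[OF that]] by simp
    show "deriv F (g (H (1/2))) \<noteq> 0" using F_deriv_nz[OF Hd[OF half(2)] nb] g(3) by simp
  qed (use g(3) in simp)
  have gz: "g z = z" using eq[of 0] H(3) by simp
  have "\<sigma> \<noteq> 1"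
  proof
    assume "\<sigma> = 1"
    then have "g x = x" if "x \<in> disc" for x using over_torsion_free[of g id z x] g(2) gz z that by simp
    then have sym: "H x = H (- x)" if "x \<in> disc" for x using eq[OF that] Hd[OF that] by simp
    have "deriv H 0 = deriv H (- 0) * deriv (\<lambda>x. - x) 0"
    proof (rule deriv_chain_disc[of "\<lambda>x. - x", OF _ _ H(1) _ sym])
      show "uminus holomorphic_on disc" by (intro holomorphic_on_minus[of "\<lambda>x. x", simplified] holomorphic_on_ident)
    qed auto
    moreover have "deriv uminus (0::complex) = - 1"
      by (rule DERIV_imp_deriv) (auto intro!: derivative_eq_intros)
    ultimately show False using H(4) by simp
  qed
  then show ?thesis using that g gz by auto
qed

section \<open>The group of the double cover and its degree\<close>

definition \<Gamma>S where "\<Gamma>S = {g. \<exists>h. over 1 g h}"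

lemma over_SOME:
  assumes "g \<in> \<Gamma>S"
  shows "over 1 g (SOME h. over 1 g h)"
proof -
  have "\<exists>h. over 1 g h" using assms unfolding \<Gamma>S_def by blast
  then show ?thesis by (rule someI_ex)
qed

text \<open>Discontinuity and cocompactness are pulled back along \<open>F\<close>. For the first,
  an element is determined by the \<open>h\<close> below it and by its value at 0, and both range
  over finite sets. For the second, \<open>F\<close> maps some smaller closed ball onto a set
  containing a compact set that meets all orbits of \<open>\<Gamma>T\<close>.\<close>

lemma S_surface_group: "surface_group \<Gamma>S"
  unfolding surface_group_def
proof (intro conjI ballI allI impI)
  show "\<Gamma>S \<subseteq> disc_automorphisms" unfolding \<Gamma>S_def using overD(1) by blast
  show "id \<in> \<Gamma>S" unfolding \<Gamma>S_def using over_id by blast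
  show "\<exists>k\<in>\<Gamma>S. \<forall>z\<in>disc. h (g z) = k z" if gh: "g \<in> \<Gamma>S" "h \<in> \<Gamma>S" for g h
  proof -
    obtain g1 h1 where o: "over 1 g g1" "over 1 h h1" using gh unfolding \<Gamma>S_def by blast
    obtain k l where "over (1 * 1) k l" "\<And>x. x \<in> disc \<Longrightarrow> k x = h (g x)" "\<And>x. x \<in> disc \<Longrightarrow> l x = h1 (g1 x)"
      by (rule over_compose[OF o]) (rule that)
    then show ?thesis unfolding \<Gamma>S_def by (intro bexI[of _ k]) auto
  qed
  show "\<exists>h\<in>\<Gamma>S. \<forall>z\<in>disc. h (g z) = z" if gS: "g \<in> \<Gamma>S" for g
  proof -
    obtain h where o: "over 1 g h" using gS unfolding \<Gamma>S_def by blast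
    obtain g' h' where "over 1 g' h'" "\<And>x. x \<in> disc \<Longrightarrow> g' (g x) = x" "\<And>x. x \<in> disc \<Longrightarrow> h' (h x) = x"
      by (rule over_inverse[OF o]) (simp, rule that)
    then show ?thesis unfolding \<Gamma>S_def by blast
  qed
  show "g w = w" if "g \<in> \<Gamma>S" "z \<in> disc" "g z = z" "w \<in> disc" for g z w
    using that over_torsion_free unfolding \<Gamma>S_def by blast
next
  fix K :: "complex set" assume K: "compact K \<and> K \<subseteq> disc"
  define HT where "HT = {h\<in>\<Gamma>T. h ` (F ` K) \<inter> F ` K \<noteq> {}}"
  have "compact (F ` K)"
    using K by (intro compact_continuous_image holomorphic_on_imp_continuous_on holomorphic_on_subset[OF F_hol]) auto
  moreover have "F ` K \<subseteq> disc" using K F_in_disc by blast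
  ultimately have finT: "finite HT" unfolding HT_def using surface_groupD(6)[OF surface] by blast
  obtain \<rho> where \<rho>: "0 < \<rho>" "\<rho> < 1" "\<And>k. k \<in> K \<Longrightarrow> norm k \<le> \<rho>"
    by (rule compact_subset_disc_bounded[OF conjunct1[OF K] conjunct2[OF K]]) (rule that)
  \<comment> \<open>If \<open>k\<close> and \<open>g k\<close> lie in \<open>K\<close>, then the
    formula for \<open>1 - (norm (g k))\<^sup>2\<close> and
    \<open>norm (1 - cnj a * k) \<ge> 1 - \<rho>\<close> give
    \<open>c \<le> 1 - (norm a)\<^sup>2\<close>, while \<open>norm (g 0) = norm a\<close>. This
    confines \<open>g 0\<close> to a fixed ball.\<close>
  define c where "c = (1 - \<rho>\<^sup>2) * (1 - \<rho>)\<^sup>2"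
  have c: "c > 0" using \<rho> by (simp add: c_def power_less_one_iff)
  define R where "R = sqrt (1 - min c 1)"
  have R: "R < 1" "0 \<le> R" using c by (auto simp: R_def)
  have g0: "g 0 \<in> cball 0 R" if g: "g \<in> disc_automorphisms" "g ` K \<inter> K \<noteq> {}" for g
  proof -
    obtain u a where ua: "g = disc_moebius u a" "norm u = 1" "norm a < 1"
      using g(1) unfolding disc_automorphisms_def by blast
    obtain k where k: "k \<in> K" "g k \<in> K" using g(2) by blast
    have k1: "norm k < 1" using k K by auto
    have "1 - \<rho> \<le> norm (1 - cnj a * k)"
    proof -
      have "norm a * norm k \<le> 1 * \<rho>"
        using ua(3) \<rho>(3)[OF k(1)] by (intro mult_mono) auto
      moreover have "norm (1::complex) - norm (cnj a * k) \<le> norm (1 - cnj a * k)" by (rule norm_triangle_ineq2)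
      ultimately show ?thesis by (simp add: norm_mult)
    qed
    then have 1: "(1 - \<rho>)\<^sup>2 \<le> (norm (1 - cnj a * k))\<^sup>2" using \<rho> by (intro power_mono) auto
    have nzk: "norm (1 - cnj a * k) > 0" using one_minus_mult_nz[OF ua(3) k1] by simp
    have 2: "1 - \<rho>\<^sup>2 \<le> 1 - (norm (g k))\<^sup>2" using \<rho>(3)[OF k(2)] by (simp add: power_mono)
    have 3: "1 - (norm (g k))\<^sup>2 = (1 - (norm a)\<^sup>2) * (1 - (norm k)\<^sup>2) / (norm (1 - cnj a * k))\<^sup>2"
      unfolding ua(1) by (rule one_minus_norm_disc_moebius[OF ua(2,3) k1])
    have "c \<le> (1 - (norm (g k))\<^sup>2) * (norm (1 - cnj a * k))\<^sup>2"
      unfolding c_def using 1 2 \<rho> by (intro mult_mono) (auto simp: power_le_one)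
    also have "\<dots> = (1 - (norm a)\<^sup>2) * (1 - (norm k)\<^sup>2)" unfolding 3 using nzk by simp
    also have "\<dots> \<le> (1 - (norm a)\<^sup>2) * 1"
      using ua(3) by (intro mult_left_mono) (auto simp: power_le_one)
    finally have "c \<le> 1 - (norm a)\<^sup>2" by simp
    moreover have "norm (g 0) = norm a" using ua by (simp add: disc_moebius_def norm_mult)
    moreover have "min c 1 \<le> c" by simp
    ultimately have "(norm (g 0))\<^sup>2 \<le> 1 - min c 1" by simp
    then have "norm (g 0) \<le> R" unfolding R_def by (rule real_le_rsqrt)
    then show ?thesis by simp
  qed
  define Y where "Y = (\<Union>h\<in>HT. {x\<in>cball 0 R. F x - h 0 = 0})"
  have "finite {x\<in>cball 0 R. F x - y = 0}" for y
  proof (rule holomorphic_compact_finite_zeros[of _ disc])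
    show "(\<lambda>x. F x - y) holomorphic_on disc" by (intro holomorphic_intros F_hol)
    show "\<not> (\<lambda>x. F x - y) constant_on disc"
    proof
      assume "(\<lambda>x. F x - y) constant_on disc"
      then obtain c where "\<forall>x\<in>disc. F x - y = c" unfolding constant_on_def by blast
      then have "\<forall>x\<in>disc. F x = c + y" by (metis diff_add_cancel)
      then show False using F_not_constant unfolding constant_on_def by blast
    qed
  qed (use R in auto)
  then have finY: "finite Y" unfolding Y_def using finT by blast
  \<comment> \<open>The second component is one of the finitely many points over \<open>h 0\<close>
    in the ball of radius \<open>R\<close>.\<close>
  define \<phi> where "\<phi> = (\<lambda>g. (SOME h. over 1 g h, g 0))"
  have sub: "\<phi> ` {g\<in>\<Gamma>S. g ` K \<inter> K \<noteq> {}} \<subseteq> HT \<times> Y"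
  proof
    fix p assume "p \<in> \<phi> ` {g\<in>\<Gamma>S. g ` K \<inter> K \<noteq> {}}"
    then obtain g where g: "p = \<phi> g" "g \<in> \<Gamma>S" "g ` K \<inter> K \<noteq> {}" by blast
    define h where "h = (SOME h. over 1 g h)"
    have o: "over 1 g h" unfolding h_def by (rule over_SOME[OF g(2)])
    obtain k where k: "k \<in> K" "g k \<in> K" using g(3) by blast
    have "h (F k) = F (g k)" using overD(3)[OF o] k K by auto
    then have hT: "h \<in> HT" unfolding HT_def using overD(2)[OF o] k by blast
    have "F (g 0) = h 0" using overD(3)[OF o, of 0] F0 by simp
    then have "g 0 \<in> Y" unfolding Y_def using hT g0[OF overD(1)[OF o] g(3)] by auto
    then show "p \<in> HT \<times> Y" using g(1) hT by (simp add: \<phi>_def h_def)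
  qed
  have "inj_on \<phi> {g\<in>\<Gamma>S. g ` K \<inter> K \<noteq> {}}"
  proof (rule inj_onI)
    fix g g' assume gg: "g \<in> {g\<in>\<Gamma>S. g ` K \<inter> K \<noteq> {}}" "g' \<in> {g\<in>\<Gamma>S. g ` K \<inter> K \<noteq> {}}" "\<phi> g = \<phi> g'"
    define h where "h = (SOME h. over 1 g h)"
    have o: "over 1 g h" unfolding h_def using gg(1) over_SOME by blast
    have "h = (SOME h. over 1 g' h)" using gg(3) by (simp add: \<phi>_def h_def)
    then have o': "over 1 g' h" using gg(2) over_SOME by simp
    note D = overD[OF o] and D' = overD[OF o']
    have eq0: "g 0 = g' 0" using gg(3) by (simp add: \<phi>_def)
    \<comment> \<open>The base point 0 does not lie over \<open>B\<close>, so the value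
      \<open>g 0\<close> singles out the lift.\<close>
    have "F (g 0) \<notin> B" using D(3)[of 0] F0 B_invariant[OF D(2), of 0] zero_notin_B by simp
    then have nz: "deriv F (g 0) \<noteq> 0" using F_deriv_nz D(6)[of 0] by simp
    have "g x = g' x" if "x \<in> disc" for x
    proof (rule lift_unique[OF F_hol open_ball connected_ball D(5) _ D'(5) _ _ _ eq0 nz that])
      show "g ` disc \<subseteq> disc" "g' ` disc \<subseteq> disc" using D(6) D'(6) by blast+
      show "F (g z) = F (g' z)" if "z \<in> disc" for z using D(3)[OF that] D'(3)[OF that] by simp
    qed simp
    then show "g = g'" using disc_automorphism_eqI[OF D(1) D'(1)] by blast
  qed
  then show "finite {g\<in>\<Gamma>S. g ` K \<inter> K \<noteq> {}}"
    using finite_subset[OF sub] finT finY finite_imageD by blast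
next
  obtain KT where KT: "compact KT" "KT \<subseteq> disc" "\<And>z. z \<in> disc \<Longrightarrow> \<exists>g\<in>\<Gamma>T. g z \<in> KT"
    using surface_groupD(7)[OF surface] by blast
  define C where "C = {r::real. 0 < r \<and> r < 1}"
  have "KT \<subseteq> (\<Union>r\<in>C. F ` ball 0 r)"
  proof
    fix p assume "p \<in> KT"
    then have pd: "p \<in> disc" using KT(2) by blast
    obtain z where z: "z \<in> disc" "F z = p" by (rule F_surj[OF pd])
    have "(norm z + 1) / 2 \<in> C" "z \<in> ball 0 ((norm z + 1) / 2)" using z(1) by (auto simp: C_def add_nonneg_pos)
    then show "p \<in> (\<Union>r\<in>C. F ` ball 0 r)" using z(2) by blast
  qed
  moreover have "open (F ` ball 0 r)" if "r \<in> C" for r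
    using that by (intro open_mapping_thm[OF F_hol open_ball connected_ball open_ball _ F_not_constant]) (auto simp: C_def)
  ultimately obtain C' where C': "C' \<subseteq> C" "finite C'" "KT \<subseteq> (\<Union>r\<in>C'. F ` ball 0 r)"
    using compactE_image[OF KT(1), of C "\<lambda>r. F ` ball 0 r"] by blast
  define R where "R = Max (insert (1/2) C')"
  have R: "R < 1" "\<And>r. r \<in> C' \<Longrightarrow> r \<le> R"
    unfolding R_def using C' by (auto simp: C_def)
  have cov: "\<exists>w\<in>cball 0 R. F w = p" if p: "p \<in> KT" for p
  proof -
    obtain r w where "r \<in> C'" "w \<in> ball 0 r" "F w = p" using C'(3) p by blast
    then show ?thesis using R(2)[of r] by (intro bexI[of _ w]) auto
  qed
  have sub: "cball 0 R \<subseteq> disc" using R by auto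
  obtain b where b: "b \<in> B" using B_ne by blast
  obtain zb where zb: "zb \<in> disc" "F zb = b" by (rule F_surj[OF conjunct1[OF m_B[OF b]]])
  have "F zb \<in> B" using zb b by simp
  then obtain g0 where g0: "over (-1) g0 id" "g0 zb = zb" by (rule branch_swap[OF zb(1)])
  note D0 = overD[OF g0(1)]
  \<comment> \<open>The lift that carries a point into the ball may have sign -1. Following it by
    \<open>g0\<close>, of sign -1 as well, corrects the sign and lands in the second piece.\<close>
  define K where "K = cball 0 R \<union> g0 ` cball 0 R"
  have "compact K" unfolding K_def
    by (intro compact_Un compact_cball compact_continuous_image
        holomorphic_on_imp_continuous_on[OF holomorphic_on_subset[OF D0(5) sub]])
  moreover have "K \<subseteq> disc" unfolding K_def using sub D0(6) by blast
  moreover have "\<exists>g\<in>\<Gamma>S. g z \<in> K" if z: "z \<in> disc" for z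
  proof -
    obtain h where h: "h \<in> \<Gamma>T" "h (F z) \<in> KT" using KT(3)[OF F_in_disc[OF z]] by blast
    obtain w where w: "w \<in> cball 0 R" "F w = h (F z)" using cov[OF h(2)] by blast
    have wd: "w \<in> disc" using w sub by blast
    obtain g \<sigma> where g: "\<sigma> = 1 \<or> \<sigma> = -1" "over \<sigma> g h" "g z = w"
      by (rule over_exists[OF h(1) z wd w(2)])
    show ?thesis
    proof (cases "\<sigma> = 1")
      case True
      then show ?thesis using g w unfolding \<Gamma>S_def K_def by blast
    next
      case False
      then have o: "over (-1) g h" using g by simp
      obtain k l where kl: "over (-1 * -1) k l" "\<And>x. x \<in> disc \<Longrightarrow> k x = g0 (g x)" "\<And>x. x \<in> disc \<Longrightarrow> l x = id (h x)"
        by (rule over_compose[OF o g0(1)]) (rule that)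
      then have "k z = g0 w" using z g(3) by simp
      then show ?thesis using kl(1) w(1) unfolding \<Gamma>S_def K_def by (intro bexI[of _ k]) auto
    qed
  qed
  ultimately show "\<exists>K. compact K \<and> K \<subseteq> disc \<and> (\<forall>z\<in>disc. \<exists>g\<in>\<Gamma>S. g z \<in> K)" by blast
qed

text \<open>The multiplicity at a point depends only on whether its image lies in \<open>B\<close>,
  and this is constant along the orbit, so the choice of representative is harmless.\<close>

lemma local_mult_S_orbit:
  assumes z: "z \<in> disc" and h: "h \<in> \<Gamma>T" and w: "w \<in> disc" "F z = h w"
  shows "local_mult F (SOME x. x \<in> orbit \<Gamma>S z) = (if w \<in> B then 2 else 1)"
proof -
  have "z \<in> orbit \<Gamma>S z"
    unfolding orbit_def using surface_groupD(2)[OF S_surface_group] by (intro CollectI exI[of _ id]) auto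
  then have "(SOME x. x \<in> orbit \<Gamma>S z) \<in> orbit \<Gamma>S z" by (rule someI)
  then obtain g where g: "g \<in> \<Gamma>S" "(SOME x. x \<in> orbit \<Gamma>S z) = g z" unfolding orbit_def by blast
  obtain k where o: "over 1 g k" using g(1) unfolding \<Gamma>S_def by blast
  have gz: "g z \<in> disc" using overD(6)[OF o z] .
  have "F (g z) = k (h w)" using overD(3)[OF o z] w(2) by simp
  then have "F (g z) \<in> B \<longleftrightarrow> w \<in> B"
    using B_invariant[OF overD(2)[OF o] T_in_disc[OF h w(1)]] B_invariant[OF h w(1)] by simp
  then show ?thesis
    unfolding g(2) local_mult_def using local_mult_unbranched[OF gz] local_mult_branched[OF gz] by auto
qed

text \<open>All lifts together act transitively on the points over an orbit, and those of sign 1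
  form a subgroup of index two. Over \<open>B\<close> the half-turn about \<open>z\<close> fixes
  \<open>z\<close> and has sign -1, so one orbit of multiplicity 2 remains. Elsewhere any element
  \<open>g0\<close> of sign -1 produces a second orbit, that of \<open>g0 z\<close>.\<close>

lemma S_branched_double_cover: "branched_double_cover \<Gamma>S \<Gamma>T F"
proof -
  have eqv: "equivariant_lift \<Gamma>S \<Gamma>T F"
    unfolding equivariant_lift_def
  proof (intro conjI ballI F_hol F_disc)
    fix g assume "g \<in> \<Gamma>S"
    then obtain h where o: "over 1 g h" unfolding \<Gamma>S_def by blast
    show "\<exists>h\<in>\<Gamma>T. \<forall>z\<in>disc. F (g z) = h (F z)" using overD(2,3)[OF o] by blast
  qed
  have in_orbitI: "orbit \<Gamma>S z' = orbit \<Gamma>S z" if "over 1 g h" "z \<in> disc" "g z = z'" for g h z z'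
    using orbit_eq[OF S_surface_group that(2), of g] that unfolding \<Gamma>S_def by blast
  have main: "finite P \<and> (\<Sum>Q\<in>P. local_mult F (SOME z. z \<in> Q)) = 2"
    if w: "w \<in> disc" and P: "P = {orbit \<Gamma>S z | z. z \<in> disc \<and> F z \<in> orbit \<Gamma>T w}" for w P
  proof -
    obtain z where z: "z \<in> disc" "F z = w" by (rule F_surj[OF w])
    have ow: "w \<in> orbit \<Gamma>T w"
      unfolding orbit_def using surface_groupD(2)[OF surface] by (intro CollectI exI[of _ id]) auto
    have idT: "id \<in> \<Gamma>T" using surface_groupD(2)[OF surface] .
    have zP: "orbit \<Gamma>S z \<in> P" unfolding P using z ow by blast
    have mz: "local_mult F (SOME x. x \<in> orbit \<Gamma>S z) = (if w \<in> B then 2 else 1)"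
      by (rule local_mult_S_orbit[OF z(1) idT w]) (simp add: z(2))
    show ?thesis
    proof (cases "w \<in> B")
      case True
      have wB: "F z \<in> B" using True z by simp
      obtain g0 where g0: "over (-1) g0 id" "g0 z = z" by (rule branch_swap[OF z(1) wB])
      have "P \<subseteq> {orbit \<Gamma>S z}"
      proof
        fix Q assume "Q \<in> P"
        then obtain z' where z': "Q = orbit \<Gamma>S z'" "z' \<in> disc" "F z' \<in> orbit \<Gamma>T w" unfolding P by blast
        obtain h where h: "h \<in> \<Gamma>T" "F z' = h w" using z'(3) unfolding orbit_def by blast
        have Fz': "F z' = h (F z)" using h(2) z(2) by simp
        obtain g \<sigma> where g: "\<sigma> = 1 \<or> \<sigma> = -1" "over \<sigma> g h" "g z = z'"
          by (rule over_exists[OF h(1) z(1) z'(2) Fz'])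
        show "Q \<in> {orbit \<Gamma>S z}"
        proof (cases "\<sigma> = 1")
          case True
          then show ?thesis using in_orbitI[of g h z z'] g z z'(1) by simp
        next
          case False
          then have o: "over (-1) g h" using g by simp
          obtain k l where kl: "over (-1 * -1) k l" "\<And>x. x \<in> disc \<Longrightarrow> k x = g (g0 x)" "\<And>x. x \<in> disc \<Longrightarrow> l x = h (id x)"
            by (rule over_compose[OF g0(1) o]) (rule that)
          then show ?thesis using in_orbitI[of k l z z'] g(3) g0(2) z(1) z'(1) by simp
        qed
      qed
      then have "P = {orbit \<Gamma>S z}" using zP by blast
      then show ?thesis using mz True by simp
    next
      case False
      obtain b where b: "b \<in> B" using B_ne by blast
      obtain zb where zb: "zb \<in> disc" "F zb = b" by (rule F_surj[OF conjunct1[OF m_B[OF b]]])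
      have "F zb \<in> B" using zb b by simp
      then obtain g0 where g0: "over (-1) g0 id" "g0 zb = zb" by (rule branch_swap[OF zb(1)])
      note D0 = overD[OF g0(1)]
      define y where "y = g0 z"
      have y: "y \<in> disc" "F y = w" using D0(6)[OF z(1)] D0(3)[OF z(1)] z(2) by (auto simp: y_def)
      have yP: "orbit \<Gamma>S y \<in> P" unfolding P using y ow by blast
      have my: "local_mult F (SOME x. x \<in> orbit \<Gamma>S y) = 1"
        using local_mult_S_orbit[OF y(1) idT w] y(2) False by simp
      have "P \<subseteq> {orbit \<Gamma>S z, orbit \<Gamma>S y}"
      proof
        fix Q assume "Q \<in> P"
        then obtain z' where z': "Q = orbit \<Gamma>S z'" "z' \<in> disc" "F z' \<in> orbit \<Gamma>T w" unfolding P by blast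
        obtain h where h: "h \<in> \<Gamma>T" "F z' = h w" using z'(3) unfolding orbit_def by blast
        have Fz': "F z' = h (F z)" using h(2) z(2) by simp
        obtain g \<sigma> where g: "\<sigma> = 1 \<or> \<sigma> = -1" "over \<sigma> g h" "g z = z'"
          by (rule over_exists[OF h(1) z(1) z'(2) Fz'])
        show "Q \<in> {orbit \<Gamma>S z, orbit \<Gamma>S y}"
        proof (cases "\<sigma> = 1")
          case True
          then show ?thesis using in_orbitI[of g h z z'] g z z'(1) by simp
        next
          case False
          then have o: "over (-1) g h" using g by simp
          obtain g1 h1 where g1: "over (-1) g1 h1" "\<And>x. x \<in> disc \<Longrightarrow> g1 (g0 x) = x" "\<And>x. x \<in> disc \<Longrightarrow> h1 (id x) = x"
            by (rule over_inverse[OF g0(1)]) (simp, rule that)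
          obtain k l where kl: "over (-1 * -1) k l" "\<And>x. x \<in> disc \<Longrightarrow> k x = g (g1 x)" "\<And>x. x \<in> disc \<Longrightarrow> l x = h (h1 x)"
            by (rule over_compose[OF g1(1) o]) (rule that)
          have "k y = z'" using kl(2)[OF y(1)] g1(2)[OF z(1)] g(3) by (simp add: y_def)
          then show ?thesis using in_orbitI[of k l y z'] kl(1) y(1) z'(1) by simp
        qed
      qed
      then have Peq: "P = {orbit \<Gamma>S z, orbit \<Gamma>S y}" using zP yP by blast
      \<comment> \<open>An element of sign 1 carrying \<open>z\<close> to \<open>g0 z\<close> would
        equal \<open>g0\<close> on the disc by unique lifting; the signs contradict each other at 0,
        where \<open>s\<close> does not vanish.\<close>
      have "orbit \<Gamma>S z \<noteq> orbit \<Gamma>S y"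
      proof
        assume "orbit \<Gamma>S z = orbit \<Gamma>S y"
        moreover have "y \<in> orbit \<Gamma>S y"
          unfolding orbit_def using surface_groupD(2)[OF S_surface_group] by (intro CollectI exI[of _ id]) auto
        ultimately obtain g where g: "g \<in> \<Gamma>S" "y = g z" unfolding orbit_def by blast
        obtain h where o: "over 1 g h" using g(1) unfolding \<Gamma>S_def by blast
        note D = overD[OF o]
        have "h w = w" using D(3)[OF z(1)] g(2) y(2) z(2) by simp
        then have hid: "h x = x" if "x \<in> disc" for x using T_fixed_point[OF D(2) w _ that] by blast
        have gg: "g x = g0 x" if "x \<in> disc" for x
        proof (rule lift_unique[OF F_hol open_ball connected_ball D(5) _ D0(5) _ _ z(1) _ _ that])
          show "g ` disc \<subseteq> disc" "g0 ` disc \<subseteq> disc" using D(6) D0(6) by blast+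
          show "F (g x) = F (g0 x)" if "x \<in> disc" for x
            using D(3)[OF that] D0(3)[OF that] hid[OF F_in_disc[OF that]] by simp
          show "g z = g0 z" using g(2) by (simp add: y_def)
          show "deriv F (g z) \<noteq> 0" using F_deriv_nz[OF y(1)] y(2) False g(2) by simp
        qed
        have zd: "(0::complex) \<in> disc" by simp
        have "s (g 0) = s 0"
          using D(4)[OF zd] deriv_identity_on_disc[OF hid F_in_disc[OF zd]] by simp
        moreover have "s (g0 0) = - s 0"
          using D0(4)[OF zd] deriv_identity_on_disc[of id "F 0"] F_in_disc[OF zd] by simp
        ultimately show False using gg[OF zd] s0 by simp
      qed
      then show ?thesis unfolding Peq using mz my False by simp
    qed
  qed
  then show ?thesis
    unfolding branched_double_cover_def Let_def using eqv by blast
qed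

lemma F_deriv_eq_0:
  assumes z: "z \<in> disc" and b: "F z \<in> B"
  shows "deriv F z = 0"
proof -
  obtain r where r: "r holomorphic_on disc" "\<And>x. x \<in> disc \<Longrightarrow> (r x)\<^sup>2 = F x - F z"
    using orbifold_mapD(3)[OF F_orb b] by blast
  have r0: "r z = 0" using r(2)[OF z] by simp
  have "((\<lambda>x. (r x)\<^sup>2 + F z) has_field_derivative 0) (at z)"
    using holomorphic_derivI[OF r(1) open_ball z] r0 by (auto intro!: derivative_eq_intros)
  then have "(F has_field_derivative 0) (at z)"
    by (rule has_field_derivative_transform_within_open[OF _ open_ball z]) (simp add: r(2))
  then show ?thesis by (rule DERIV_imp_deriv)
qed

text \<open>Automorphisms preserve the metric, so \<open>z\<close> may be moved to 0 and
  \<open>F z\<close> into the ball of radius \<open>\<rho>\<close>. For the resulting map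
  \<open>G\<close> the ratio is \<open>norm (deriv G 0)\<close> squared over a denominator of at
  least \<open>(1 - \<rho>\<^sup>2)\<^sup>2\<close>. A numerator above \<open>64 * \<delta>\<close>
  would make \<open>G\<close> take a value in \<open>B\<close> at a noncritical point.\<close>

lemma metric_ratio_le:
  assumes \<rho>: "0 < \<rho>" "\<rho> < 1" "\<And>z. z \<in> disc \<Longrightarrow> \<exists>h\<in>\<Gamma>T. h z \<in> cball 0 \<rho>"
    and dense: "\<And>x. x \<in> cball 0 \<rho> \<Longrightarrow> \<exists>b\<in>B. dist x b < \<delta>" and z: "z \<in> disc"
  shows "metric_ratio F z \<le> 64 * \<delta> / (1 - \<rho>\<^sup>2)\<^sup>2"
proof -
  obtain h where h: "h \<in> \<Gamma>T" "h (F z) \<in> cball 0 \<rho>" using \<rho>(3)[OF F_in_disc[OF z]] by blast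
  define M where "M = disc_moebius 1 (- z)"
  have Ma: "M \<in> disc_automorphisms"
    unfolding M_def disc_automorphisms_def using z by (intro CollectI exI[of _ 1] exI[of _ "- z"]) auto
  have M0: "M 0 = z" by (simp add: M_def disc_moebius_def)
  have Md: "M ` disc \<subseteq> disc" using disc_automorphisms_in_disc[OF Ma] by blast
  note Mh = disc_automorphisms_holomorphic[OF Ma]
  have zd: "(0::complex) \<in> disc" by simp
  define N where "N = (\<lambda>x. F (M x))"
  have N: "N holomorphic_on disc" "N ` disc \<subseteq> disc"
    unfolding N_def using holomorphic_compose_disc[OF Mh Md F_hol] Md F_disc by blast+
  define G where "G = (\<lambda>x. h (N x))"
  have G: "G holomorphic_on disc" "G ` disc \<subseteq> disc"
    unfolding G_def using holomorphic_compose_disc[OF N T_hol[OF h(1)]] N(2) T_in_disc[OF h(1)] by blast+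
  have dN: "deriv N x = deriv F (M x) * deriv M x" if "x \<in> disc" for x
    using deriv_chain_disc[OF Mh Md F_hol that] by (simp add: N_def)
  have dG: "deriv G x = deriv h (N x) * deriv N x" if "x \<in> disc" for x
    using deriv_chain_disc[OF N T_hol[OF h(1)] that] by (simp add: G_def)
  have small: "(norm (deriv G 0))\<^sup>2 \<le> 64 * \<delta>"
  proof (rule ccontr)
    assume "\<not> ?thesis"
    then have big: "\<delta> < (norm (deriv G 0))\<^sup>2 / 64" by simp
    have G0: "G 0 \<in> cball 0 \<rho>" using h(2) by (simp add: G_def N_def M0)
    obtain b where b: "b \<in> B" "dist (G 0) b < \<delta>" using dense[OF G0] by blast
    then have "b \<in> ball (G 0) ((norm (deriv G 0))\<^sup>2 / 64)" using big by simp
    then obtain x where x: "x \<in> disc" "deriv G x \<noteq> 0" "b = G x"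
      using ball_subset_regular_values[OF G] by blast
    have Nx: "N x \<in> disc" using N(2) x(1) by blast
    have "F (M x) \<in> B" using B_invariant[OF h(1) Nx] b(1) x(3) by (simp add: G_def N_def)
    then have "deriv F (M x) = 0" using F_deriv_eq_0 Md x(1) by blast
    then show False using x(2) dG[OF x(1)] dN[OF x(1)] by simp
  qed
  have z1: "0 < 1 - (norm z)\<^sup>2" using z by (simp add: abs_square_less_1)
  have F1: "0 < 1 - (norm (F z))\<^sup>2" using F_in_disc[OF z] by (simp add: abs_square_less_1)
  have h1: "1 - \<rho>\<^sup>2 \<le> 1 - (norm (h (F z)))\<^sup>2" using h(2) by (simp add: power_mono)
  have \<rho>1: "0 < 1 - \<rho>\<^sup>2" using \<rho> by (simp add: abs_square_less_1)
  have "norm (deriv M 0) = 1 - (norm z)\<^sup>2"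
    using norm_deriv_disc_automorphism[OF Ma zd] M0 by simp
  moreover have "norm (deriv h (F z)) = (1 - (norm (h (F z)))\<^sup>2) / (1 - (norm (F z))\<^sup>2)"
    using norm_deriv_disc_automorphism[OF T_aut[OF h(1)] F_in_disc[OF z]] F1 by (simp add: field_simps)
  ultimately have "norm (deriv G 0) = (1 - (norm (h (F z)))\<^sup>2) / (1 - (norm (F z))\<^sup>2) * (norm (deriv F z) * (1 - (norm z)\<^sup>2))"
    using dG[OF zd] dN[OF zd] by (simp add: N_def M0 norm_mult)
  then have "norm (deriv F z) * (1 - (norm z)\<^sup>2) / (1 - (norm (F z))\<^sup>2) = norm (deriv G 0) / (1 - (norm (h (F z)))\<^sup>2)"
    using h1 \<rho>1 by simp
  then have "metric_ratio F z = (norm (deriv G 0) / (1 - (norm (h (F z)))\<^sup>2))\<^sup>2"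
    unfolding metric_ratio_def by (metis power_divide power_mult_distrib)
  also have "\<dots> = (norm (deriv G 0))\<^sup>2 / (1 - (norm (h (F z)))\<^sup>2)\<^sup>2" by (simp add: power_divide)
  also have "\<dots> \<le> 64 * \<delta> / (1 - \<rho>\<^sup>2)\<^sup>2"
  proof (rule frac_le)
    show "0 \<le> 64 * \<delta>" using small zero_le_power2[of "norm (deriv G 0)"] by linarith
  qed (use small h1 \<rho>1 in \<open>auto intro!: power_mono\<close>)
  finally show ?thesis .
qed

end

section \<open>An arithmetic surface group\<close>

text \<open>The automorphy factor of the matrix with rows \<open>a, b\<close> and
  \<open>cnj b, cnj a\<close>, which lies in SU(1,1) when its determinant is 1.\<close>

definition su_jac :: "complex \<Rightarrow> complex \<Rightarrow> complex \<Rightarrow> complex" where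
  "su_jac a b z = cnj b * z + cnj a"

definition su_act :: "complex \<Rightarrow> complex \<Rightarrow> complex \<Rightarrow> complex" where
  "su_act a b z = (a * z + b) / su_jac a b z"

lemma su_norm:
  assumes "a * cnj a - b * cnj b = 1"
  shows "(norm a)\<^sup>2 - (norm b)\<^sup>2 = 1" "norm b < norm a" "norm a \<ge> 1" "a \<noteq> 0"
proof -
  have "complex_of_real ((norm a)\<^sup>2 - (norm b)\<^sup>2) = 1"
    using assms unfolding of_real_diff complex_norm_square .
  then show 1: "(norm a)\<^sup>2 - (norm b)\<^sup>2 = 1" by (metis of_real_eq_1_iff)
  then have "(norm b)\<^sup>2 < (norm a)\<^sup>2" by linarith
  then show "norm b < norm a" by (rule power_less_imp_less_base) simp
  have "1\<^sup>2 \<le> (norm a)\<^sup>2" using 1 by (smt (verit) one_power2 zero_le_power2)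
  then show "norm a \<ge> 1" by (rule power2_le_imp_le) auto
  then show "a \<noteq> 0" by auto
qed

text \<open>Holds because \<open>norm b < norm a\<close>. The bound serves both the discontinuity of
  the arithmetic group and the convergence of the Poincare series.\<close>

lemma norm_su_jac_ge:
  assumes "a * cnj a - b * cnj b = 1"
  shows "norm (su_jac a b z) \<ge> norm a * (1 - norm z)"
proof -
  have "norm (cnj b * z) \<le> norm a * norm z"
    using su_norm(2)[OF assms] by (simp add: norm_mult mult_right_mono)
  moreover have "norm (cnj a) \<le> norm (su_jac a b z) + norm (cnj b * z)"
    unfolding su_jac_def by (metis add_diff_cancel_left' norm_triangle_ineq4 norm_minus_commute
        add.commute norm_triangle_sub diff_add_cancel)
  ultimately show ?thesis by (simp add: algebra_simps)
qed

lemma su_jac_nz: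
  assumes "a * cnj a - b * cnj b = 1" "z \<in> disc"
  shows "su_jac a b z \<noteq> 0"
proof -
  have "norm a * (1 - norm z) > 0" using su_norm(3)[OF assms(1)] assms(2) by (intro mult_pos_pos) auto
  then show ?thesis using norm_su_jac_ge[OF assms(1), of z] by auto
qed

lemma su_act_automorphism:
  assumes "a * cnj a - b * cnj b = 1"
  shows "su_act a b \<in> disc_automorphisms"
proof -
  note n = su_norm[OF assms]
  have "su_act a b = disc_moebius (a / cnj a) (- b / a)"
  proof
    fix z
    have 1: "a / cnj a * (z - - b / a) = (a * z + b) / cnj a"
      using n(4) by (simp add: field_simps)
    have 2: "1 - cnj (- b / a) * z = su_jac a b z / cnj a"
      using n(4) by (simp add: su_jac_def field_simps)
    show "su_act a b z = disc_moebius (a / cnj a) (- b / a) z"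
      unfolding disc_moebius_def su_act_def 1 2 using n(4) by simp
  qed
  moreover have "norm (a / cnj a) = 1" "norm (- b / a) < 1"
    using n(2,4) by (auto simp: norm_divide)
  ultimately show ?thesis unfolding disc_automorphisms_def by blast
qed

lemma one_minus_norm_su_act:
  assumes "a * cnj a - b * cnj b = 1" "z \<in> disc"
  shows "1 - (norm (su_act a b z))\<^sup>2 = (1 - (norm z)\<^sup>2) / (norm (su_jac a b z))\<^sup>2"
proof -
  have "su_jac a b z * cnj (su_jac a b z) - (a * z + b) * cnj (a * z + b)
      = (a * cnj a - b * cnj b) * (1 - z * cnj z)"
    unfolding su_jac_def by (simp add: algebra_simps)
  then have "complex_of_real ((norm (su_jac a b z))\<^sup>2 - (norm (a * z + b))\<^sup>2) = complex_of_real (1 - (norm z)\<^sup>2)"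
    unfolding of_real_diff complex_norm_square using assms(1) by simp
  then have "(norm (su_jac a b z))\<^sup>2 - (norm (a * z + b))\<^sup>2 = 1 - (norm z)\<^sup>2" by (simp only: of_real_eq_iff)
  moreover have "1 - (norm (su_act a b z))\<^sup>2 = ((norm (su_jac a b z))\<^sup>2 - (norm (a * z + b))\<^sup>2) / (norm (su_jac a b z))\<^sup>2"
    using su_jac_nz[OF assms] by (simp add: su_act_def norm_divide power_divide diff_divide_distrib)
  ultimately show ?thesis by simp
qed

lemma su_act_compose:
  assumes "a * cnj a - b * cnj b = 1" "c * cnj c - d * cnj d = 1" "z \<in> disc"
  shows "su_jac (a * c + b * cnj d) (a * d + b * cnj c) z = su_jac a b (su_act c d z) * su_jac c d z"
    "su_act a b (su_act c d z) = su_act (a * c + b * cnj d) (a * d + b * cnj c) z"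
proof -
  have j: "su_jac c d z \<noteq> 0" using su_jac_nz[OF assms(2,3)] .
  have w: "su_act c d z * su_jac c d z = c * z + d" using j by (simp add: su_act_def)
  have "su_jac a b (su_act c d z) * su_jac c d z = cnj b * (su_act c d z * su_jac c d z) + cnj a * su_jac c d z"
    by (simp add: su_jac_def[of a b] algebra_simps)
  also have "\<dots> = su_jac (a * c + b * cnj d) (a * d + b * cnj c) z"
    unfolding w by (simp add: su_jac_def algebra_simps)
  finally show 1: "su_jac (a * c + b * cnj d) (a * d + b * cnj c) z = su_jac a b (su_act c d z) * su_jac c d z" ..
  have "(a * su_act c d z + b) * su_jac c d z = a * (su_act c d z * su_jac c d z) + b * su_jac c d z"
    by (simp add: algebra_simps)
  also have "\<dots> = (a * c + b * cnj d) * z + (a * d + b * cnj c)"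
    unfolding w by (simp add: su_jac_def algebra_simps)
  finally have 2: "(a * su_act c d z + b) * su_jac c d z = (a * c + b * cnj d) * z + (a * d + b * cnj c)" .
  have "su_act a b (su_act c d z) = (a * su_act c d z + b) * su_jac c d z / (su_jac a b (su_act c d z) * su_jac c d z)"
    using j by (simp add: su_act_def[of a b])
  then show "su_act a b (su_act c d z) = su_act (a * c + b * cnj d) (a * d + b * cnj c) z"
    unfolding 2 1[symmetric] by (simp add: su_act_def)
qed

lemma deriv_su_act:
  assumes "a * cnj a - b * cnj b = 1" "z \<in> disc"
  shows "deriv (su_act a b) z = 1 / (su_jac a b z)\<^sup>2"
proof -
  have j: "cnj b * z + cnj a \<noteq> 0" using su_jac_nz[OF assms] by (simp add: su_jac_def)
  have "((\<lambda>z. (a * z + b) / (cnj b * z + cnj a)) has_field_derivative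
      (a * (cnj b * z + cnj a) - (a * z + b) * cnj b) / ((cnj b * z + cnj a) * (cnj b * z + cnj a))) (at z)"
    by (rule DERIV_divide) (use j in \<open>auto intro!: derivative_eq_intros\<close>)
  moreover have "a * (cnj b * z + cnj a) - (a * z + b) * cnj b = a * cnj a - b * cnj b"
    by (simp add: algebra_simps)
  ultimately have "((\<lambda>z. (a * z + b) / (cnj b * z + cnj a)) has_field_derivative 1 / (su_jac a b z)\<^sup>2) (at z)"
    using assms(1) by (simp add: su_jac_def power2_eq_square)
  then show ?thesis
    unfolding su_act_def su_jac_def by (rule DERIV_imp_deriv)
qed

text \<open>At a fixed point the vector \<open>(z, 1)\<close> is an eigenvector of the matrix with
  eigenvalue \<open>l = su_jac a b z\<close>. As \<open>z\<close> stays at the same distance from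
  the circle, \<open>norm l = 1\<close>, and the characteristic equation gives
  \<open>Re a = Re l\<close>.\<close>

lemma su_act_fixed_point:
  assumes n: "a * cnj a - b * cnj b = 1" and z: "z \<in> disc" and fx: "su_act a b z = z"
  shows "\<bar>Re a\<bar> \<le> 1"
proof -
  define l where "l = su_jac a b z"
  have l0: "l \<noteq> 0" using su_jac_nz[OF n z] by (simp add: l_def)
  have z1: "1 - (norm z)\<^sup>2 > 0" using z by (simp add: abs_square_less_1)
  have "1 - (norm z)\<^sup>2 = (1 - (norm z)\<^sup>2) / (norm l)\<^sup>2"
    using one_minus_norm_su_act[OF n z] fx by (simp add: l_def)
  then have l1: "(norm l)\<^sup>2 = 1" using z1 by (metis divide_cancel_left div_by_1 less_irrefl)
  have e1: "a * z + b = l * z" using fx l0 by (simp add: su_act_def l_def field_simps)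
  have e2: "l = cnj b * z + cnj a" by (simp add: l_def su_jac_def)
  have "l * l + 1 = (a + cnj a) * l"
  proof -
    have "(l - a) * z = b" using e1 by (simp add: algebra_simps)
    moreover have "cnj b * z = l - cnj a" using e2 by simp
    ultimately have "(l - a) * (l - cnj a) = b * cnj b" by (metis mult.assoc mult.commute)
    then show ?thesis using n by (simp add: algebra_simps)
  qed
  moreover have "cnj l * l = 1" using l1 complex_norm_square[of l] by (simp add: mult.commute)
  ultimately have "(l + cnj l) * l = (a + cnj a) * l" by (simp add: algebra_simps)
  then have "l + cnj l = a + cnj a" using l0 by simp
  then have "Re l = Re a" by (simp add: complex_add_cnj)
  moreover have "norm l = 1" using l1 by (metis norm_ge_zero one_power2 power2_eq_imp_eq zero_le_one)
  ultimately show ?thesis using abs_Re_le_cmod[of l] by simp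
qed

section \<open>Gaussian integers and the anisotropic norm form\<close>

definition gauss_int :: "int \<Rightarrow> int \<Rightarrow> complex" where
  "gauss_int p q = Complex (of_int p) (of_int q)"

definition gauss_ints :: "complex set" where
  "gauss_ints = {gauss_int p q | p q. True}"

lemma gauss_ints_iff: "z \<in> gauss_ints \<longleftrightarrow> Re z \<in> \<int> \<and> Im z \<in> \<int>"
proof
  assume "Re z \<in> \<int> \<and> Im z \<in> \<int>"
  then obtain p q where "Re z = of_int p" "Im z = of_int q" by (auto elim!: Ints_cases)
  then have "z = gauss_int p q" by (simp add: gauss_int_def complex_eq_iff)
  then show "z \<in> gauss_ints" by (auto simp: gauss_ints_def)
qed (auto simp: gauss_ints_def gauss_int_def)

lemma gauss_ints_intros:
  "x \<in> gauss_ints \<Longrightarrow> y \<in> gauss_ints \<Longrightarrow> x + y \<in> gauss_ints"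
  "x \<in> gauss_ints \<Longrightarrow> y \<in> gauss_ints \<Longrightarrow> x - y \<in> gauss_ints"
  "x \<in> gauss_ints \<Longrightarrow> y \<in> gauss_ints \<Longrightarrow> x * y \<in> gauss_ints"
  "x \<in> gauss_ints \<Longrightarrow> cnj x \<in> gauss_ints" "x \<in> gauss_ints \<Longrightarrow> - x \<in> gauss_ints"
  "0 \<in> gauss_ints" "1 \<in> gauss_ints" "3 \<in> gauss_ints" "\<i> \<in> gauss_ints"
  unfolding gauss_ints_iff by auto

lemma gauss_int_in_gauss_ints: "gauss_int p q \<in> gauss_ints"
  by (auto simp: gauss_ints_def)

lemma sum_squares_mod_3: "((a mod 3)\<^sup>2 + (b mod 3)\<^sup>2) mod 3 = (a\<^sup>2 + b\<^sup>2) mod (3::int)"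
proof -
  have "((a mod 3)\<^sup>2 + (b mod 3)\<^sup>2) mod 3 = ((a mod 3)\<^sup>2 mod 3 + (b mod 3)\<^sup>2 mod 3) mod 3"
    by (rule mod_add_eq[symmetric])
  also have "\<dots> = (a\<^sup>2 mod 3 + b\<^sup>2 mod 3) mod 3" by (simp only: power_mod)
  also have "\<dots> = (a\<^sup>2 + b\<^sup>2) mod 3" by (rule mod_add_eq)
  finally show ?thesis .
qed

lemma mod_3_cases: "(a::int) mod 3 = 0 \<or> a mod 3 = 1 \<or> a mod 3 = 2"
  by presburger

text \<open>Infinite descent: a sum of two squares is divisible by 3 only if both terms are, so all
  four numbers can be divided by 3. This is the anisotropy of the norm form, which is behind both
  cocompactness and the absence of torsion.\<close>

lemma sum_two_squares_eq_3_times: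
  fixes x y z w :: int
  assumes "x\<^sup>2 + y\<^sup>2 = 3 * (z\<^sup>2 + w\<^sup>2)"
  shows "x = 0 \<and> y = 0"
  using assms
proof (induction "nat (x\<^sup>2 + y\<^sup>2 + z\<^sup>2 + w\<^sup>2)" arbitrary: x y z w rule: less_induct)
  case less
  have dvd3: "3 dvd a \<and> 3 dvd b" if "3 dvd a\<^sup>2 + b\<^sup>2" for a b :: int
  proof -
    have "((a mod 3)\<^sup>2 + (b mod 3)\<^sup>2) mod 3 = 0"
      using that unfolding sum_squares_mod_3 dvd_eq_mod_eq_0 .
    then show ?thesis
      unfolding dvd_eq_mod_eq_0 using mod_3_cases[of a] mod_3_cases[of b] by (elim disjE) simp_all
  qed
  have "3 dvd x\<^sup>2 + y\<^sup>2" using less.prems by simp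
  then obtain x' y' where x': "x = 3 * x'" and y': "y = 3 * y'" using dvd3 by (meson dvdE)
  then have zw: "z\<^sup>2 + w\<^sup>2 = 3 * (x'\<^sup>2 + y'\<^sup>2)" using less.prems by (simp add: power_mult_distrib)
  then have "3 dvd z\<^sup>2 + w\<^sup>2" by simp
  then obtain z' w' where z': "z = 3 * z'" and w': "w = 3 * w'" using dvd3 by (meson dvdE)
  have eq: "x'\<^sup>2 + y'\<^sup>2 = 3 * (z'\<^sup>2 + w'\<^sup>2)" using zw z' w' by (simp add: power_mult_distrib)
  show ?case
  proof (rule ccontr)
    assume "\<not> ?case"
    then have "x \<noteq> 0 \<or> y \<noteq> 0" by simp
    then have pos: "x'\<^sup>2 + y'\<^sup>2 > 0" using x' y' by (simp add: sum_power2_gt_zero_iff)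
    have "x\<^sup>2 + y\<^sup>2 + z\<^sup>2 + w\<^sup>2 = 9 * (x'\<^sup>2 + y'\<^sup>2 + z'\<^sup>2 + w'\<^sup>2)"
      by (simp add: x' y' z' w' power_mult_distrib)
    moreover have "x'\<^sup>2 + y'\<^sup>2 + z'\<^sup>2 + w'\<^sup>2 > 0" using pos by (simp add: add_pos_nonneg)
    moreover have "nat A < nat (9 * A)" if "A > 0" for A :: int using that by simp
    ultimately have "nat (x'\<^sup>2 + y'\<^sup>2 + z'\<^sup>2 + w'\<^sup>2) < nat (x\<^sup>2 + y\<^sup>2 + z\<^sup>2 + w\<^sup>2)" by metis
    then have "x' = 0 \<and> y' = 0" using less.hyps eq by blast
    then show False using \<open>x \<noteq> 0 \<or> y \<noteq> 0\<close> x' y' by simp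
  qed
qed

text \<open>The reduced norm of the quaternion algebra \<open>(-1, 3 / \<rat>)\<close>.\<close>

definition qnorm :: "complex \<Rightarrow> complex \<Rightarrow> complex" where
  "qnorm a b = a * cnj a - 3 * (b * cnj b)"

abbreviation s3 :: complex where "s3 \<equiv> of_real (sqrt 3)"

lemma s3_mult: "s3 * s3 = 3" "s3 * (s3 * x) = 3 * x"
  by (simp_all flip: of_real_mult mult.assoc)

lemma qnorm_su: "a * cnj a - (s3 * b) * cnj (s3 * b) = qnorm a b"
proof -
  have "(s3 * b) * cnj (s3 * b) = (s3 * s3) * (b * cnj b)" by (simp add: mult_ac)
  then show ?thesis by (simp only: qnorm_def s3_mult)
qed

lemma qnorm_mult: "qnorm (a * c + 3 * (b * cnj d)) (a * d + b * cnj c) = qnorm a b * qnorm c d"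
  unfolding qnorm_def by (simp add: algebra_simps)

lemma qnorm_gauss:
  "qnorm (gauss_int p q) (gauss_int r s) = of_int (p\<^sup>2 + q\<^sup>2 - 3 * (r\<^sup>2 + s\<^sup>2))"
  by (simp add: qnorm_def gauss_int_def complex_eq_iff power2_eq_square)

text \<open>The congruence \<open>a \<equiv> 1\<close> modulo 3 excludes torsion: an element with a fixed point in the disc has
  \<open>\<bar>Re a\<bar> \<le> 1\<close>, and \<open>Re a = 1\<close> forces the identity since the norm form is anisotropic.\<close>

definition arith_pairs :: "(complex \<times> complex) set" where
  "arith_pairs = {(a, b). b \<in> gauss_ints \<and> (\<exists>c\<in>gauss_ints. a = 1 + 3 * c) \<and> qnorm a b = 1}"

text \<open>The quaternion \<open>a + b j\<close> with \<open>j\<^sup>2 = 3\<close> acts through the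
  matrix with entries \<open>a\<close> and \<open>s3 * b\<close>: over the reals 3 has a square root
  and the algebra splits, with \<open>qnorm\<close> becoming the determinant.\<close>

definition arith_group :: "(complex \<Rightarrow> complex) set" where
  "arith_group = (\<lambda>(a, b). su_act a (s3 * b)) ` arith_pairs"

lemma arith_pairsD:
  assumes "(a, b) \<in> arith_pairs"
  shows "a \<in> gauss_ints" "b \<in> gauss_ints" "a * cnj a - (s3 * b) * cnj (s3 * b) = 1" "qnorm a b = 1"
    "\<exists>c\<in>gauss_ints. a = 1 + 3 * c"
proof -
  show b: "b \<in> gauss_ints" and c: "\<exists>c\<in>gauss_ints. a = 1 + 3 * c" and q: "qnorm a b = 1"
    using assms unfolding arith_pairs_def by auto
  show "a * cnj a - (s3 * b) * cnj (s3 * b) = 1" unfolding qnorm_su by (rule q)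
  show "a \<in> gauss_ints" using c by (auto intro!: gauss_ints_intros)
qed

lemma arith_pairs_mult:
  assumes "(a, b) \<in> arith_pairs" "(c, d) \<in> arith_pairs"
  shows "(a * c + 3 * (b * cnj d), a * d + b * cnj c) \<in> arith_pairs"
proof -
  note 1 = arith_pairsD[OF assms(1)] and 2 = arith_pairsD[OF assms(2)]
  obtain x where x: "x \<in> gauss_ints" "a = 1 + 3 * x" using 1(5) by blast
  obtain y where y: "y \<in> gauss_ints" "c = 1 + 3 * y" using 2(5) by blast
  have e: "a * c + 3 * (b * cnj d) = 1 + 3 * (x + y + 3 * x * y + b * cnj d)"
    by (simp add: x y algebra_simps)
  have g: "x + y + 3 * x * y + b * cnj d \<in> gauss_ints"
    by (intro gauss_ints_intros x y 1 2)
  have "\<exists>e\<in>gauss_ints. a * c + 3 * (b * cnj d) = 1 + 3 * e"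
    using e g by blast
  moreover have "a * d + b * cnj c \<in> gauss_ints"
    by (intro gauss_ints_intros 1 2)
  moreover have "qnorm (a * c + 3 * (b * cnj d)) (a * d + b * cnj c) = 1"
    by (simp only: qnorm_mult 1(4) 2(4) mult_1_left)
  ultimately show ?thesis
    unfolding arith_pairs_def mem_Collect_eq case_prod_conv by blast
qed

lemma arith_act_compose:
  assumes "(a, b) \<in> arith_pairs" "(c, d) \<in> arith_pairs" "z \<in> disc"
  shows "su_act a (s3 * b) (su_act c (s3 * d) z) = su_act (a * c + 3 * (b * cnj d)) (s3 * (a * d + b * cnj c)) z"
    "su_jac (a * c + 3 * (b * cnj d)) (s3 * (a * d + b * cnj c)) z = su_jac a (s3 * b) (su_act c (s3 * d) z) * su_jac c (s3 * d) z"
proof -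
  have e: "a * c + s3 * b * cnj (s3 * d) = a * c + 3 * (b * cnj d)"
    "a * (s3 * d) + s3 * b * cnj c = s3 * (a * d + b * cnj c)"
    using s3_mult(1) by (simp_all add: algebra_simps flip: s3_mult(1))
  show "su_act a (s3 * b) (su_act c (s3 * d) z) = su_act (a * c + 3 * (b * cnj d)) (s3 * (a * d + b * cnj c)) z"
    "su_jac (a * c + 3 * (b * cnj d)) (s3 * (a * d + b * cnj c)) z = su_jac a (s3 * b) (su_act c (s3 * d) z) * su_jac c (s3 * d) z"
    using su_act_compose[OF arith_pairsD(3)[OF assms(1)] arith_pairsD(3)[OF assms(2)] assms(3)]
    unfolding e by simp_all
qed

lemma arith_pairs_one: "(1, 0) \<in> arith_pairs"
  unfolding arith_pairs_def by (auto simp: qnorm_def intro!: gauss_ints_intros bexI[of _ 0])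

lemma arith_pairs_inverse:
  assumes "(a, b) \<in> arith_pairs"
  shows "(cnj a, - b) \<in> arith_pairs"
proof -
  note 1 = arith_pairsD[OF assms]
  obtain c where c: "c \<in> gauss_ints" "a = 1 + 3 * c" using 1(5) by blast
  have "cnj a = 1 + 3 * cnj c" using c by simp
  then show ?thesis
    unfolding arith_pairs_def using 1 c gauss_ints_intros(4)[OF c(1)] gauss_ints_intros(5)[OF 1(2)]
    by (auto simp: qnorm_def mult.commute)
qed

lemma su_act_one: "su_act 1 (s3 * 0) = id"
  by (auto simp: su_act_def su_jac_def fun_eq_iff)

lemma arith_pair_torsion_free:
  assumes ab: "(a, b) \<in> arith_pairs" and z: "z \<in> disc" and fx: "su_act a (s3 * b) z = z"
  shows "a = 1" "b = 0"
proof -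
  note 1 = arith_pairsD[OF ab]
  have "\<bar>Re a\<bar> \<le> 1" using su_act_fixed_point[OF 1(3) z fx] .
  moreover obtain c where c: "c \<in> gauss_ints" "a = 1 + 3 * c" using 1(5) by blast
  obtain p q where pq: "c = gauss_int p q" using c(1) by (auto simp: gauss_ints_def)
  obtain r s where rs: "b = gauss_int r s" using 1(2) by (auto simp: gauss_ints_def)
  have "\<bar>1 + 3 * real_of_int p\<bar> \<le> 1" using calculation c(2) pq by (simp add: gauss_int_def)
  then have "-2 \<le> 3 * real_of_int p" "3 * real_of_int p \<le> 0" by linarith+
  then have "real_of_int (-2) \<le> real_of_int (3 * p)" "real_of_int (3 * p) \<le> real_of_int 0" by simp_all
  then have "p = 0" unfolding of_int_le_iff by presburger
  then have a: "a = gauss_int 1 (3 * q)" using c(2) pq by (simp add: gauss_int_def complex_eq_iff)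
  have "complex_of_int (1\<^sup>2 + (3 * q)\<^sup>2 - 3 * (r\<^sup>2 + s\<^sup>2)) = 1"
    using 1(4) unfolding a rs qnorm_gauss .
  then have "1\<^sup>2 + (3 * q)\<^sup>2 - 3 * (r\<^sup>2 + s\<^sup>2) = 1" by (metis of_int_eq_1_iff)
  \<comment> \<open>With real part 1 the norm equation loses its constant term; dividing by 3 leaves
    an instance of the anisotropic form.\<close>
  then have e: "r\<^sup>2 + s\<^sup>2 = 3 * (q\<^sup>2 + 0\<^sup>2)" by (simp add: power_mult_distrib)
  have "r = 0 \<and> s = 0" using sum_two_squares_eq_3_times[OF e] .
  moreover have "q = 0" using e calculation by simp
  ultimately show "a = 1" "b = 0" using a rs by (simp_all add: gauss_int_def complex_eq_iff)
qed

section \<open>Discontinuity and cocompactness of the arithmetic group\<close>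

lemma finite_arith_pairs_bounded: "finite {(a, b)\<in>arith_pairs. norm a \<le> R}"
proof -
  define N where "N = \<lceil>R\<rceil>"
  define box where "box = (\<lambda>(p, q). gauss_int p q) ` ({-N..N} \<times> {-N..N})"
  have in_box: "x \<in> box" if x: "x \<in> gauss_ints" "norm x \<le> R" for x
  proof -
    obtain p q where pq: "x = gauss_int p q" using x(1) by (auto simp: gauss_ints_def)
    have "\<bar>of_int p\<bar> \<le> R" "\<bar>of_int q\<bar> \<le> R"
      using abs_Re_le_cmod[of x] abs_Im_le_cmod[of x] x(2) by (auto simp: pq gauss_int_def)
    then have "p \<in> {-N..N}" "q \<in> {-N..N}" unfolding N_def by (auto simp: abs_le_iff le_ceiling_iff) linarith+
    then show ?thesis unfolding box_def pq by blast
  qed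
  have "{(a, b)\<in>arith_pairs. norm a \<le> R} \<subseteq> box \<times> box"
  proof clarify
    fix a b assume ab: "(a, b) \<in> arith_pairs" "norm a \<le> R"
    note 1 = arith_pairsD[OF ab(1)]
    have "norm b \<le> norm (s3 * b)" by (simp add: norm_mult mult_le_cancel_right1)
    also have "\<dots> < norm a" using su_norm(2)[OF 1(3)] .
    finally show "a \<in> box \<and> b \<in> box" using in_box 1 ab(2) by auto
  qed
  moreover have "finite (box \<times> box)" unfolding box_def by blast
  ultimately show ?thesis by (rule finite_subset)
qed

text \<open>Dirichlet's box principle: there are \<open>(M + 1)\<^sup>2\<close> multiples of
  \<open>z / s3\<close> by Gaussian integers and \<open>M\<^sup>2\<close> boxes for their fractional
  parts. The difference of two multiples in one box gives \<open>a\<close>, and the integer parts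
  give \<open>b\<close>.\<close>

lemma small_quaternion:
  assumes z: "z \<in> disc"
  obtains a b where "a \<in> gauss_ints" "b \<in> gauss_ints" "a \<noteq> 0"
    "norm (a * z + s3 * b) \<le> 8 * sqrt (1 - (norm z)\<^sup>2)"
    "norm (su_jac a (s3 * b) z) \<le> 8 * sqrt (1 - (norm z)\<^sup>2)"
proof -
  define t where "t = 1 - (norm z)\<^sup>2"
  have t: "0 < t" "t \<le> 1" using z by (auto simp: t_def abs_square_less_1)
  have st: "0 < sqrt t" "sqrt t \<le> 1" using t by auto
  \<comment> \<open>The size that balances the errors: \<open>a * z + s3 * b\<close> is of order
    \<open>1 / M\<close> and \<open>norm a * t\<close> of order \<open>M * t\<close>; both become of
    order \<open>sqrt t\<close>.\<close>
  define M where "M = nat \<lceil>1 / sqrt t\<rceil>"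
  have M1: "1 / sqrt t \<le> real M" unfolding M_def by (simp add: real_nat_ceiling_ge)
  have "real_of_int \<lceil>1 / sqrt t\<rceil> < 1 / sqrt t + 1" by linarith
  moreover have "1 \<le> 1 / sqrt t" using st by simp
  ultimately have M2: "real M \<le> 2 / sqrt t" unfolding M_def by simp
  have "real M \<ge> 1" using M1 \<open>1 \<le> 1 / sqrt t\<close> by linarith
  then have Mpos: "M > 0" by simp
  have M3: "1 / real M \<le> sqrt t" using M1 st Mpos by (simp add: field_simps)
  define x where "x = (\<lambda>(j, k). gauss_int (int j) (int k) * z / s3)"
  define \<phi> where "\<phi> = (\<lambda>p. (nat \<lfloor>real M * frac (Re (x p))\<rfloor>, nat \<lfloor>real M * frac (Im (x p))\<rfloor>))"
  have fr: "nat \<lfloor>real M * frac y\<rfloor> < M" for y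
  proof -
    have "real M * frac y < real M * 1" using Mpos frac_lt_1[of y] by (intro mult_strict_left_mono) auto
    then show ?thesis using frac_ge_0[of y] by (simp add: nat_less_iff floor_less_iff)
  qed
  have "\<phi> ` ({..M} \<times> {..M}) \<subseteq> {..<M} \<times> {..<M}" using fr by (auto simp: \<phi>_def)
  then have "card (\<phi> ` ({..M} \<times> {..M})) \<le> card ({..<M} \<times> {..<M})" by (intro card_mono) auto
  also have "\<dots> < card ({..M} \<times> {..M})" by (simp add: card_cartesian_product)
  finally have "\<not> inj_on \<phi> ({..M} \<times> {..M})" using pigeonhole by blast
  then obtain p p' where pp: "p \<in> {..M} \<times> {..M}" "p' \<in> {..M} \<times> {..M}" "p \<noteq> p'" "\<phi> p = \<phi> p'"
    unfolding inj_on_def by blast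
  obtain j k j' k' where jk: "p = (j, k)" "p' = (j', k')" by (metis surj_pair)
  define a where "a = gauss_int (int j - int j') (int k - int k')"
  define b where "b = - gauss_int (\<lfloor>Re (x p)\<rfloor> - \<lfloor>Re (x p')\<rfloor>) (\<lfloor>Im (x p)\<rfloor> - \<lfloor>Im (x p')\<rfloor>)"
  have ab: "a \<in> gauss_ints" "b \<in> gauss_ints"
    unfolding a_def b_def by (intro gauss_ints_intros gauss_int_in_gauss_ints)+
  have a0: "a \<noteq> 0" using pp(3) jk by (auto simp: a_def gauss_int_def complex_eq_iff)
  have close: "\<bar>frac u - frac v\<bar> \<le> 1 / real M"
    if "nat \<lfloor>real M * frac u\<rfloor> = nat \<lfloor>real M * frac v\<rfloor>" for u v
  proof -
    have "\<lfloor>real M * frac u\<rfloor> = \<lfloor>real M * frac v\<rfloor>"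
      using that frac_ge_0[of u] frac_ge_0[of v] by (simp add: eq_nat_nat_iff)
    then have "\<bar>real M * frac u - real M * frac v\<bar> \<le> 1" by linarith
    then have "real M * \<bar>frac u - frac v\<bar> \<le> 1" by (simp add: abs_mult flip: right_diff_distrib)
    then show ?thesis using Mpos by (simp add: field_simps)
  qed
  define y where "y = x p - x p' + b"
  have y: "Re y = frac (Re (x p)) - frac (Re (x p'))" "Im y = frac (Im (x p)) - frac (Im (x p'))"
    by (simp_all add: y_def b_def gauss_int_def frac_def)
  have "norm y \<le> \<bar>Re y\<bar> + \<bar>Im y\<bar>" by (rule cmod_le)
  also have "\<dots> \<le> 1 / real M + 1 / real M"
    unfolding y using pp(4) by (intro add_mono close) (auto simp: \<phi>_def)
  also have "\<dots> \<le> 2 * sqrt t" using M3 by linarith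
  finally have ny: "norm y \<le> 2 * sqrt t" .
  have v: "a * z + s3 * b = s3 * y"
  proof -
    have "s3 * (x p - x p') = a * z"
      by (simp add: x_def jk a_def gauss_int_def complex_eq_iff algebra_simps)
    then show ?thesis by (simp add: y_def distrib_left)
  qed
  have "sqrt 3 \<le> 2" by (rule real_le_lsqrt) auto
  then have nv: "norm (a * z + s3 * b) \<le> 4 * sqrt t"
    unfolding v norm_mult using ny st mult_mono[of "sqrt 3" 2 "norm y" "2 * sqrt t"] by simp
  have na: "norm a \<le> 2 * real M"
  proof -
    have "norm a \<le> \<bar>Re a\<bar> + \<bar>Im a\<bar>" by (rule cmod_le)
    moreover have "\<bar>Re a\<bar> \<le> real M" "\<bar>Im a\<bar> \<le> real M"
      using pp(1,2) jk by (auto simp: a_def gauss_int_def)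
    ultimately show ?thesis by linarith
  qed
  have "norm (su_jac a (s3 * b) z) = norm (cnj (su_jac a (s3 * b) z))" by (rule complex_mod_cnj[symmetric])
  \<comment> \<open>Writing 1 as \<open>z * cnj z + t\<close> reduces the bound on the denominator
    to those on \<open>a * z + s3 * b\<close> and on \<open>norm a * t\<close>.\<close>
  also have "cnj (su_jac a (s3 * b) z) = cnj z * (a * z + s3 * b) + a * of_real t"
  proof -
    have "complex_of_real t = 1 - z * cnj z"
      unfolding t_def of_real_diff complex_norm_square by simp
    then show ?thesis by (simp only:) (simp add: su_jac_def algebra_simps)
  qed
  also have "norm \<dots> \<le> norm z * norm (a * z + s3 * b) + norm a * t"
    using norm_triangle_ineq[of "cnj z * (a * z + s3 * b)" "a * of_real t"] t by (simp add: norm_mult)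
  also have "\<dots> \<le> 1 * (4 * sqrt t) + 4 * sqrt t"
  proof (rule add_mono)
    show "norm z * norm (a * z + s3 * b) \<le> 1 * (4 * sqrt t)"
      using z nv by (intro mult_mono) auto
    have "norm a * t \<le> (4 / sqrt t) * t" using na M2 t by (intro mult_right_mono) auto
    also have "\<dots> = 4 * (t / sqrt t)" by simp
    also have "t / sqrt t = sqrt t" using t by (simp add: real_div_sqrt)
    finally show "norm a * t \<le> 4 * sqrt t" .
  qed
  finally have "norm (su_jac a (s3 * b) z) \<le> 8 * sqrt t" by simp
  moreover have "norm (a * z + s3 * b) \<le> 8 * sqrt t" using nv st by linarith
  ultimately show ?thesis using that[OF ab a0] by (simp add: t_def)
qed

lemma gauss_int_cong:
  assumes "p mod n = p' mod n" "q mod n = q' mod n"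
  shows "\<exists>c\<in>gauss_ints. gauss_int p q = gauss_int p' q' + of_int n * c"
proof -
  obtain k l where "p = p' + n * k" "q = q' + n * l"
    using assms by (metis mod_eqE diff_eq_eq add.commute mult.commute)
  then show ?thesis
    by (intro bexI[of _ "gauss_int k l"]) (auto simp: gauss_int_def complex_eq_iff gauss_ints_def)
qed

text \<open>A quaternion \<open>x\<close> that is small at \<open>z\<close> has bounded norm \<open>n\<close>; multiplying it from the left by
  the conjugate of a fixed representative \<open>y\<close> of its class modulo \<open>n\<close> gives \<open>n\<close> times a quaternion
  of norm one.\<close>

lemma arith_cocompact_full:
  obtains C where "C \<ge> 1" "\<And>z. z \<in> disc \<Longrightarrow> \<exists>a\<in>gauss_ints. \<exists>b\<in>gauss_ints. qnorm a b = 1 \<and>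
     norm (su_jac a (s3 * b) z) \<le> C * sqrt (1 - (norm z)\<^sup>2)"
proof -
  define N where "N = (\<lambda>(p, q, r, s). p\<^sup>2 + q\<^sup>2 - 3 * (r\<^sup>2 + s\<^sup>2) :: int)"
  \<comment> \<open>The constant is the square of the 8 in \<open>small_quaternion\<close>: the norm
    times \<open>t\<close> is a difference of two squares, each at most
    \<open>64 * t\<close>.\<close>
  define X where "X = {x. N x \<noteq> 0 \<and> \<bar>N x\<bar> \<le> 64}"
  \<comment> \<open>The norm together with the residue class modulo the norm. It takes finitely many
    values on \<open>X\<close>, so finitely many representatives suffice, and \<open>C\<close> is a
    maximum over them.\<close>
  define \<kappa> where "\<kappa> = (\<lambda>x. case x of (p, q, r, s) \<Rightarrow> (N x, p mod N x, q mod N x, r mod N x, s mod N x))"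
  have md: "p mod m \<in> {-64..64}" if "m \<noteq> 0" "\<bar>m\<bar> \<le> 64" for p m :: int
  proof (cases "m > 0")
    case True
    then have "0 \<le> p mod m" "p mod m < m" by (rule pos_mod_sign, rule pos_mod_bound)
    then show ?thesis using that(2) by simp
  next
    case False
    then have "m < 0" using that(1) by simp
    then have "p mod m \<le> 0" "m < p mod m" by (rule neg_mod_sign, rule neg_mod_bound)
    then show ?thesis using that(2) by simp
  qed
  have "\<kappa> ` X \<subseteq> {-64..64} \<times> {-64..64} \<times> {-64..64} \<times> {-64..64} \<times> {-64..64}"
  proof
    fix v assume "v \<in> \<kappa> ` X"
    then obtain p q r s where x: "(p, q, r, s) \<in> X" "v = \<kappa> (p, q, r, s)" by auto
    moreover have "N (p, q, r, s) \<in> {-64..64}" using x(1) by (auto simp: X_def)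
    ultimately show "v \<in> {-64..64} \<times> {-64..64} \<times> {-64..64} \<times> {-64..64} \<times> {-64..64}"
      using md by (auto simp: \<kappa>_def X_def simp del: atLeastAtMost_iff)
  qed
  moreover have "finite ({-64..64::int} \<times> {-64..64::int} \<times> {-64..64::int} \<times> {-64..64::int} \<times> {-64..64::int})"
    by (intro finite_cartesian_product finite_atLeastAtMost_int)
  ultimately have "finite (\<kappa> ` X)" by (rule finite_subset)
  then obtain Y where Y: "Y \<subseteq> X" "finite Y" "\<kappa> ` X = \<kappa> ` Y"
    using finite_subset_image[of "\<kappa> ` X" \<kappa> X] by blast
  define w where "w = (\<lambda>(p, q, r, s). sqrt 3 * norm (gauss_int r s) + norm (gauss_int p q))"
  define C where "C = Max (insert 1 ((\<lambda>y. 8 * w y) ` Y))"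
  have C1: "C \<ge> 1" and Cw: "\<And>y. y \<in> Y \<Longrightarrow> 8 * w y \<le> C"
    unfolding C_def using Y(2) by auto
  show ?thesis
  proof (rule that[OF C1])
    fix z assume z: "z \<in> disc"
    define t where "t = 1 - (norm z)\<^sup>2"
    have t: "t > 0" using z by (simp add: t_def abs_square_less_1)
    obtain a b where ab: "a \<in> gauss_ints" "b \<in> gauss_ints" "a \<noteq> 0"
      "norm (a * z + s3 * b) \<le> 8 * sqrt t" "norm (su_jac a (s3 * b) z) \<le> 8 * sqrt t"
      unfolding t_def by (rule small_quaternion[OF z])
    obtain p q where pq: "a = gauss_int p q" using ab(1) by (auto simp: gauss_ints_def)
    obtain r s where rs: "b = gauss_int r s" using ab(2) by (auto simp: gauss_ints_def)
    define n where "n = N (p, q, r, s)"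
    have qn: "qnorm a b = of_int n" unfolding pq rs qnorm_gauss by (simp add: n_def N_def)
    \<comment> \<open>Anisotropy enters here: the small quaternion is nonzero, hence
      invertible.\<close>
    have n0: "n \<noteq> 0"
    proof
      assume "n = 0"
      then have "p\<^sup>2 + q\<^sup>2 = 3 * (r\<^sup>2 + s\<^sup>2)" by (simp add: n_def N_def)
      then have "p = 0 \<and> q = 0" by (rule sum_two_squares_eq_3_times)
      then show False using ab(3) pq by (simp add: gauss_int_def complex_eq_iff)
    qed
    have "su_jac a (s3 * b) z * cnj (su_jac a (s3 * b) z) - (a * z + s3 * b) * cnj (a * z + s3 * b)
        = (a * cnj a - (s3 * b) * cnj (s3 * b)) * (1 - z * cnj z)"
      unfolding su_jac_def by (simp add: algebra_simps)
    then have "complex_of_real ((norm (su_jac a (s3 * b) z))\<^sup>2 - (norm (a * z + s3 * b))\<^sup>2) = complex_of_real (of_int n * t)"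
      unfolding of_real_diff of_real_mult complex_norm_square qnorm_su qn t_def by simp
    then have nt: "(norm (su_jac a (s3 * b) z))\<^sup>2 - (norm (a * z + s3 * b))\<^sup>2 = of_int n * t"
      by (simp only: of_real_eq_iff)
    have "(norm (su_jac a (s3 * b) z))\<^sup>2 \<le> (8 * sqrt t)\<^sup>2" "(norm (a * z + s3 * b))\<^sup>2 \<le> (8 * sqrt t)\<^sup>2"
      by (rule power_mono[OF ab(5) norm_ge_zero], rule power_mono[OF ab(4) norm_ge_zero])
    then have b64: "(norm (su_jac a (s3 * b) z))\<^sup>2 \<le> 64 * t" "(norm (a * z + s3 * b))\<^sup>2 \<le> 64 * t"
      using t by (auto simp: power_mult_distrib)
    have "of_int n * t \<le> 64 * t" "(-64) * t \<le> of_int n * t"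
      using nt b64 by (smt (verit) zero_le_power2)+
    then have "real_of_int n \<le> 64" "-64 \<le> real_of_int n" using t by (simp_all only: mult_le_cancel_right_pos)
    then have "\<bar>n\<bar> \<le> 64" by linarith
    then have "(p, q, r, s) \<in> X" using n0 by (simp add: X_def n_def)
    then have "\<kappa> (p, q, r, s) \<in> \<kappa> ` Y" using Y(3) by blast
    then obtain y where y: "y \<in> Y" "\<kappa> y = \<kappa> (p, q, r, s)" by (metis imageE)
    obtain p' q' r' s' where y': "y = (p', q', r', s')" by (metis prod_cases4)
    define c d where "c = gauss_int p' q'" and "d = gauss_int r' s'"
    have Ny: "N y = n" using y(2) y' by (auto simp: \<kappa>_def n_def)
    have "p mod n = p' mod n" "q mod n = q' mod n" "r mod n = r' mod n" "s mod n = s' mod n"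
      using y(2) y' Ny by (auto simp: \<kappa>_def n_def)
    then obtain e f where ef: "e \<in> gauss_ints" "a = c + of_int n * e" "f \<in> gauss_ints" "b = d + of_int n * f"
      unfolding pq rs c_def d_def using gauss_int_cong by metis
    have cd: "c \<in> gauss_ints" "d \<in> gauss_ints" by (auto simp: c_def d_def gauss_ints_def)
    have qcd: "c * cnj c - 3 * (d * cnj d) = of_int n"
      using Ny unfolding y' N_def
      by (simp add: c_def d_def flip: qnorm_def) (simp add: qnorm_gauss)
    \<comment> \<open>\<open>a'\<close> and \<open>b'\<close> are the entries of the conjugate of
      \<open>(c, d)\<close> times \<open>(a, b)\<close>, divided by \<open>n\<close>. The congruence
      modulo \<open>n\<close> and the norm \<open>n\<close> of \<open>(c, d)\<close> make the
      quotient integral.\<close>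
    define a' where "a' = 1 + cnj c * e - 3 * (d * cnj f)"
    define b' where "b' = cnj c * f - d * cnj e"
    have ab': "a' \<in> gauss_ints" "b' \<in> gauss_ints"
      unfolding a'_def b'_def by (intro gauss_ints_intros cd ef)+
    have na': "of_int n * a' = cnj c * a + 3 * (- d * cnj b)"
    proof -
      have "cnj c * a + 3 * (- d * cnj b) = (c * cnj c - 3 * (d * cnj d)) + of_int n * (cnj c * e - 3 * (d * cnj f))"
        unfolding ef by (simp add: algebra_simps)
      then show ?thesis unfolding qcd by (simp add: a'_def algebra_simps)
    qed
    have nb': "of_int n * b' = cnj c * b + (- d) * cnj a"
      unfolding ef b'_def by (simp add: algebra_simps)
    have n0': "(of_int n :: complex) \<noteq> 0" using n0 by simp
    have "of_int n * of_int n * qnorm a' b' = qnorm (of_int n * a') (of_int n * b')"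
      by (simp add: qnorm_def algebra_simps)
    also have "\<dots> = qnorm (cnj c) (- d) * qnorm a b"
      unfolding na' nb' by (rule qnorm_mult)
    also have "qnorm (cnj c) (- d) = of_int n" using qcd by (simp add: qnorm_def mult.commute)
    finally have "of_int n * of_int n * qnorm a' b' = of_int n * of_int n" unfolding qn .
    then have q1: "qnorm a' b' = 1" using n0' by simp
    have "of_int n * su_jac a' (s3 * b') z = cnj (s3 * (of_int n * b')) * z + cnj (of_int n * a')"
      by (simp add: su_jac_def algebra_simps)
    also have "\<dots> = - s3 * cnj d * (a * z + s3 * b) + c * su_jac a (s3 * b) z"
      unfolding na' nb' by (simp add: su_jac_def algebra_simps s3_mult)
    finally have e1: "of_int n * su_jac a' (s3 * b') z = - s3 * cnj d * (a * z + s3 * b) + c * su_jac a (s3 * b) z" .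
    have "norm (su_jac a' (s3 * b') z) \<le> norm (of_int n * su_jac a' (s3 * b') z)"
    proof -
      have "1 \<le> \<bar>real_of_int n\<bar>" using n0 by linarith
      then show ?thesis by (simp add: norm_mult mult_le_cancel_right1)
    qed
    also have "\<dots> \<le> sqrt 3 * norm d * norm (a * z + s3 * b) + norm c * norm (su_jac a (s3 * b) z)"
      unfolding e1 by (rule order_trans[OF norm_triangle_ineq]) (simp add: norm_mult)
    also have "\<dots> \<le> sqrt 3 * norm d * (8 * sqrt t) + norm c * (8 * sqrt t)"
      using ab(4,5) by (intro add_mono mult_left_mono) auto
    also have "\<dots> = 8 * w y * sqrt t" by (simp add: w_def y' c_def d_def algebra_simps)
    also have "\<dots> \<le> C * sqrt t" using Cw[OF y(1)] t by (intro mult_right_mono) auto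
    finally show "\<exists>a\<in>gauss_ints. \<exists>b\<in>gauss_ints. qnorm a b = 1 \<and>
       norm (su_jac a (s3 * b) z) \<le> C * sqrt (1 - (norm z)\<^sup>2)"
      using ab' q1 unfolding t_def by blast
  qed
qed

text \<open>The norm equation makes \<open>a * cnj a\<close> congruent to 1 modulo 3, which leaves
  only the residues of the four units of the Gaussian integers; \<open>e\<close> is the inverse
  unit. Multiplication by it does not change \<open>norm (su_jac a (s3 * b) z)\<close>, so
  cocompactness passes to the congruence group.\<close>

lemma unit_times_cong_1:
  assumes a: "a \<in> gauss_ints" and b: "b \<in> gauss_ints" and q: "qnorm a b = 1"
  obtains e where "e \<in> gauss_ints" "norm e = 1" "(e * a, e * b) \<in> arith_pairs"
proof -
  obtain p q where pq: "a = gauss_int p q" using a by (auto simp: gauss_ints_def)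
  obtain r s where rs: "b = gauss_int r s" using b by (auto simp: gauss_ints_def)
  have "complex_of_int (p\<^sup>2 + q\<^sup>2 - 3 * (r\<^sup>2 + s\<^sup>2)) = 1"
    using q unfolding pq rs qnorm_gauss .
  then have eq: "p\<^sup>2 + q\<^sup>2 = 1 + 3 * (r\<^sup>2 + s\<^sup>2)" by (metis of_int_eq_1_iff diff_eq_eq)
  have "((p mod 3)\<^sup>2 + (q mod 3)\<^sup>2) mod 3 = (p\<^sup>2 + q\<^sup>2) mod 3" by (rule sum_squares_mod_3)
  also have "\<dots> = 1"
  proof -
    have "(1 + 3 * k) mod 3 = 1" for k :: int by presburger
    then show ?thesis unfolding eq .
  qed
  finally have m: "((p mod 3)\<^sup>2 + (q mod 3)\<^sup>2) mod 3 = 1" .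
  have "(p mod 3 = 1 \<and> q mod 3 = 0) \<or> (p mod 3 = 2 \<and> q mod 3 = 0) \<or> (p mod 3 = 0 \<and> q mod 3 = 1) \<or> (p mod 3 = 0 \<and> q mod 3 = 2)"
    using m mod_3_cases[of p] mod_3_cases[of q] by (elim disjE) simp_all
  then obtain e where e: "e \<in> gauss_ints" "norm e = 1" "\<exists>c\<in>gauss_ints. e * a = 1 + 3 * c"
  proof (elim disjE conjE)
    assume "p mod 3 = 1" "q mod 3 = 0"
    then have "\<exists>k l. p = 1 + 3 * k \<and> q = 3 * l" by presburger
    then obtain k l where "p = 1 + 3 * k" "q = 3 * l" by blast
    then have "1 * a = 1 + 3 * gauss_int k l" by (simp add: pq gauss_int_def complex_eq_iff)
    then show ?thesis using that[of 1] gauss_ints_intros by (auto simp: gauss_ints_def)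
  next
    assume "p mod 3 = 2" "q mod 3 = 0"
    then have "\<exists>k l. p = - 1 - 3 * k \<and> q = - (3 * l)" by presburger
    then obtain k l where "p = - 1 - 3 * k" "q = - (3 * l)" by blast
    then have "- 1 * a = 1 + 3 * gauss_int k l" by (simp add: pq gauss_int_def complex_eq_iff)
    then show ?thesis using that[of "-1"] gauss_ints_intros by (auto simp: gauss_ints_def)
  next
    assume "p mod 3 = 0" "q mod 3 = 1"
    then have "\<exists>k l. q = 1 + 3 * k \<and> p = - (3 * l)" by presburger
    then obtain k l where "q = 1 + 3 * k" "p = - (3 * l)" by blast
    then have "- \<i> * a = 1 + 3 * gauss_int k l" by (simp add: pq gauss_int_def complex_eq_iff)
    then show ?thesis using that[of "- \<i>"] gauss_ints_intros by (auto simp: gauss_ints_def)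
  next
    assume "p mod 3 = 0" "q mod 3 = 2"
    then have "\<exists>k l. q = - 1 - 3 * k \<and> p = 3 * l" by presburger
    then obtain k l where "q = - 1 - 3 * k" "p = 3 * l" by blast
    then have "\<i> * a = 1 + 3 * gauss_int k l" by (simp add: pq gauss_int_def complex_eq_iff)
    then show ?thesis using that[of "\<i>"] gauss_ints_intros by (auto simp: gauss_ints_def)
  qed
  have ee: "e * cnj e = 1" using e(2) complex_norm_square[of e] by simp
  have "qnorm (e * a) (e * b) = (e * cnj e) * qnorm a b"
    by (simp add: qnorm_def algebra_simps)
  then have "qnorm (e * a) (e * b) = 1" using ee q by simp
  then have "(e * a, e * b) \<in> arith_pairs"
    unfolding arith_pairs_def using e gauss_ints_intros(3)[OF e(1) b] by blast
  then show ?thesis using that e by blast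
qed

lemma arith_cocompact:
  obtains \<rho> where "0 < \<rho>" "\<rho> < 1" "\<And>z. z \<in> disc \<Longrightarrow> \<exists>g\<in>arith_group. g z \<in> cball 0 \<rho>"
proof -
  obtain C where C: "C \<ge> 1" "\<And>z. z \<in> disc \<Longrightarrow> \<exists>a\<in>gauss_ints. \<exists>b\<in>gauss_ints. qnorm a b = 1 \<and>
     norm (su_jac a (s3 * b) z) \<le> C * sqrt (1 - (norm z)\<^sup>2)"
    by (rule arith_cocompact_full) (rule that)
  \<comment> \<open>The bound on \<open>su_jac\<close> gives
    \<open>1 - (norm (g z))\<^sup>2 \<ge> 1 / C\<^sup>2\<close>. The factor 2 keeps
    \<open>\<rho>\<close> positive even when \<open>C = 1\<close>.\<close>
  define \<rho> where "\<rho> = sqrt (1 - 1 / (2 * C\<^sup>2))"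
  have C2: "C\<^sup>2 \<ge> 1" using C(1) by (simp add: one_le_power)
  have C0: "0 < C\<^sup>2" using C2 by linarith
  have "1 / (2 * C\<^sup>2) \<le> 1 / 2" by (rule divide_left_mono) (use C0 C2 in auto)
  moreover have "0 < 1 / (2 * C\<^sup>2)" using C0 by simp
  ultimately have \<rho>: "0 < \<rho>" "\<rho> < 1" by (auto simp: \<rho>_def)
  show ?thesis
  proof (rule that[OF \<rho>])
    fix z assume z: "z \<in> disc"
    have t: "1 - (norm z)\<^sup>2 > 0" using z by (simp add: abs_square_less_1)
    obtain a b where ab: "a \<in> gauss_ints" "b \<in> gauss_ints" "qnorm a b = 1"
     "norm (su_jac a (s3 * b) z) \<le> C * sqrt (1 - (norm z)\<^sup>2)" using C(2)[OF z] by blast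
    obtain e where e: "e \<in> gauss_ints" "norm e = 1" "(e * a, e * b) \<in> arith_pairs"
      by (rule unit_times_cong_1[OF ab(1-3)])
    have n: "(e * a) * cnj (e * a) - (s3 * (e * b)) * cnj (s3 * (e * b)) = 1"
      using arith_pairsD(3)[OF e(3)] .
    have "su_jac (e * a) (s3 * (e * b)) z = cnj e * su_jac a (s3 * b) z"
      by (simp add: su_jac_def algebra_simps)
    then have jn: "norm (su_jac (e * a) (s3 * (e * b)) z) \<le> C * sqrt (1 - (norm z)\<^sup>2)"
      using ab(4) e(2) by (simp add: norm_mult)
    have "(norm (su_jac (e * a) (s3 * (e * b)) z))\<^sup>2 \<le> (C * sqrt (1 - (norm z)\<^sup>2))\<^sup>2"
      using jn by (intro power_mono) auto
    then have j2: "(norm (su_jac (e * a) (s3 * (e * b)) z))\<^sup>2 \<le> C\<^sup>2 * (1 - (norm z)\<^sup>2)"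
      using t by (simp add: power_mult_distrib)
    have jpos: "0 < (norm (su_jac (e * a) (s3 * (e * b)) z))\<^sup>2" using su_jac_nz[OF n z] by simp
    have "1 / (2 * C\<^sup>2) \<le> 1 / C\<^sup>2" using C2 by (intro divide_left_mono) auto
    also have "\<dots> = (1 - (norm z)\<^sup>2) / (C\<^sup>2 * (1 - (norm z)\<^sup>2))" using t by simp
    also have "\<dots> \<le> (1 - (norm z)\<^sup>2) / (norm (su_jac (e * a) (s3 * (e * b)) z))\<^sup>2"
      by (rule divide_left_mono[OF j2 less_imp_le[OF t] mult_pos_pos[OF less_le_trans[OF jpos j2] jpos]])
    also have "\<dots> = 1 - (norm (su_act (e * a) (s3 * (e * b)) z))\<^sup>2"
      using one_minus_norm_su_act[OF n z] by simp
    finally have "(norm (su_act (e * a) (s3 * (e * b)) z))\<^sup>2 \<le> 1 - 1 / (2 * C\<^sup>2)" by linarith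
    then have "norm (su_act (e * a) (s3 * (e * b)) z) \<le> \<rho>" unfolding \<rho>_def by (rule real_le_rsqrt)
    moreover have "su_act (e * a) (s3 * (e * b)) \<in> arith_group"
      unfolding arith_group_def using e(3) by (intro image_eqI[of _ _ "(e * a, e * b)"]) auto
    ultimately show "\<exists>g\<in>arith_group. g z \<in> cball 0 \<rho>" by (intro bexI) auto
  qed
qed

lemma arith_groupE:
  assumes "g \<in> arith_group"
  obtains a b where "(a, b) \<in> arith_pairs" "g = su_act a (s3 * b)"
  using assms unfolding arith_group_def by auto

lemma arith_groupI: "(a, b) \<in> arith_pairs \<Longrightarrow> su_act a (s3 * b) \<in> arith_group"
  unfolding arith_group_def by (intro image_eqI[of _ _ "(a, b)"]) auto

theorem arith_group_surface_group: "surface_group arith_group"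
  unfolding surface_group_def
proof (intro conjI ballI allI impI)
  show "arith_group \<subseteq> disc_automorphisms"
    using su_act_automorphism arith_pairsD(3) by (auto elim!: arith_groupE)
  show "id \<in> arith_group" using arith_groupI[OF arith_pairs_one] unfolding su_act_one .
next
  fix g h assume g: "g \<in> arith_group" and h: "h \<in> arith_group"
  obtain a b where ab: "(a, b) \<in> arith_pairs" "g = su_act a (s3 * b)" using g by (rule arith_groupE)
  obtain c d where cd: "(c, d) \<in> arith_pairs" "h = su_act c (s3 * d)" using h by (rule arith_groupE)
  show "\<exists>k\<in>arith_group. \<forall>z\<in>disc. h (g z) = k z"
    using arith_groupI[OF arith_pairs_mult[OF cd(1) ab(1)]] arith_act_compose(1)[OF cd(1) ab(1)]
    unfolding ab(2) cd(2) by blast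
next
  fix g assume g: "g \<in> arith_group"
  obtain a b where ab: "(a, b) \<in> arith_pairs" "g = su_act a (s3 * b)" using g by (rule arith_groupE)
  note i = arith_pairs_inverse[OF ab(1)]
  have "a * cnj a - 3 * (b * cnj b) = 1" using arith_pairsD(4)[OF ab(1)] by (simp add: qnorm_def)
  then have e: "cnj a * a + 3 * (- b * cnj b) = 1" "cnj a * b + - b * cnj a = 0"
    by (simp_all add: algebra_simps)
  have "su_act (cnj a) (s3 * - b) (g z) = z" if "z \<in> disc" for z
    using arith_act_compose(1)[OF i ab(1) that] unfolding e su_act_one ab(2) by simp
  then show "\<exists>h\<in>arith_group. \<forall>z\<in>disc. h (g z) = z" using arith_groupI[OF i] by blast
next
  fix g z w assume g: "g \<in> arith_group" and z: "z \<in> disc" and fx: "g z = z" and w: "w \<in> disc"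
  obtain a b where ab: "(a, b) \<in> arith_pairs" "g = su_act a (s3 * b)" using g by (rule arith_groupE)
  have "a = 1" "b = 0" using arith_pair_torsion_free[OF ab(1) z] fx ab(2) by auto
  then show "g w = w" using ab(2) su_act_one by simp
next
  fix K :: "complex set" assume K: "compact K \<and> K \<subseteq> disc"
  obtain \<rho> where "0 < \<rho>" and \<rho>: "\<rho> < 1" "\<And>k. k \<in> K \<Longrightarrow> norm k \<le> \<rho>"
    by (rule compact_subset_disc_bounded[OF conjunct1[OF K] conjunct2[OF K]]) (rule that)
  \<comment> \<open>When \<open>k\<close> and \<open>g k\<close> have norm at most
    \<open>\<rho>\<close>, \<open>su_jac\<close> at \<open>k\<close> is at most
    \<open>1 / sqrt (1 - \<rho>\<^sup>2)\<close> in modulus, and at least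
    \<open>norm a * (1 - \<rho>)\<close>.\<close>
  define R where "R = 1 / (sqrt (1 - \<rho>\<^sup>2) * (1 - \<rho>))"
  have "{g\<in>arith_group. g ` K \<inter> K \<noteq> {}} \<subseteq> (\<lambda>(a, b). su_act a (s3 * b)) ` {(a, b)\<in>arith_pairs. norm a \<le> R}"
  proof
    fix g assume "g \<in> {g\<in>arith_group. g ` K \<inter> K \<noteq> {}}"
    then have g: "g \<in> arith_group" and "g ` K \<inter> K \<noteq> {}" by auto
    then obtain k where k: "k \<in> K" "g k \<in> K" by blast
    obtain a b where ab: "(a, b) \<in> arith_pairs" "g = su_act a (s3 * b)" using g by (rule arith_groupE)
    note n = arith_pairsD(3)[OF ab(1)]
    have kd: "k \<in> disc" using k K by blast
    have r0: "0 \<le> \<rho>" using \<rho>(2)[OF k(1)] norm_ge_zero order_trans by blast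
    have r2: "1 - \<rho>\<^sup>2 > 0" using r0 \<rho>(1) by (simp add: abs_square_less_1)
    define J where "J = norm (su_jac a (s3 * b) k)"
    have J0: "J > 0" using su_jac_nz[OF n kd] by (simp add: J_def)
    have "1 - \<rho>\<^sup>2 \<le> 1 - (norm (g k))\<^sup>2" using \<rho>(2)[OF k(2)] by (simp add: power_mono)
    also have "\<dots> = (1 - (norm k)\<^sup>2) / J\<^sup>2"
      using one_minus_norm_su_act[OF n kd] by (simp add: ab(2) J_def)
    also have "\<dots> \<le> 1 / J\<^sup>2" using J0 by (intro divide_right_mono) auto
    finally have "(1 - \<rho>\<^sup>2) * J\<^sup>2 \<le> 1" using J0 by (simp add: field_simps)
    then have "sqrt ((1 - \<rho>\<^sup>2) * J\<^sup>2) \<le> 1" by simp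
    then have 1: "sqrt (1 - \<rho>\<^sup>2) * J \<le> 1" using J0 by (simp add: real_sqrt_mult)
    have "norm a * (1 - \<rho>) \<le> norm a * (1 - norm k)" using \<rho>(2)[OF k(1)] by (intro mult_left_mono) auto
    also have "\<dots> \<le> J" unfolding J_def by (rule norm_su_jac_ge[OF n])
    finally have "sqrt (1 - \<rho>\<^sup>2) * (norm a * (1 - \<rho>)) \<le> sqrt (1 - \<rho>\<^sup>2) * J"
      using r2 by (intro mult_left_mono) auto
    then have "sqrt (1 - \<rho>\<^sup>2) * (norm a * (1 - \<rho>)) \<le> 1" using 1 by (rule order_trans)
    then have "norm a \<le> R" unfolding R_def using r2 \<rho>(1) by (simp add: field_simps)
    then show "g \<in> (\<lambda>(a, b). su_act a (s3 * b)) ` {(a, b)\<in>arith_pairs. norm a \<le> R}"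
      using ab by (intro image_eqI[of _ _ "(a, b)"]) auto
  qed
  then show "finite {g\<in>arith_group. g ` K \<inter> K \<noteq> {}}"
    using finite_arith_pairs_bounded finite_subset by blast
next
  obtain \<rho> where \<rho>: "0 < \<rho>" "\<rho> < 1" "\<And>z. z \<in> disc \<Longrightarrow> \<exists>g\<in>arith_group. g z \<in> cball 0 \<rho>"
    by (rule arith_cocompact) (rule that)
  then show "\<exists>K. compact K \<and> K \<subseteq> disc \<and> (\<forall>z\<in>disc. \<exists>g\<in>arith_group. g z \<in> K)"
    by (intro exI[of _ "cball 0 \<rho>"]) auto
qed

section \<open>Poincare series and the theorem\<close>

text \<open>The bound carries the telescoping term \<open>2 / (N + 1)\<close> so that the induction
  closes; only the constant 4 is used.\<close>

lemma sum_inverse_squares_le: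
  "(\<Sum>k\<in>{- int N..int N}. 1 / (1 + \<bar>real_of_int k\<bar>)\<^sup>2) \<le> 4 - 2 / (real N + 1)"
proof (induction N)
  case (Suc N)
  let ?f = "\<lambda>k. 1 / (1 + \<bar>real_of_int k\<bar>)\<^sup>2"
  have eq: "{- int (Suc N)..int (Suc N)} = insert (int (Suc N)) (insert (- int (Suc N)) {- int N..int N})"
    by auto
  have "sum ?f {- int (Suc N)..int (Suc N)} = 2 / (real N + 2)\<^sup>2 + sum ?f {- int N..int N}"
    unfolding eq by (simp add: add.commute)
  also have "\<dots> \<le> 2 / (real N + 2)\<^sup>2 + (4 - 2 / (real N + 1))" using Suc.IH by simp
  also have "\<dots> \<le> 4 - 2 / (real (Suc N) + 1)"
  proof -
    have "2 / (real N + 2)\<^sup>2 \<le> 2 / ((real N + 1) * (real N + 2))"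
      by (rule divide_left_mono) (auto simp: power2_eq_square mult_right_mono)
    also have "\<dots> = 2 / (real N + 1) - 2 / (real N + 2)" by (simp add: field_simps)
    finally show ?thesis by (simp add: algebra_simps)
  qed
  finally show ?case .
qed simp

lemma norm_ge_one_plus_gauss:
  assumes "1 \<le> norm a" "\<bar>x\<bar> \<le> norm a"
  shows "1 / (2 * norm a)\<^sup>2 \<le> 1 / (1 + \<bar>x\<bar>)\<^sup>2"
  using assms by (intro divide_left_mono power_mono mult_pos_pos) (auto simp: zero_less_power2)

text \<open>Each of the four integer coordinates of \<open>(a, b)\<close> is at most
  \<open>norm a\<close> in modulus, so two of the eight powers can be spent on each coordinate. The
  factor 256 is \<open>2 ^ 8\<close>, from \<open>1 + \<bar>x\<bar> \<le> 2 * norm a\<close>. What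
  remains is a product of four convergent sums over the integers.\<close>

lemma summable_arith_pairs: "(\<lambda>(a, b). 1 / norm a ^ 8) summable_on arith_pairs"
proof (rule nonneg_bdd_above_summable_on)
  show "bdd_above (sum (\<lambda>(a, b). 1 / norm a ^ 8) ` {F. F \<subseteq> arith_pairs \<and> finite F})"
  proof (rule bdd_aboveI2)
    fix F assume "F \<in> {F. F \<subseteq> arith_pairs \<and> finite F}"
    then have F: "F \<subseteq> arith_pairs" "finite F" by auto
    define f where "f = (\<lambda>k::int. 1 / (1 + \<bar>real_of_int k\<bar>)\<^sup>2)"
    have fpos: "f k \<ge> 0" for k by (simp add: f_def)
    define \<phi> where "\<phi> = (\<lambda>(a, b). (\<lfloor>Re a\<rfloor>, \<lfloor>Im a\<rfloor>, \<lfloor>Re b\<rfloor>, \<lfloor>Im b\<rfloor>))"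
    define g where "g = (\<lambda>(p, q, r, s). f p * (f q * (f r * f s)))"
    have fl: "of_int \<lfloor>x\<rfloor> = x" if "x \<in> \<int>" for x :: real using that by (auto elim!: Ints_cases)
    have fl_inj: "x = y" if "\<lfloor>x\<rfloor> = \<lfloor>y\<rfloor>" "x \<in> \<int>" "y \<in> \<int>" for x y :: real
      using fl[OF that(2)] fl[OF that(3)] that(1) by metis
    have G: "Re a \<in> \<int>" "Im a \<in> \<int>" "Re b \<in> \<int>" "Im b \<in> \<int>" if "(a, b) \<in> arith_pairs" for a b
      using arith_pairsD(1,2)[OF that] by (auto simp: gauss_ints_iff)
    have inj: "inj_on \<phi> F"
    proof (rule inj_onI)
      fix x y assume xy: "x \<in> F" "y \<in> F" "\<phi> x = \<phi> y"
      obtain a b c d where x: "x = (a, b)" and y: "y = (c, d)" by (metis surj_pair)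
      have A: "(a, b) \<in> arith_pairs" "(c, d) \<in> arith_pairs" using xy F x y by auto
      have "\<lfloor>Re a\<rfloor> = \<lfloor>Re c\<rfloor>" "\<lfloor>Im a\<rfloor> = \<lfloor>Im c\<rfloor>" "\<lfloor>Re b\<rfloor> = \<lfloor>Re d\<rfloor>" "\<lfloor>Im b\<rfloor> = \<lfloor>Im d\<rfloor>"
        using xy(3) by (simp_all add: x y \<phi>_def)
      then have "Re a = Re c" "Im a = Im c" "Re b = Re d" "Im b = Im d"
        using fl_inj G[OF A(1)] G[OF A(2)] by blast+
      then show "x = y" by (simp add: x y complex_eq_iff)
    qed
    have term_le: "(case x of (a, b) \<Rightarrow> 1 / norm a ^ 8) \<le> 256 * g (\<phi> x)" if "x \<in> F" for x
    proof -
      obtain a b where x: "x = (a, b)" by (metis surj_pair)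
      have A: "(a, b) \<in> arith_pairs" using that F x by auto
      note n = su_norm[OF arith_pairsD(3)[OF A]]
      have "norm b \<le> norm (s3 * b)" by (simp add: norm_mult mult_le_cancel_right1)
      then have ba: "norm b \<le> norm a" using n(2) by linarith
      have le: "1 / (2 * norm a)\<^sup>2 \<le> f \<lfloor>x\<rfloor>" if "x \<in> \<int>" "\<bar>x\<bar> \<le> norm a" for x
        unfolding f_def fl[OF that(1)] by (rule norm_ge_one_plus_gauss[OF n(3) that(2)])
      have 4: "1 / (2 * norm a)\<^sup>2 \<le> f \<lfloor>Re a\<rfloor>" "1 / (2 * norm a)\<^sup>2 \<le> f \<lfloor>Im a\<rfloor>"
        "1 / (2 * norm a)\<^sup>2 \<le> f \<lfloor>Re b\<rfloor>" "1 / (2 * norm a)\<^sup>2 \<le> f \<lfloor>Im b\<rfloor>"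
        by (rule le[OF G(1)[OF A] abs_Re_le_cmod] le[OF G(2)[OF A] abs_Im_le_cmod]
            le[OF G(3)[OF A] order_trans[OF abs_Re_le_cmod ba]] le[OF G(4)[OF A] order_trans[OF abs_Im_le_cmod ba]])+
      define v where "v = 1 / (2 * norm a)\<^sup>2"
      have v0: "0 \<le> v" by (simp add: v_def)
      have "v * (v * (v * v)) \<le> g (\<phi> x)"
        unfolding g_def \<phi>_def x using 4 v0 fpos unfolding v_def[symmetric]
        by (auto intro!: mult_mono mult_nonneg_nonneg)
      moreover have "1 / norm a ^ 8 = 256 * (v * (v * (v * v)))"
        using n(4) by (simp add: v_def power_mult_distrib divide_simps)
      ultimately show ?thesis by (simp add: x)
    qed
    define \<nu> where "\<nu> = (\<lambda>(p, q, r, s). max (max \<bar>p\<bar> \<bar>q\<bar>) (max \<bar>r\<bar> \<bar>s\<bar>) :: int)"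
    define N where "N = nat (Max (\<nu> ` \<phi> ` F))"
    define I where "I = {- int N..int N}"
    have "\<phi> ` F \<subseteq> I \<times> I \<times> I \<times> I"
    proof
      fix y assume y: "y \<in> \<phi> ` F"
      obtain p q r s where pq: "y = (p, q, r, s)" by (metis prod_cases4)
      have "\<nu> y \<le> Max (\<nu> ` \<phi> ` F)" using F(2) y by (intro Max_ge) auto
      then have "\<nu> y \<le> int N" unfolding N_def by linarith
      then show "y \<in> I \<times> I \<times> I \<times> I" unfolding pq I_def by (auto simp: \<nu>_def)
    qed
    have "sum (\<lambda>(a, b). 1 / norm a ^ 8) F \<le> (\<Sum>x\<in>F. 256 * g (\<phi> x))"
      using term_le by (intro sum_mono) auto
    also have "\<dots> = 256 * sum g (\<phi> ` F)"
      using inj by (simp add: sum.reindex sum_distrib_left)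
    also have "\<dots> \<le> 256 * sum g (I \<times> I \<times> I \<times> I)"
      using \<open>\<phi> ` F \<subseteq> I \<times> I \<times> I \<times> I\<close> fpos
      by (intro mult_left_mono sum_mono2) (auto simp: I_def g_def)
    also have "sum g (I \<times> I \<times> I \<times> I) = sum f I * (sum f I * (sum f I * sum f I))"
      unfolding g_def sum_product sum.cartesian_product by (simp add: case_prod_unfold)
    also have "\<dots> \<le> 4 * (4 * (4 * 4))"
    proof -
      have "sum f I \<le> 4 - 2 / (real N + 1)" unfolding f_def I_def by (rule sum_inverse_squares_le)
      also have "\<dots> \<le> 4" by simp
      finally have "sum f I \<le> 4" .
      moreover have "0 \<le> sum f I" using fpos by (simp add: sum_nonneg)
      ultimately show ?thesis by (intro mult_mono) auto
    qed
    finally show "sum (\<lambda>(a, b). 1 / norm a ^ 8) F \<le> 256 * (4 * (4 * (4 * 4)))" by simp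
  qed
qed auto

text \<open>The sum runs over matrices rather than over maps, since \<open>su_jac\<close> depends on
  the matrix. Opposite matrices do not both occur, because \<open>a\<close> is congruent to 1 modulo
  3.\<close>

definition poincare_series :: "(complex \<Rightarrow> complex) \<Rightarrow> nat \<Rightarrow> complex \<Rightarrow> complex" where
  "poincare_series f k z =
     (\<Sum>\<^sub>\<infinity>(a, b)\<in>arith_pairs. f (su_act a (s3 * b) z) / su_jac a (s3 * b) z ^ k)"

lemma arith_act_in_disc: "(a, b) \<in> arith_pairs \<Longrightarrow> z \<in> disc \<Longrightarrow> su_act a (s3 * b) z \<in> disc"
  using disc_automorphisms_in_disc[OF su_act_automorphism[OF arith_pairsD(3)]] .

lemma poincare_term_le:
  assumes ab: "(a, b) \<in> arith_pairs" and z: "norm z \<le> r" "r < 1" and k: "k \<ge> 8"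
    and f: "\<And>w. w \<in> disc \<Longrightarrow> norm (f w) \<le> 1"
  shows "norm (f (su_act a (s3 * b) z) / su_jac a (s3 * b) z ^ k) \<le> (1 / (1 - r) ^ k) * (1 / norm a ^ 8)"
proof -
  note n = arith_pairsD(3)[OF ab]
  have zd: "z \<in> disc" using z by simp
  have a1: "norm a \<ge> 1" using su_norm(3)[OF n] .
  have "norm a * (1 - r) \<le> norm a * (1 - norm z)" using z by (intro mult_left_mono) auto
  also have "\<dots> \<le> norm (su_jac a (s3 * b) z)" by (rule norm_su_jac_ge[OF n])
  finally have "(norm a * (1 - r)) ^ k \<le> norm (su_jac a (s3 * b) z) ^ k"
    using a1 z by (intro power_mono) auto
  moreover have "norm a ^ 8 * (1 - r) ^ k \<le> (norm a * (1 - r)) ^ k"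
    unfolding power_mult_distrib using a1 z k by (intro mult_right_mono power_increasing) auto
  ultimately have le: "norm a ^ 8 * (1 - r) ^ k \<le> norm (su_jac a (s3 * b) z) ^ k" by linarith
  have pos: "0 < norm a ^ 8 * (1 - r) ^ k" using a1 z by (intro mult_pos_pos zero_less_power) auto
  have "norm (f (su_act a (s3 * b) z) / su_jac a (s3 * b) z ^ k) \<le> 1 / (norm a ^ 8 * (1 - r) ^ k)"
    unfolding norm_divide norm_power using f[OF arith_act_in_disc[OF ab zd]] le pos by (intro frac_le) auto
  then show ?thesis by (simp add: mult.commute)
qed

lemma poincare_series_holomorphic:
  assumes fh: "f holomorphic_on disc" and f: "\<And>w. w \<in> disc \<Longrightarrow> norm (f w) \<le> 1" and k: "k \<ge> 8"
  shows "poincare_series f k holomorphic_on disc"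
proof -
  define T where "T = (\<lambda>(a, b) z. f (su_act a (s3 * b) z) / su_jac a (s3 * b) z ^ k)"
  have Th: "T x holomorphic_on disc" if "x \<in> arith_pairs" for x
  proof -
    obtain a b where x: "x = (a, b)" by (metis surj_pair)
    have ab: "(a, b) \<in> arith_pairs" using that x by simp
    note n = arith_pairsD(3)[OF ab]
    have "(\<lambda>z. f (su_act a (s3 * b) z)) holomorphic_on disc"
      by (rule holomorphic_compose_disc[OF disc_automorphisms_holomorphic[OF su_act_automorphism[OF n]] _ fh])
         (use arith_act_in_disc[OF ab] in blast)
    moreover have "(\<lambda>z. su_jac a (s3 * b) z ^ k) holomorphic_on disc"
      unfolding su_jac_def by (intro holomorphic_intros)
    ultimately show ?thesis
      unfolding T_def x using su_jac_nz[OF n] by (auto intro!: holomorphic_on_divide)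
  qed
  have "poincare_series f k holomorphic_on ball 0 r" if r: "r \<in> {0<..<1}" for r
  proof -
    have sub: "cball 0 r \<subseteq> disc" using r by auto
    have "uniform_limit (cball 0 r) (\<lambda>X z. \<Sum>x\<in>X. T x z) (\<lambda>z. \<Sum>\<^sub>\<infinity>x\<in>arith_pairs. T x z)
        (finite_subsets_at_top arith_pairs)"
    proof (rule Weierstrass_m_test_general)
      show "(\<lambda>x. (1 / (1 - r) ^ k) * (case x of (a, b) \<Rightarrow> 1 / norm a ^ 8)) summable_on arith_pairs"
        using summable_arith_pairs by (rule summable_on_cmult_right)
      show "norm (T x z) \<le> (1 / (1 - r) ^ k) * (case x of (a, b) \<Rightarrow> 1 / norm a ^ 8)"
        if "x \<in> arith_pairs" "z \<in> cball 0 r" for x z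
        using poincare_term_le[of "fst x" "snd x" z r k f] that r k f by (simp add: T_def case_prod_unfold)
    qed
    moreover have "eventually (\<lambda>X. continuous_on (cball 0 r) (\<lambda>z. \<Sum>x\<in>X. T x z) \<and> (\<lambda>z. \<Sum>x\<in>X. T x z) holomorphic_on ball 0 r)
       (finite_subsets_at_top arith_pairs)"
    proof (rule eventually_finite_subsets_at_top_weakI)
      fix X assume X: "finite X" "X \<subseteq> arith_pairs"
      have h: "(\<lambda>z. \<Sum>x\<in>X. T x z) holomorphic_on disc" using Th X by (intro holomorphic_on_sum) auto
      show "continuous_on (cball 0 r) (\<lambda>z. \<Sum>x\<in>X. T x z) \<and> (\<lambda>z. \<Sum>x\<in>X. T x z) holomorphic_on ball 0 r"
        using holomorphic_on_imp_continuous_on[OF holomorphic_on_subset[OF h sub]]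
          holomorphic_on_subset[OF h subset_trans[OF ball_subset_cball sub]] by blast
    qed
    ultimately have "(\<lambda>z. \<Sum>\<^sub>\<infinity>x\<in>arith_pairs. T x z) holomorphic_on ball 0 r"
      using holomorphic_uniform_limit[of 0 r "\<lambda>X z. \<Sum>x\<in>X. T x z"] finite_subsets_at_top_neq_bot by blast
    moreover have "poincare_series f k = (\<lambda>z. \<Sum>\<^sub>\<infinity>x\<in>arith_pairs. T x z)"
      by (simp add: fun_eq_iff poincare_series_def T_def case_prod_unfold)
    ultimately show ?thesis by simp
  qed
  then have "poincare_series f k holomorphic_on (\<Union>r\<in>{0<..<1}. ball 0 r)"
    by (intro holomorphic_on_UN_open) auto
  moreover have "(\<Union>r\<in>{0<..<1::real}. ball 0 r) = disc"
  proof
    show "disc \<subseteq> (\<Union>r\<in>{0<..<1::real}. ball 0 r)"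
    proof
      fix z :: complex assume "z \<in> disc"
      then show "z \<in> (\<Union>r\<in>{0<..<1::real}. ball 0 r)"
        by (intro UN_I[of "(1 + norm z) / 2"]) (auto simp: add_pos_nonneg)
    qed
  qed auto
  ultimately show ?thesis by simp
qed

lemma arith_right_mult_bij:
  assumes cd: "(c, d) \<in> arith_pairs"
  shows "bij_betw (\<lambda>(a, b). (a * c + 3 * (b * cnj d), a * d + b * cnj c)) arith_pairs arith_pairs"
proof -
  have q: "c * cnj c - 3 * (d * cnj d) = 1" using arith_pairsD(4)[OF cd] by (simp add: qnorm_def)
  note i = arith_pairs_inverse[OF cd]
  have 1: "(a * c + 3 * (b * cnj d)) * cnj c + 3 * ((a * d + b * cnj c) * cnj (- d)) = a"
      "(a * c + 3 * (b * cnj d)) * - d + (a * d + b * cnj c) * cnj (cnj c) = b"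
      "(a * cnj c + 3 * (b * cnj (- d))) * c + 3 * ((a * - d + b * cnj (cnj c)) * cnj d) = a"
      "(a * cnj c + 3 * (b * cnj (- d))) * d + (a * - d + b * cnj (cnj c)) * cnj c = b" for a b
  proof -
    have "(a * c + 3 * (b * cnj d)) * cnj c + 3 * ((a * d + b * cnj c) * cnj (- d)) = a * (c * cnj c - 3 * (d * cnj d))"
      "(a * c + 3 * (b * cnj d)) * - d + (a * d + b * cnj c) * cnj (cnj c) = b * (c * cnj c - 3 * (d * cnj d))"
      "(a * cnj c + 3 * (b * cnj (- d))) * c + 3 * ((a * - d + b * cnj (cnj c)) * cnj d) = a * (c * cnj c - 3 * (d * cnj d))"
      "(a * cnj c + 3 * (b * cnj (- d))) * d + (a * - d + b * cnj (cnj c)) * cnj c = b * (c * cnj c - 3 * (d * cnj d))"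
      by (simp_all add: algebra_simps)
    then show "(a * c + 3 * (b * cnj d)) * cnj c + 3 * ((a * d + b * cnj c) * cnj (- d)) = a"
      "(a * c + 3 * (b * cnj d)) * - d + (a * d + b * cnj c) * cnj (cnj c) = b"
      "(a * cnj c + 3 * (b * cnj (- d))) * c + 3 * ((a * - d + b * cnj (cnj c)) * cnj d) = a"
      "(a * cnj c + 3 * (b * cnj (- d))) * d + (a * - d + b * cnj (cnj c)) * cnj c = b"
      unfolding q by simp_all
  qed
  show ?thesis
  proof (rule bij_betw_byWitness[where f' = "\<lambda>(a, b). (a * cnj c + 3 * (b * cnj (- d)), a * - d + b * cnj (cnj c))"])
    show "(\<lambda>(a, b). (a * c + 3 * (b * cnj d), a * d + b * cnj c)) ` arith_pairs \<subseteq> arith_pairs"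
      using arith_pairs_mult[OF _ cd] by auto
    show "(\<lambda>(a, b). (a * cnj c + 3 * (b * cnj (- d)), a * - d + b * cnj (cnj c))) ` arith_pairs \<subseteq> arith_pairs"
      using arith_pairs_mult[OF _ i] by auto
    show "\<forall>x\<in>arith_pairs. (\<lambda>(a, b). (a * cnj c + 3 * (b * cnj (- d)), a * - d + b * cnj (cnj c)))
        ((\<lambda>(a, b). (a * c + 3 * (b * cnj d), a * d + b * cnj c)) x) = x"
      unfolding case_prod_unfold fst_conv snd_conv 1 by simp
    show "\<forall>x\<in>arith_pairs. (\<lambda>(a, b). (a * c + 3 * (b * cnj d), a * d + b * cnj c))
        ((\<lambda>(a, b). (a * cnj c + 3 * (b * cnj (- d)), a * - d + b * cnj (cnj c))) x) = x"
      unfolding case_prod_unfold fst_conv snd_conv 1 by simp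
  qed
qed

lemma poincare_series_automorphic:
  assumes cd: "(c, d) \<in> arith_pairs" and z: "z \<in> disc"
  shows "poincare_series f k (su_act c (s3 * d) z) = su_jac c (s3 * d) z ^ k * poincare_series f k z"
proof -
  define T where "T = (\<lambda>(a, b) z. f (su_act a (s3 * b) z) / su_jac a (s3 * b) z ^ k)"
  define \<mu> where "\<mu> = (\<lambda>(a, b). (a * c + 3 * (b * cnj d), a * d + b * cnj c))"
  have j: "su_jac c (s3 * d) z \<noteq> 0" using su_jac_nz[OF arith_pairsD(3)[OF cd] z] .
  have T: "T x (su_act c (s3 * d) z) = su_jac c (s3 * d) z ^ k * T (\<mu> x) z" if "x \<in> arith_pairs" for x
  proof -
    obtain a b where x: "x = (a, b)" by (metis surj_pair)
    have ab: "(a, b) \<in> arith_pairs" using that x by simp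
    show ?thesis
      unfolding x T_def \<mu>_def case_prod_conv arith_act_compose[OF ab cd z] using j
      by (simp add: power_mult_distrib)
  qed
  have "poincare_series f k (su_act c (s3 * d) z) = (\<Sum>\<^sub>\<infinity>x\<in>arith_pairs. T x (su_act c (s3 * d) z))"
    by (simp add: poincare_series_def T_def case_prod_unfold)
  also have "\<dots> = (\<Sum>\<^sub>\<infinity>x\<in>arith_pairs. su_jac c (s3 * d) z ^ k * T (\<mu> x) z)"
    using T by (rule infsum_cong)
  also have "\<dots> = su_jac c (s3 * d) z ^ k * (\<Sum>\<^sub>\<infinity>x\<in>arith_pairs. T (\<mu> x) z)"
    by (rule infsum_cmult_right')
  also have "(\<Sum>\<^sub>\<infinity>x\<in>arith_pairs. T (\<mu> x) z) = (\<Sum>\<^sub>\<infinity>x\<in>arith_pairs. T x z)"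
    unfolding \<mu>_def by (rule infsum_reindex_bij_betw[OF arith_right_mult_bij[OF cd]])
  also have "\<dots> = poincare_series f k z"
    by (simp add: poincare_series_def T_def case_prod_unfold)
  finally show ?thesis .
qed

text \<open>If \<open>b = 0\<close> the map fixes 0 and is the identity. Otherwise
  \<open>norm b \<ge> 1\<close>, and the norm equation gives
  \<open>(norm a)\<^sup>2 \<ge> 1 + 3\<close>.\<close>

lemma arith_pair_norm_ge_2:
  assumes ab: "(a, b) \<in> arith_pairs" "(a, b) \<noteq> (1, 0)"
  shows "norm a \<ge> 2"
proof -
  note 1 = arith_pairsD[OF ab(1)]
  have b0: "b \<noteq> 0"
  proof
    assume "b = 0"
    then have "su_act a (s3 * b) 0 = 0" by (simp add: su_act_def)
    then show False using arith_pair_torsion_free[OF ab(1), of 0] ab(2) by simp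
  qed
  obtain r s where rs: "b = gauss_int r s" using 1(2) by (auto simp: gauss_ints_def)
  have "r\<^sup>2 + s\<^sup>2 > 0" using b0 rs by (auto simp: sum_power2_gt_zero_iff gauss_int_def complex_eq_iff)
  then have "real_of_int (r\<^sup>2 + s\<^sup>2) \<ge> 1" by linarith
  then have nb: "(norm b)\<^sup>2 \<ge> 1" unfolding rs cmod_power2 by (simp add: gauss_int_def)
  have "(norm a)\<^sup>2 - (norm (s3 * b))\<^sup>2 = 1" using su_norm(1)[OF 1(3)] .
  then have "(norm a)\<^sup>2 = 1 + 3 * (norm b)\<^sup>2" by (simp add: norm_mult power_mult_distrib)
  then have "2\<^sup>2 \<le> (norm a)\<^sup>2" using nb by simp
  then show ?thesis by (rule power2_le_imp_le) simp
qed

text \<open>All pairs but the identity have \<open>norm a \<ge> 2\<close>, so the identity term dominates for large weight.\<close>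

lemma poincare_series_near_0:
  assumes "\<epsilon> > (0::real)"
  obtains l where "l \<ge> 2" "\<And>f z. \<lbrakk>\<forall>w\<in>disc. norm (f w) \<le> 1; norm z \<le> 1/10\<rbrakk> \<Longrightarrow>
     norm (poincare_series f (4 * l) z - f z) \<le> \<epsilon>"
proof -
  define S where "S = (\<Sum>\<^sub>\<infinity>(a, b)\<in>arith_pairs. 1 / norm a ^ 8)"
  \<comment> \<open>For \<open>norm z \<le> 1/10\<close> the denominators of the other terms are at
    least \<open>9/10 * norm a \<ge> 9/5\<close>. Eight powers are reserved for convergence, at the
    cost of the constant \<open>A\<close>; the remaining ones give the decay
    \<open>(5/9) ^ (k - 8)\<close>.\<close>
  define A where "A = (10/9 :: real) ^ 8"
  have lim: "(\<lambda>n. (5/9 :: real) ^ n * (A * S)) \<longlonglongrightarrow> 0 * (A * S)"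
    by (intro tendsto_mult_right LIMSEQ_power_zero) auto
  then have "eventually (\<lambda>n. (5/9 :: real) ^ n * (A * S) < \<epsilon>) sequentially"
    using assms by (intro order_tendstoD(2)) auto
  then obtain n0 where n0: "\<And>n. n \<ge> n0 \<Longrightarrow> (5/9 :: real) ^ n * (A * S) < \<epsilon>"
    unfolding eventually_sequentially by blast
  define l where "l = n0 + 2"
  have k: "4 * l \<ge> 8" "4 * l - 8 \<ge> n0" by (auto simp: l_def)
  show ?thesis
  proof (rule that[of l])
    show "l \<ge> 2" by (simp add: l_def)
    fix f :: "complex \<Rightarrow> complex" and z :: complex
    assume f: "\<forall>w\<in>disc. norm (f w) \<le> 1" and z: "norm z \<le> 1/10"
    define k where "k = 4 * l"
    have k8: "k \<ge> 8" and kn: "k - 8 \<ge> n0" using k by (auto simp: k_def)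
    have zd: "z \<in> disc" using z by simp
    define T where "T = (\<lambda>(a, b). f (su_act a (s3 * b) z) / su_jac a (s3 * b) z ^ k)"
    define u where "u = (\<lambda>(a::complex, b::complex). 1 / norm a ^ 8)"
    have us: "u summable_on arith_pairs" unfolding u_def by (rule summable_arith_pairs)
    have "(\<lambda>x. norm (T x)) summable_on arith_pairs"
    proof (rule summable_on_comparison_test)
      show "(\<lambda>x. (1 / (1 - 1/10) ^ k) * u x) summable_on arith_pairs"
        using us by (rule summable_on_cmult_right)
      show "norm (T x) \<le> (1 / (1 - 1/10) ^ k) * u x" if "x \<in> arith_pairs" for x
        using poincare_term_le[of "fst x" "snd x" z "1/10" k f] that z f k8
        by (simp add: T_def u_def case_prod_unfold)
    qed auto
    then have Ts: "T summable_on arith_pairs" by (rule abs_summable_summable)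
    define A' where "A' = arith_pairs - {(1, 0)}"
    have eq: "arith_pairs = {(1, 0)} \<union> A'" using arith_pairs_one by (auto simp: A'_def)
    have Ts': "T summable_on A'" using summable_on_subset_banach[OF Ts] by (simp add: A'_def)
    have us': "u summable_on A'" using summable_on_subset_banach[OF us] by (simp add: A'_def)
    have "infsum T arith_pairs = infsum T {(1, 0)} + infsum T A'"
      unfolding eq using Ts' by (intro infsum_Un_disjoint) (auto simp: A'_def)
    moreover have "infsum T {(1, 0)} = f z"
      by (simp add: T_def su_act_def su_jac_def)
    ultimately have diff: "poincare_series f k z - f z = infsum T A'"
      by (simp add: poincare_series_def T_def case_prod_unfold)
    have "norm (infsum T A') \<le> ((5/9) ^ (k - 8) * A) * infsum u A'"
    proof (rule norm_infsum_le)
      show "(T has_sum infsum T A') A'" using Ts' by (rule has_sum_infsum)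
      show "((\<lambda>x. ((5/9) ^ (k - 8) * A) * u x) has_sum ((5/9) ^ (k - 8) * A) * infsum u A') A'"
        using us' by (intro has_sum_cmult_right has_sum_infsum)
      fix x assume x: "x \<in> A'"
      obtain a b where ab': "x = (a, b)" by (metis surj_pair)
      have ab: "(a, b) \<in> arith_pairs" "(a, b) \<noteq> (1, 0)" using x ab' by (auto simp: A'_def)
      have a2: "norm a \<ge> 2" using arith_pair_norm_ge_2[OF ab] .
      define t where "t = 9/10 * norm a"
      have t: "t \<ge> 9/5" using a2 by (simp add: t_def)
      have "norm a * (9/10) \<le> norm a * (1 - norm z)" using z by (intro mult_left_mono) auto
      also have "\<dots> \<le> norm (su_jac a (s3 * b) z)" by (rule norm_su_jac_ge[OF arith_pairsD(3)[OF ab(1)]])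
      finally have "t \<le> norm (su_jac a (s3 * b) z)" by (simp add: t_def)
      then have tk: "t ^ k \<le> norm (su_jac a (s3 * b) z) ^ k" using t by (intro power_mono) auto
      have "norm (T x) \<le> 1 / t ^ k"
        unfolding T_def ab' case_prod_conv norm_divide norm_power
        using f arith_act_in_disc[OF ab(1) zd] tk t by (intro frac_le zero_less_power) auto
      also have "t ^ k = t ^ (k - 8) * t ^ 8" using k8 by (simp flip: power_add)
      also have "1 / (t ^ (k - 8) * t ^ 8) \<le> 1 / ((9/5) ^ (k - 8) * t ^ 8)"
        using t by (intro divide_left_mono mult_right_mono power_mono mult_pos_pos zero_less_power) auto
      also have "\<dots> = ((5/9) ^ (k - 8) * A) * u x"
        by (simp add: t_def A_def u_def ab' power_mult_distrib power_divide)
      finally show "norm (T x) \<le> ((5/9) ^ (k - 8) * A) * u x" .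
    qed
    also have "\<dots> \<le> ((5/9) ^ (k - 8) * A) * S"
    proof (rule mult_left_mono)
      show "infsum u A' \<le> S"
        unfolding S_def u_def[symmetric] using us us'
        by (intro infsum_mono_neutral) (auto simp: A'_def u_def)
    qed (auto simp: A_def)
    also have "\<dots> \<le> \<epsilon>" using n0[OF kn] by (simp add: mult.assoc)
    finally show "norm (poincare_series f (4 * l) z - f z) \<le> \<epsilon>" using diff by (simp add: k_def)
  qed
qed

text \<open>The series with seeds \<open>w\<close> and 1 are within 1/100 of \<open>z\<close> and 1
  near 0. Comparing 0 with 1/10, the first product is at most 0.0101 and the second at least 0.0891
  in modulus.\<close>

lemma poincare_quotient_not_constant:
  obtains l P Q where "P holomorphic_on disc" "Q holomorphic_on disc" "Q 0 \<noteq> 0"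
    "\<And>c d z. \<lbrakk>(c, d) \<in> arith_pairs; z \<in> disc\<rbrakk> \<Longrightarrow> P (su_act c (s3 * d) z) = su_jac c (s3 * d) z ^ (4 * l) * P z"
    "\<And>c d z. \<lbrakk>(c, d) \<in> arith_pairs; z \<in> disc\<rbrakk> \<Longrightarrow> Q (su_act c (s3 * d) z) = su_jac c (s3 * d) z ^ (4 * l) * Q z"
    "\<exists>z\<in>disc. P 0 * Q z \<noteq> P z * Q 0"
proof -
  obtain l where l: "l \<ge> 2" "\<And>f z. \<lbrakk>\<forall>w\<in>disc. norm (f w) \<le> 1; norm z \<le> 1/10\<rbrakk> \<Longrightarrow>
     norm (poincare_series f (4 * l) z - f z) \<le> 1/100"
    by (rule poincare_series_near_0[of "1/100"]) (simp, rule that)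
  define P where "P = poincare_series (\<lambda>w. w) (4 * l)"
  define Q where "Q = poincare_series (\<lambda>_. 1) (4 * l)"
  have k: "4 * l \<ge> 8" using l(1) by simp
  define y :: complex where "y = 1/10"
  have e: "norm (P 0 - 0) \<le> 1/100" "norm (P y - y) \<le> 1/100" "norm (Q 0 - 1) \<le> 1/100" "norm (Q y - 1) \<le> 1/100"
    unfolding P_def Q_def by (rule l(2); simp add: y_def less_imp_le)+
  have Q0: "norm (Q 0) \<ge> 99/100" "norm (Q y) \<le> 101/100"
    using norm_triangle_ineq2[of 1 "Q 0"] norm_triangle_ineq2[of "Q y" 1] e(3,4)
    by (auto simp: norm_minus_commute)
  have Py: "norm (P y) \<ge> 9/100"
    using norm_triangle_ineq2[of y "P y"] e(2) by (auto simp: norm_minus_commute y_def)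
  have "norm (P 0 * Q y) \<le> 1/100 * (101/100)"
    unfolding norm_mult using e(1) Q0(2) by (intro mult_mono) auto
  moreover have "9/100 * (99/100) \<le> norm (P y * Q 0)"
    unfolding norm_mult using Py Q0(1) by (intro mult_mono) auto
  ultimately have "P 0 * Q y \<noteq> P y * Q 0" by auto
  moreover have "y \<in> disc" by (simp add: y_def)
  ultimately have ex: "\<exists>z\<in>disc. P 0 * Q z \<noteq> P z * Q 0" by blast
  have Qnz: "Q 0 \<noteq> 0" using Q0(1) by auto
  show ?thesis
  proof (rule that[OF _ _ Qnz _ _ ex])
    show "P holomorphic_on disc" unfolding P_def
      by (rule poincare_series_holomorphic[OF holomorphic_on_ident _ k]) simp
    show "Q holomorphic_on disc" unfolding Q_def
      by (rule poincare_series_holomorphic[OF holomorphic_on_const _ k]) simp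
    show "P (su_act c (s3 * d) z) = su_jac c (s3 * d) z ^ (4 * l) * P z" if "(c, d) \<in> arith_pairs" "z \<in> disc" for c d z
      unfolding P_def by (rule poincare_series_automorphic[OF that])
    show "Q (su_act c (s3 * d) z) = su_jac c (s3 * d) z ^ (4 * l) * Q z" if "(c, d) \<in> arith_pairs" "z \<in> disc" for c d z
      unfolding Q_def by (rule poincare_series_automorphic[OF that])
  qed
qed

text \<open>The expression is the numerator of the derivative of \<open>P / Q\<close>. Where it does
  not vanish, the form \<open>P - c Q\<close> that vanishes there has a simple zero.\<close>

lemma wronskian_not_zero:
  assumes P: "P holomorphic_on disc" and Q: "Q holomorphic_on disc" and Q0: "Q 0 \<noteq> 0"
    and ex: "\<exists>z\<in>disc. P 0 * Q z \<noteq> P z * Q 0"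
  shows "\<exists>w\<in>disc. deriv P w * Q w - P w * deriv Q w \<noteq> 0"
proof (rule ccontr)
  assume "\<not> ?thesis"
  then have W: "deriv P w * Q w - P w * deriv Q w = 0" if "w \<in> disc" for w using that by blast
  define U where "U = {z\<in>disc. Q z \<in> - {0}}"
  have "open U" unfolding U_def by (rule open_holomorphic_preimage[OF Q]) (auto simp: open_Compl)
  moreover have "0 \<in> U" using Q0 by (simp add: U_def)
  ultimately obtain e where e: "e > 0" "ball 0 e \<subseteq> U" using open_contains_ball by blast
  have sub: "ball 0 e \<subseteq> disc" and Qnz: "\<And>z. z \<in> ball 0 e \<Longrightarrow> Q z \<noteq> 0" using e(2) unfolding U_def by blast+
  have "((\<lambda>z. P z / Q z) has_field_derivative 0) (at z within ball 0 e)" if "z \<in> ball 0 e" for z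
  proof -
    have zd: "z \<in> disc" using that sub by blast
    have "((\<lambda>z. P z / Q z) has_field_derivative (deriv P z * Q z - P z * deriv Q z) / (Q z * Q z)) (at z)"
      by (rule DERIV_divide[OF holomorphic_derivI[OF P open_ball zd] holomorphic_derivI[OF Q open_ball zd] Qnz[OF that]])
    then show ?thesis using W[OF zd] by (simp add: has_field_derivative_at_within)
  qed
  then have "\<exists>c. \<forall>z\<in>ball 0 e. P z / Q z = c"
    by (rule has_field_derivative_zero_constant[OF convex_ball])
  then obtain c where c: "\<And>z. z \<in> ball 0 e \<Longrightarrow> P z / Q z = c" by blast
  have eq: "P z = c * Q z" if "z \<in> ball 0 e" for z using c[OF that] Qnz[OF that] by (simp add: field_simps)
  have cQ: "(\<lambda>z. c * Q z) holomorphic_on disc" by (intro holomorphic_intros Q)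
  have ne: "ball 0 e \<noteq> {}" using e(1) by simp
  have "P z = c * Q z" if "z \<in> disc" for z
    by (rule analytic_continuation_open[OF open_ball open_ball ne connected_ball sub P cQ eq that])
  then have "P 0 * Q z = P z * Q 0" if "z \<in> disc" for z using that by (simp add: mult_ac)
  then show False using ex by blast
qed

text \<open>Products of the forms \<open>P - c Q\<close>, where \<open>c\<close> runs through the values of \<open>P / Q\<close> at generic points,
  have simple zeros at these points.\<close>

lemma automorphic_form_dense_zeros:
  assumes \<delta>: "\<delta> > 0" and \<rho>: "0 < \<rho>" "\<rho> < 1"
  obtains m n where "m holomorphic_on disc" "m 0 \<noteq> 0"
    "\<And>h z. \<lbrakk>h \<in> arith_group; z \<in> disc\<rbrakk> \<Longrightarrow> m (h z) * deriv h z ^ (2 * n) = m z"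
    "\<And>x. x \<in> cball 0 \<rho> \<Longrightarrow> \<exists>b\<in>disc. zorder m b = 1 \<and> dist x b < \<delta>"
proof -
  obtain l P Q where P: "P holomorphic_on disc" and Q: "Q holomorphic_on disc" and Q0: "Q 0 \<noteq> 0"
    and Pa: "\<And>c d z. \<lbrakk>(c, d) \<in> arith_pairs; z \<in> disc\<rbrakk> \<Longrightarrow> P (su_act c (s3 * d) z) = su_jac c (s3 * d) z ^ (4 * l) * P z"
    and Qa: "\<And>c d z. \<lbrakk>(c, d) \<in> arith_pairs; z \<in> disc\<rbrakk> \<Longrightarrow> Q (su_act c (s3 * d) z) = su_jac c (s3 * d) z ^ (4 * l) * Q z"
    and ex: "\<exists>z\<in>disc. P 0 * Q z \<noteq> P z * Q 0"
    by (rule poincare_quotient_not_constant) (rule that)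
  define W where "W = (\<lambda>w. deriv P w * Q w - P w * deriv Q w)"
  define R where "R = (\<lambda>w. P 0 * Q w - P w * Q 0)"
  have Wh: "W holomorphic_on disc" unfolding W_def
    by (intro holomorphic_intros P Q holomorphic_deriv open_ball)
  have Rh: "R holomorphic_on disc" unfolding R_def by (intro holomorphic_intros P Q)
  obtain w0 where w0: "w0 \<in> disc" "W w0 \<noteq> 0" using wronskian_not_zero[OF P Q Q0 ex] unfolding W_def by blast
  obtain r0 where r0: "r0 \<in> disc" "R r0 \<noteq> 0" using ex unfolding R_def by auto
  \<comment> \<open>The three conditions make the zero at \<open>w\<close> simple, the value
    \<open>c = P w / Q w\<close> finite, and \<open>P - c Q\<close> nonzero at 0.\<close>
  have generic: "\<exists>w\<in>disc. dist x w < \<delta>/2 \<and> W w \<noteq> 0 \<and> Q w \<noteq> 0 \<and> R w \<noteq> 0" if x: "x \<in> disc" for x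
  proof -
    have zd: "(0::complex) \<in> disc" by simp
    have "eventually (\<lambda>w. w \<in> ball x (\<delta>/2)) (at x)" using \<delta> by (intro eventually_at_in_open') auto
    moreover have "eventually (\<lambda>w. w \<in> disc) (at x)" using x by (intro eventually_at_in_open') auto
    moreover note eventually_nonzero_disc[OF Wh w0 x] eventually_nonzero_disc[OF Q zd Q0 x]
      eventually_nonzero_disc[OF Rh r0 x]
    ultimately have "eventually (\<lambda>w. w \<in> disc \<and> dist x w < \<delta>/2 \<and> W w \<noteq> 0 \<and> Q w \<noteq> 0 \<and> R w \<noteq> 0) (at x)"
      by eventually_elim auto
    then have "\<exists>w. w \<in> disc \<and> dist x w < \<delta>/2 \<and> W w \<noteq> 0 \<and> Q w \<noteq> 0 \<and> R w \<noteq> 0"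
      by (rule eventually_happens'[OF at_neq_bot])
    then show ?thesis by blast
  qed
  then have "\<forall>x\<in>disc. \<exists>w. w \<in> disc \<and> dist x w < \<delta>/2 \<and> W w \<noteq> 0 \<and> Q w \<noteq> 0 \<and> R w \<noteq> 0" by blast
  from bchoice[OF this] obtain w where
    w: "\<And>x. x \<in> disc \<Longrightarrow> w x \<in> disc \<and> dist x (w x) < \<delta>/2 \<and> W (w x) \<noteq> 0 \<and> Q (w x) \<noteq> 0 \<and> R (w x) \<noteq> 0"
    by blast
  have "cball (0::complex) \<rho> \<subseteq> (\<Union>x\<in>cball 0 \<rho>. ball x (\<delta>/2))" using \<delta> by auto
  then obtain X where X: "X \<subseteq> cball (0::complex) \<rho>" "finite X" "cball 0 \<rho> \<subseteq> (\<Union>x\<in>X. ball x (\<delta>/2))"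
    by (rule compactE_image[OF compact_cball open_ball])
  have Xd: "x \<in> disc" if "x \<in> X" for x using X(1) \<rho> that by auto
  \<comment> \<open>A set of values, so that a value attained at several chosen points contributes a
    single factor and the zeros stay simple.\<close>
  define C where "C = (\<lambda>x. P (w x) / Q (w x)) ` X"
  have finC: "finite C" using X(2) by (simp add: C_def)
  define q where "q = (\<lambda>c z. P z - c * Q z)"
  have qh: "q c holomorphic_on disc" for c unfolding q_def by (intro holomorphic_intros P Q)
  define m where "m = (\<lambda>z. \<Prod>c\<in>C. q c z)"
  have mh: "m holomorphic_on disc" unfolding m_def by (intro holomorphic_on_prod qh)
  have m0: "m 0 \<noteq> 0"
  proof -
    have "q c 0 \<noteq> 0" if c: "c \<in> C" for c
    proof -
      obtain x where x: "x \<in> X" "c = P (w x) / Q (w x)" using c by (auto simp: C_def)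
      have "q c 0 * Q (w x) = R (w x)" using w[OF Xd[OF x(1)]] by (simp add: q_def R_def x(2) field_simps)
      then show ?thesis using w[OF Xd[OF x(1)]] by auto
    qed
    then show ?thesis unfolding m_def using finC by simp
  qed
  have aut: "m (h z) * deriv h z ^ (2 * (l * card C)) = m z" if h: "h \<in> arith_group" and z: "z \<in> disc" for h z
  proof -
    obtain c d where cd: "(c, d) \<in> arith_pairs" "h = su_act c (s3 * d)" using h by (rule arith_groupE)
    define J where "J = su_jac c (s3 * d) z"
    have J: "J \<noteq> 0" using su_jac_nz[OF arith_pairsD(3)[OF cd(1)] z] by (simp add: J_def)
    have "q e (h z) = J ^ (4 * l) * q e z" for e
      unfolding q_def cd(2) Pa[OF cd(1) z] Qa[OF cd(1) z] J_def by (simp add: algebra_simps)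
    then have "m (h z) = (J ^ (4 * l)) ^ card C * m z" unfolding m_def by (simp add: prod.distrib)
    moreover have "deriv h z = 1 / J\<^sup>2"
      unfolding cd(2) J_def by (rule deriv_su_act[OF arith_pairsD(3)[OF cd(1)] z])
    \<comment> \<open>As \<open>deriv h z\<close> is \<open>1 / J\<^sup>2\<close>, weights divisible
      by 4 correspond to even powers of the derivative. This is the form \<open>2 * n\<close> that
      the square root of \<open>m\<close> requires.\<close>
    moreover have "(J ^ (4 * l)) ^ card C = J\<^sup>2 ^ (2 * (l * card C))"
      by (simp flip: power_mult) (simp add: mult_ac)
    ultimately show ?thesis using J by (simp add: power_divide)
  qed
  have dense: "\<exists>b\<in>disc. zorder m b = 1 \<and> dist y b < \<delta>" if y: "y \<in> cball 0 \<rho>" for y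
  proof -
    obtain x where x: "x \<in> X" "y \<in> ball x (\<delta>/2)" using X(3) y by blast
    note wx = w[OF Xd[OF x(1)]]
    define b where "b = w x"
    define c where "c = P b / Q b"
    have bd: "b \<in> disc" and Qb: "Q b \<noteq> 0" and Wb: "W b \<noteq> 0" using wx by (auto simp: b_def)
    have cC: "c \<in> C" using x(1) by (auto simp: C_def c_def b_def)
    have "dist y b \<le> dist x y + dist x b" by (metis dist_commute dist_triangle)
    then have db: "dist y b < \<delta>" using wx x(2) by (simp add: b_def)
    have qb: "q c b = 0" using Qb by (simp add: q_def c_def)
    have mb: "m b = 0" unfolding m_def using finC cC qb by (auto intro!: prod_zero)
    define M where "M = (\<lambda>z. \<Prod>e\<in>C - {c}. q e z)"
    have Mh: "M holomorphic_on disc" unfolding M_def by (intro holomorphic_on_prod qh)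
    have meq: "m z = q c z * M z" for z unfolding m_def M_def by (rule prod.remove[OF finC cC])
    have "q e b \<noteq> 0" if "e \<in> C - {c}" for e
    proof -
      have "q e b = (c - e) * Q b" using Qb by (simp add: q_def c_def algebra_simps)
      then show ?thesis using that Qb by auto
    qed
    then have Mb: "M b \<noteq> 0" unfolding M_def using finC by simp
    have dq: "deriv (q c) b = deriv P b - c * deriv Q b"
      unfolding q_def using holomorphic_derivI[OF P open_ball bd] holomorphic_derivI[OF Q open_ball bd]
      by (intro DERIV_imp_deriv) (auto intro!: derivative_eq_intros)
    then have "deriv (q c) b * Q b = W b" using Qb by (simp add: W_def c_def field_simps)
    then have dq0: "deriv (q c) b \<noteq> 0" using Wb by auto
    have "((\<lambda>z. q c z * M z) has_field_derivative q c b * deriv M b + deriv (q c) b * M b) (at b)"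
      by (rule DERIV_mult'[OF holomorphic_derivI[OF qh open_ball bd] holomorphic_derivI[OF Mh open_ball bd]])
    then have "(m has_field_derivative deriv (q c) b * M b) (at b)"
      using qb unfolding meq[abs_def] by simp
    then have "deriv m b = deriv (q c) b * M b" by (rule DERIV_imp_deriv)
    then have "deriv m b \<noteq> 0" using dq0 Mb by simp
    then have "zorder m b = 1" using zorder_simple_zero[OF mh open_ball bd mb] by blast
    then show ?thesis using bd db by blast
  qed
  show ?thesis by (rule that[OF mh m0 aut dense])
qed

text \<open>\<open>\<rho>\<close> belongs to \<open>arith_group\<close> and is chosen independently
  of \<open>\<delta>\<close>; only \<open>m\<close>, and with it \<open>B\<close>, \<open>F\<close>
  and the source group, change with \<open>\<delta>\<close>. Since \<open>m 0 \<noteq> 0\<close>, a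
  disc about 0 avoids \<open>B\<close>, as the construction of \<open>F\<close> demands.\<close>

lemma double_cover_with_small_ratio:
  assumes \<delta>: "\<delta> > 0" and \<rho>: "0 < \<rho>" "\<rho> < 1" "\<And>z. z \<in> disc \<Longrightarrow> \<exists>h\<in>arith_group. h z \<in> cball 0 \<rho>"
  shows "\<exists>\<Gamma>S F. surface_group \<Gamma>S \<and> branched_double_cover \<Gamma>S arith_group F \<and>
    0 \<le> sup_ratio F \<and> sup_ratio F \<le> 64 * \<delta> / (1 - \<rho>\<^sup>2)\<^sup>2"
proof -
  obtain m n where m: "m holomorphic_on disc" "m 0 \<noteq> 0"
    "\<And>h z. \<lbrakk>h \<in> arith_group; z \<in> disc\<rbrakk> \<Longrightarrow> m (h z) * deriv h z ^ (2 * n) = m z"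
    "\<And>x. x \<in> cball 0 \<rho> \<Longrightarrow> \<exists>b\<in>disc. zorder m b = 1 \<and> dist x b < \<delta>"
    by (rule automorphic_form_dense_zeros[OF \<delta> \<rho>(1,2)]) (rule that)
  define B where "B = {z\<in>disc. odd (zorder m z)}"
  have dense: "\<exists>b\<in>B. dist x b < \<delta>" if x: "x \<in> cball 0 \<rho>" for x
  proof -
    obtain b where "b \<in> disc" "zorder m b = 1" "dist x b < \<delta>" using m(4)[OF x] by blast
    then show ?thesis unfolding B_def by (intro bexI[of _ b]) auto
  qed
  have Bne: "B \<noteq> {}" using dense[of 0] \<rho>(1) by auto
  have zd: "(0::complex) \<in> disc" by simp
  have "eventually (\<lambda>w. m w \<noteq> 0) (nhds 0)"
    using eventually_nonzero_disc[OF m(1) zd m(2) zd] m(2) by (simp add: eventually_nhds_conv_at)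
  then obtain e where e: "e > 0" "\<And>w. dist w 0 < e \<Longrightarrow> m w \<noteq> 0"
    unfolding eventually_nhds_metric by blast
  have "ball 0 e \<inter> B = {}"
  proof -
    have "x \<notin> B" if "x \<in> ball 0 e" for x
    proof
      assume xB: "x \<in> B"
      have "m x \<noteq> 0" using e(2)[of x] that by (simp add: dist_commute)
      then have "zorder m x = 0" using xB unfolding B_def by (intro zorder_eq_0I analytic_at_disc[OF m(1)]) auto
      then show False using xB unfolding B_def by simp
    qed
    then show ?thesis by blast
  qed
  then obtain F where F: "orbifold_map B F" "lifts_orbifold_maps B F"
    by (rule universal_orbifold_cover_exists[OF e(1)])
  interpret branched_orbifold_cover arith_group m F n B
    by unfold_locales (use arith_group_surface_group m F Bne in \<open>auto simp: B_def simp del: mem_ball\<close>)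
  have le: "metric_ratio F z \<le> 64 * \<delta> / (1 - \<rho>\<^sup>2)\<^sup>2" if "z \<in> disc" for z
    by (rule metric_ratio_le[OF \<rho> dense that])
  have "sup_ratio F \<le> 64 * \<delta> / (1 - \<rho>\<^sup>2)\<^sup>2"
    unfolding sup_ratio_def by (rule cSUP_least) (use le in auto)
  moreover have "0 \<le> sup_ratio F"
  proof -
    have "0 \<le> metric_ratio F 0" by (simp add: metric_ratio_def)
    also have "\<dots> \<le> sup_ratio F"
      unfolding sup_ratio_def by (rule cSUP_upper[OF zd]) (use le in \<open>auto intro!: bdd_aboveI2 simp del: mem_ball\<close>)
    finally show ?thesis .
  qed
  ultimately show ?thesis using S_surface_group S_branched_double_cover by blast
qed

theorem theorem2:
  shows "\<exists>(\<Gamma>S :: nat \<Rightarrow> (complex \<Rightarrow> complex) set) (\<Gamma>T :: nat \<Rightarrow> (complex \<Rightarrow> complex) set)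
           (F :: nat \<Rightarrow> complex \<Rightarrow> complex).
           (\<forall>i. surface_group (\<Gamma>S i) \<and> surface_group (\<Gamma>T i) \<and>
                branched_double_cover (\<Gamma>S i) (\<Gamma>T i) (F i)) \<and>
           (\<lambda>i. sup_ratio (F i)) \<longlonglongrightarrow> 0"
proof -
  obtain \<rho> where \<rho>: "0 < \<rho>" "\<rho> < 1" "\<And>z. z \<in> disc \<Longrightarrow> \<exists>g\<in>arith_group. g z \<in> cball 0 \<rho>"
    by (rule arith_cocompact) (rule that)
  define K where "K = 64 / (1 - \<rho>\<^sup>2)\<^sup>2"
  have "\<exists>\<Gamma>S F. surface_group \<Gamma>S \<and> branched_double_cover \<Gamma>S arith_group F \<and>
    0 \<le> sup_ratio F \<and> sup_ratio F \<le> 64 * (1 / real (Suc i)) / (1 - \<rho>\<^sup>2)\<^sup>2" for i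
    by (rule double_cover_with_small_ratio[OF _ \<rho>]) auto
  then obtain \<Gamma>S F where SF: "\<And>i. surface_group (\<Gamma>S i)" "\<And>i. branched_double_cover (\<Gamma>S i) arith_group (F i)"
    "\<And>i. 0 \<le> sup_ratio (F i)" "\<And>i. sup_ratio (F i) \<le> 64 * (1 / real (Suc i)) / (1 - \<rho>\<^sup>2)\<^sup>2"
    by metis
  have "(\<lambda>i. sup_ratio (F i)) \<longlonglongrightarrow> 0"
  proof (rule tendsto_sandwich[of "\<lambda>_. 0" _ _ "\<lambda>i. K * (1 / real (Suc i))"])
    have "(\<lambda>i. K * (1 / real (Suc i))) \<longlonglongrightarrow> K * 0"
      using LIMSEQ_inverse_real_of_nat by (intro tendsto_intros) (simp add: inverse_eq_divide)
    then show "(\<lambda>i. K * (1 / real (Suc i))) \<longlonglongrightarrow> 0" by simp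
    show "eventually (\<lambda>i. sup_ratio (F i) \<le> K * (1 / real (Suc i))) sequentially"
      using SF(4) by (intro always_eventually allI) (simp only: K_def times_divide_eq_left)
    show "eventually (\<lambda>i. 0 \<le> sup_ratio (F i)) sequentially" using SF(3) by simp
  qed simp
  then show ?thesis
    using SF(1,2) arith_group_surface_group
    by (intro exI[of _ \<Gamma>S] exI[of _ "\<lambda>_. arith_group"] exI[of _ F]) simp
qed

end
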